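(* Let $\kappa\in\{1,-1\}$ and let $\Phi_t$ be the flow on $X$ of $i\partial_tq=-\frac12\partial_x^2q+\kappa|q|^2q$. Let $q_0\in X\cap\mathrm{AP}(\mathbb R)$ and $q(t)=\Phi_t(q_0)$. Then $q(t)\in X\cap\mathrm{AP}(\mathbb R)$ for every $t\in\mathbb R$, and $$\Gamma(q(t))=\Gamma(q_0)\qquad(t\in\mathbb R).$$ Moreover, for every $t$ the map $\Phi_t$ restricts to a homeomorphism between the spatial translation hulls of $q_0$ and of $q(t)$ in $X$, and intertwines translations.
   Context: Choose a real, even $\chi\in C_c^\infty((-1,1))$ with $\sum_{k\in\mathbb Z}\chi(\xi-k)=1$. With $\widehat f(\xi)=\int e^{-ix\xi}f(x)\,dx$, put $\Box_kf=\mathcal F^{-1}(\chi(\xi-k)\widehat f(\xi))$, $\langle k\rangle=(1+k^2)^{1/2}$. For $s\ge0$, $X_s=M^s_{\infty,1}(\mathbb R)=\{f\in\mathcal S'(\mathbb R):\|f\|_s:=\sum_{k}\langle k\rangle^s\|\Box_kf\|_\infty<\infty\}$, and $X=X_5$ (complex-valued, identified with bounded uniformly continuous representatives). Flow: for every $q_0\in X$ there is a global classical solution $q\in C(\mathbb R;X)\cap C^1(\mathbb R;X_3)$ of the equation with $q(0)=q_0$, unique among classical solutions $v$ with $v,v_x$ bounded on every strip $[-T,T]\times\mathbb R$, $T<\infty$; $\Phi_t(q_0)=q(t)$. $\mathrm{AP}(\mathbb R)$ is the space of Bohr almost periodic functions (uniform limits of trigonometric polynomials $\sum_jc_je^{i\lambda_jx}$,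 $\lambda_j\in\mathbb R$). $\Gamma(f)$ is the additive subgroup of $\mathbb R$ generated by the frequencies at which $f$ has a nonzero Bohr Fourier coefficient. With $(\mathcal T_yf)(x)=f(x+y)$, the spatial translation hull of $f$ in $X$ is the closure of $\{\mathcal T_yf:y\in\mathbb R\}$ in $X$, with the norm topology of $X$. *)

theory Defs
  imports "HOL-Analysis.Analysis" "HOL-Computational_Algebra.Group_Closure"
begin

section \<open>Schwartz functions and tempered distributions on the real line\<close>

definition vderiv :: "(real \<Rightarrow> 'a::real_normed_vector) \<Rightarrow> real \<Rightarrow> 'a" where
  "vderiv f x = vector_derivative f (at x)"

definition smooth :: "(real \<Rightarrow> 'a::real_normed_vector) \<Rightarrow> bool" where
  "smooth f \<longleftrightarrow> (\<forall>n x. (vderiv ^^ n) f differentiable (at x))"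

definition schwartz :: "(real \<Rightarrow> complex) set" where
  "schwartz = {\<phi>. smooth \<phi> \<and>
     (\<forall>m n. bounded (range (\<lambda>x. x ^ m *\<^sub>R (vderiv ^^ n) \<phi> x)))}"

definition schwartz_seminorm :: "nat \<Rightarrow> nat \<Rightarrow> (real \<Rightarrow> complex) \<Rightarrow> real" where
  "schwartz_seminorm m n \<phi> = (SUP x. norm (x ^ m *\<^sub>R (vderiv ^^ n) \<phi> x))"

text \<open>A distribution is a functional on test functions; only its values on the
  set \<^const>\<open>schwartz\<close> are relevant.\<close>

type_synonym distribution = "(real \<Rightarrow> complex) \<Rightarrow> complex"

definition tempered :: "distribution \<Rightarrow> bool" where
  "tempered u \<longleftrightarrow>
     (\<forall>\<phi>\<in>schwartz. \<forall>\<psi>\<in>schwartz. u (\<lambda>x. \<phi> x + \<psi> x) = u \<phi> + u \<psi>) \<and>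
     (\<forall>c. \<forall>\<phi>\<in>schwartz. u (\<lambda>x. c * \<phi> x) = c * u \<phi>) \<and>
     (\<exists>C N. \<forall>\<phi>\<in>schwartz. norm (u \<phi>) \<le> C * (\<Sum>m\<le>N. \<Sum>n\<le>N. schwartz_seminorm m n \<phi>))"

definition regular_dist :: "(real \<Rightarrow> complex) \<Rightarrow> distribution" where
  "regular_dist f = (\<lambda>\<phi>. LINT x|lborel. f x * \<phi> x)"

definition fourier :: "(real \<Rightarrow> complex) \<Rightarrow> real \<Rightarrow> complex" where
  "fourier f \<xi> = (LINT x|lborel. exp (- (\<i> * of_real x * of_real \<xi>)) * f x)"

definition inv_fourier :: "(real \<Rightarrow> complex) \<Rightarrow> real \<Rightarrow> complex" where
  "inv_fourier g x = (LINT \<xi>|lborel. exp (\<i> * of_real x * of_real \<xi>) * g \<xi>) / of_real (2 * pi)"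

text \<open>The operations on distributions are the transposes of those on test functions.\<close>

definition dist_fourier :: "distribution \<Rightarrow> distribution" where
  "dist_fourier u = (\<lambda>\<phi>. u (fourier \<phi>))"

definition dist_inv_fourier :: "distribution \<Rightarrow> distribution" where
  "dist_inv_fourier u = (\<lambda>\<phi>. u (inv_fourier \<phi>))"

definition dist_mult :: "(real \<Rightarrow> complex) \<Rightarrow> distribution \<Rightarrow> distribution" where
  "dist_mult m u = (\<lambda>\<phi>. u (\<lambda>\<xi>. m \<xi> * \<phi> \<xi>))"

text \<open>The value is \<open>\<infinity>\<close> (the infimum of the empty set) if the distribution is not
  given by an essentially bounded function.\<close>

definition Linf_norm :: "distribution \<Rightarrow> ennreal" where
  "Linf_norm u = Inf {ennreal C | C. \<exists>g. g \<in> borel_measurable lborel \<and>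
     (AE x in lborel. norm (g x) \<le> C) \<and> (\<forall>\<phi>\<in>schwartz. u \<phi> = regular_dist g \<phi>)}"


section \<open>The modulation spaces\<close>

definition uniform_cutoff :: "(real \<Rightarrow> real) \<Rightarrow> bool" where
  "uniform_cutoff \<sigma> \<longleftrightarrow> smooth \<sigma> \<and> closure {\<xi>. \<sigma> \<xi> \<noteq> 0} \<subseteq> {-1<..<1} \<and>
     (\<forall>\<xi>. \<sigma> (- \<xi>) = \<sigma> \<xi>) \<and>
     (\<forall>\<xi>. ((\<lambda>k::int. \<sigma> (\<xi> - of_int k)) has_sum 1) UNIV)"

definition box_op :: "(real \<Rightarrow> real) \<Rightarrow> int \<Rightarrow> distribution \<Rightarrow> distribution" where
  "box_op \<sigma> k u =
     dist_inv_fourier (dist_mult (\<lambda>\<xi>. of_real (\<sigma> (\<xi> - of_int k))) (dist_fourier u))"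

definition japanese_bracket :: "int \<Rightarrow> real" where
  "japanese_bracket k = sqrt (1 + (of_int k)\<^sup>2)"

definition modulation_norm :: "(real \<Rightarrow> real) \<Rightarrow> real \<Rightarrow> distribution \<Rightarrow> ennreal" where
  "modulation_norm \<sigma> s u =
     (\<Sum>\<^sub>\<infinity>k::int. ennreal (japanese_bracket k powr s) * Linf_norm (box_op \<sigma> k u))"

definition modulation_space :: "(real \<Rightarrow> real) \<Rightarrow> real \<Rightarrow> distribution set" where
  "modulation_space \<sigma> s = {u. tempered u \<and> modulation_norm \<sigma> s u < \<infinity>}"

text \<open>For \<open>s \<ge> 0\<close> every element of the modulation space has a unique bounded
  uniformly continuous representative; \<open>X_space\<close> is the space of these.\<close>

definition X_space :: "(real \<Rightarrow> real) \<Rightarrow> real \<Rightarrow> (real \<Rightarrow> complex) set" where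
  "X_space \<sigma> s = {f. bounded (range f) \<and> uniformly_continuous_on UNIV f \<and>
     regular_dist f \<in> modulation_space \<sigma> s}"

definition X_norm :: "(real \<Rightarrow> real) \<Rightarrow> real \<Rightarrow> (real \<Rightarrow> complex) \<Rightarrow> ennreal" where
  "X_norm \<sigma> s f = modulation_norm \<sigma> s (regular_dist f)"

definition X_dist ::
  "(real \<Rightarrow> real) \<Rightarrow> real \<Rightarrow> (real \<Rightarrow> complex) \<Rightarrow> (real \<Rightarrow> complex) \<Rightarrow> real" where
  "X_dist \<sigma> s f g = enn2real (X_norm \<sigma> s (\<lambda>x. f x - g x))"

definition X_topology :: "(real \<Rightarrow> real) \<Rightarrow> real \<Rightarrow> (real \<Rightarrow> complex) topology" where
  "X_topology \<sigma> s = Metric_space.mtopology (X_space \<sigma> s) (X_dist \<sigma> s)"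


section \<open>The cubic nonlinear Schroedinger flow\<close>

text \<open>Functions of time and space are curried, time first.\<close>

definition dt :: "(real \<Rightarrow> real \<Rightarrow> complex) \<Rightarrow> real \<Rightarrow> real \<Rightarrow> complex" where
  "dt v t x = vderiv (\<lambda>s. v s x) t"

definition dx :: "(real \<Rightarrow> real \<Rightarrow> complex) \<Rightarrow> real \<Rightarrow> real \<Rightarrow> complex" where
  "dx v t x = vderiv (v t) x"

definition classical_solution :: "real \<Rightarrow> (real \<Rightarrow> real \<Rightarrow> complex) \<Rightarrow> bool" where
  "classical_solution \<kappa> v \<longleftrightarrow>
     (\<forall>t x. (\<lambda>s. v s x) differentiable (at t) \<and> v t differentiable (at x) \<and>
            dx v t differentiable (at x)) \<and>
     continuous_on UNIV (\<lambda>(t, x). v t x) \<and>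
     continuous_on UNIV (\<lambda>(t, x). dt v t x) \<and>
     continuous_on UNIV (\<lambda>(t, x). dx v t x) \<and>
     continuous_on UNIV (\<lambda>(t, x). dx (dx v) t x) \<and>
     (\<forall>t x. \<i> * dt v t x =
        - (1 / 2) * dx (dx v) t x + of_real \<kappa> * of_real ((norm (v t x))\<^sup>2) * v t x)"

definition bounded_on_strips :: "(real \<Rightarrow> real \<Rightarrow> complex) \<Rightarrow> bool" where
  "bounded_on_strips v \<longleftrightarrow> (\<forall>T. bounded ((\<lambda>(t, x). v t x) ` ({-T..T} \<times> UNIV)))"

definition C0_X :: "(real \<Rightarrow> real) \<Rightarrow> real \<Rightarrow> (real \<Rightarrow> real \<Rightarrow> complex) \<Rightarrow> bool" where
  "C0_X \<sigma> s q \<longleftrightarrow> (\<forall>t. q t \<in> X_space \<sigma> s) \<and> continuous_map euclideanreal (X_topology \<sigma> s) q"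

definition C1_X :: "(real \<Rightarrow> real) \<Rightarrow> real \<Rightarrow> (real \<Rightarrow> real \<Rightarrow> complex) \<Rightarrow> bool" where
  "C1_X \<sigma> s q \<longleftrightarrow> (\<forall>t. q t \<in> X_space \<sigma> s) \<and>
     (\<exists>p. C0_X \<sigma> s p \<and>
       (\<forall>t. ((\<lambda>h. X_norm \<sigma> s (\<lambda>x. (q (t + h) x - q t x) / of_real h - p t x)) \<longlongrightarrow> 0) (at 0)))"

text \<open>\<open>\<Phi>\<close> is the flow on \<open>X_space \<sigma> 5\<close>: orbits are the global classical solutions
  furnished by the well-posedness theory. Values of \<open>\<Phi> t\<close> outside that space are
  unconstrained.\<close>

definition nls_flow ::
  "(real \<Rightarrow> real) \<Rightarrow> real \<Rightarrow> (real \<Rightarrow> (real \<Rightarrow> complex) \<Rightarrow> (real \<Rightarrow> complex)) \<Rightarrow> bool" where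
  "nls_flow \<sigma> \<kappa> \<Phi> \<longleftrightarrow> (\<forall>q0 \<in> X_space \<sigma> 5.
     classical_solution \<kappa> (\<lambda>t. \<Phi> t q0) \<and> C0_X \<sigma> 5 (\<lambda>t. \<Phi> t q0) \<and> C1_X \<sigma> 3 (\<lambda>t. \<Phi> t q0) \<and>
     \<Phi> 0 q0 = q0 \<and>
     (\<forall>v. classical_solution \<kappa> v \<and> bounded_on_strips v \<and> bounded_on_strips (dx v) \<and> v 0 = q0
          \<longrightarrow> v = (\<lambda>t. \<Phi> t q0)))"


section \<open>Almost periodic functions and translation hulls\<close>

definition trig_poly :: "(real \<Rightarrow> complex) \<Rightarrow> bool" where
  "trig_poly p \<longleftrightarrow>
     (\<exists>F c. finite F \<and> p = (\<lambda>x. \<Sum>\<omega>\<in>F. c \<omega> * exp (\<i> * of_real \<omega> * of_real x)))"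

definition AP :: "(real \<Rightarrow> complex) set" where
  "AP = {f. \<exists>P. (\<forall>n. trig_poly (P n)) \<and> uniform_limit UNIV P f sequentially}"

definition bohr_coeff :: "(real \<Rightarrow> complex) \<Rightarrow> real \<Rightarrow> complex" where
  "bohr_coeff f \<omega> = Lim at_top (\<lambda>T::real.
     integral {-T..T} (\<lambda>x. f x * exp (- (\<i> * of_real \<omega> * of_real x))) / of_real (2 * T))"

definition frequency_module :: "(real \<Rightarrow> complex) \<Rightarrow> real set" where
  "frequency_module f = group_closure {\<omega>. bohr_coeff f \<omega> \<noteq> 0}"

definition translate :: "real \<Rightarrow> (real \<Rightarrow> complex) \<Rightarrow> (real \<Rightarrow> complex)" where
  "translate y f = (\<lambda>x. f (x + y))"

definition translation_hull :: "(real \<Rightarrow> real) \<Rightarrow> (real \<Rightarrow> complex) \<Rightarrow> (real \<Rightarrow> complex) set" where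
  "translation_hull \<sigma> f = (X_topology \<sigma> 5) closure_of (range (\<lambda>y. translate y f))"

end

theory Submission
  imports Defs "HOL-Probability.Probability"
begin

text \<open>The hull of \<open>q0\<close> consists of limits of translates, and every \<open>\<box>\<^sub>k\<close> is a convolution with an
  integrable kernel, so all elements \<open>g\<close> of the hull share the tail bound
  \<open>\<parallel>\<box>\<^sub>k g\<parallel> \<le> \<parallel>\<box>\<^sub>k q0\<parallel>\<close>. Hence on the hull the topology of \<open>X\<close> is the topology of
  uniform convergence, and it suffices to know that the flow is stable in the supremum norm. The free
  Schroedinger group is unbounded there, but two solutions that are bounded together with their
  \<open>x\<close>-derivatives by \<open>M\<close> satisfy a localized \<open>L\<^sup>2\<close> energy estimate on an interval of radius \<open>R\<close>, with
  a flux error \<open>O(1 / R)\<close>; this gives \<open>\<parallel>u(t) - v(t)\<parallel>\<^sup>3 \<le> C (R \<parallel>u(0) - v(0)\<parallel>\<^sup>2 + 1 / R)\<close> for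
  all \<open>R \<ge> 1\<close>. The needed bounds on \<open>q\<close> and \<open>q\<^sub>x\<close> hold since \<open>q\<close> and \<open>q\<^sub>t\<close>, hence by the equation
  \<open>q\<^sub>x\<^sub>x\<close>, are locally bounded in time. Uniqueness gives translation equivariance and the group law, and
  a Bochner-Fejer summation turns the transfer of almost periods from \<open>q0\<close> to \<open>q(t)\<close> into almost
  periodicity together with the inclusion of frequency modules.\<close>

section \<open>Stability of bounded classical solutions\<close>

text \<open>\<open>nls_flow\<close> provides existence, regularity and uniqueness of orbits but no
  continuous dependence on the data, so stability has to come out of the equation itself. A nonzero
  almost periodic function has infinite \<open>L^2\<close> norm on the line, hence the localization;
  its price is a flux density of size \<open>1 / R^2\<close> on an interval of length
  \<open>2 R\<close>. Returning from \<open>L^2\<close> to a point uses the slope bound, which costs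
  the cube. The resulting modulus of continuity depends on the two solutions through
  \<open>M\<close> alone, and \<open>M\<close> is invariant under translations; so one \<delta>
  serves all translates of an orbit, which is the form needed both for almost periods and for hulls.
  Negative times are kept throughout because \<open>\<Phi> (- t)\<close> is the inverse: the reverse
  inclusion of modules and the continuity of the inverse on hulls are the forward statements applied
  to it.\<close>

lemma has_vector_derivative_vderiv:
  "f differentiable (at x) \<Longrightarrow> (f has_vector_derivative vderiv f x) (at x)"
  by (simp add: vderiv_def vector_derivative_works)

lemma vderiv_eqI: "(f has_vector_derivative f') (at x) \<Longrightarrow> vderiv f x = f'"
  by (simp add: vderiv_def vector_derivative_at)

lemma has_vector_derivative_shift_iff:
  fixes f :: "real \<Rightarrow> 'a::real_normed_vector"
  shows "((\<lambda>x. f (x + y)) has_vector_derivative f') (at x) \<longleftrightarrow>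
    (f has_vector_derivative f') (at (x + y))"
proof -
  have shift: "((\<lambda>x. g (x + z)) has_vector_derivative f') (at w)"
    if "(g has_vector_derivative f') (at (w + z))" for g :: "real \<Rightarrow> 'a" and z w
  proof -
    have "((\<lambda>x. x + z) has_vector_derivative 1) (at w)"
      by (auto intro!: derivative_eq_intros)
    from vector_diff_chain_at[OF this that] show ?thesis
      by (simp add: o_def)
  qed
  show ?thesis
    using shift[of f x y] shift[of "\<lambda>x. f (x + y)" "x + y" "- y"] by auto
qed

lemma vderiv_shift:
  fixes f :: "real \<Rightarrow> 'a::real_normed_vector"
  shows "vderiv (\<lambda>x. f (x + y)) x = vderiv f (x + y)"
  unfolding vderiv_def vector_derivative_def has_vector_derivative_shift_iff ..

lemma differentiable_shift_iff:
  fixes f :: "real \<Rightarrow> 'a::real_normed_vector"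
  shows "(\<lambda>x. f (x + y)) differentiable (at x) \<longleftrightarrow> f differentiable (at (x + y))"
  by (metis has_vector_derivative_shift_iff vector_derivative_works differentiableI_vector)

text \<open>Apply the mean value inequality to \<open>f y - y *\<^sub>R f' x\<close> on the unit
  interval to the right of \<open>x\<close>: its derivative \<open>f' y - f' x\<close> has norm at
  most \<open>A\<close> there. So \<open>f' x\<close> differs from \<open>f (x + 1) - f x\<close> by
  at most \<open>A\<close>.\<close>

lemma landau_derivative_bound:
  fixes f :: "real \<Rightarrow> 'a::real_normed_vector"
  assumes f: "\<And>x. (f has_vector_derivative f' x) (at x)"
    and f': "\<And>x. (f' has_vector_derivative f'' x) (at x)"
    and B: "\<And>x. norm (f x) \<le> B" and A: "\<And>x. norm (f'' x) \<le> A"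
  shows "norm (f' x) \<le> 2 * B + A"
proof -
  have f'_diff: "norm (f' y - f' x) \<le> A" if "y \<in> {x..x + 1}" for y
  proof -
    have "norm (f' y - f' x) \<le> A * norm (y - x)"
      by (rule differentiable_bound[where S = UNIV and f' = "\<lambda>x h. h *\<^sub>R f'' x"])
        (use f' A in \<open>auto simp: has_vector_derivative_def mult.commute[of A]
            intro!: onorm_le mult_left_mono\<close>)
    also have "\<dots> \<le> A * 1"
      using that A[of 0] norm_ge_zero[of "f'' 0"] by (intro mult_left_mono) (auto simp del: norm_ge_zero)
    finally show ?thesis by simp
  qed
  define g where "g y = f y - y *\<^sub>R f' x" for y
  have "norm (g (x + 1) - g x) \<le> A * norm (x + 1 - x)"
  proof (rule differentiable_bound[where S = "{x..x + 1}" and f' = "\<lambda>y h. h *\<^sub>R (f' y - f' x)"])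
    fix y assume y: "y \<in> {x..x + 1}"
    have "(g has_vector_derivative (f' y - f' x)) (at y)"
      unfolding g_def by (auto intro!: derivative_eq_intros f)
    then show "(g has_derivative (\<lambda>h. h *\<^sub>R (f' y - f' x))) (at y within {x..x + 1})"
      by (simp add: has_vector_derivative_def has_derivative_at_withinI)
    show "onorm (\<lambda>h. h *\<^sub>R (f' y - f' x)) \<le> A"
      using f'_diff[OF y] by (intro onorm_le) (auto simp: mult.commute[of A] intro: mult_left_mono)
  qed auto
  then have "norm (f (x + 1) - f x - f' x) \<le> A"
    by (simp add: g_def algebra_simps)
  moreover have "f' x = f (x + 1) - f x - (f (x + 1) - f x - f' x)"
    by simp
  ultimately show ?thesis
    using B[of "x + 1"] B[of x]
    by (smt (verit) norm_triangle_ineq4)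
qed

text \<open>The factor \<open>exp (- (L * s))\<close> forwards and \<open>exp (L * s)\<close>
  backwards makes \<open>E s + c / L\<close> monotone; the shift by \<open>c / L\<close> absorbs the
  inhomogeneity. Controlling the absolute value of \<open>E'\<close> gives both time
  directions.\<close>

lemma gronwall_two_sided:
  fixes E E' :: "real \<Rightarrow> real"
  assumes E: "\<And>s. (E has_real_derivative E' s) (at s)"
    and bound: "\<And>s. \<bar>s\<bar> \<le> \<bar>t\<bar> \<Longrightarrow> \<bar>E' s\<bar> \<le> L * E s + c" and L: "L > 0" and c: "c \<ge> 0"
  shows "E t \<le> exp (L * \<bar>t\<bar>) * (E 0 + c / L)"
proof -
  have "E t + c / L \<le> exp (L * \<bar>t\<bar>) * (E 0 + c / L)"
  proof (cases "t \<ge> 0")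
    case True
    define G where "G s = exp (- (L * s)) * (E s + c / L)" for s
    have "G t \<le> G 0"
    proof (rule DERIV_nonpos_imp_nonincreasing[where f = G, OF True])
      fix s assume s: "0 \<le> s" "s \<le> t"
      have "(G has_real_derivative exp (- (L * s)) * (E' s - L * E s - c)) (at s)"
        unfolding G_def using L
        by (auto intro!: derivative_eq_intros E simp: field_simps)
      moreover have "exp (- (L * s)) * (E' s - L * E s - c) \<le> 0"
        using bound[of s] s by (intro mult_nonneg_nonpos) auto
      ultimately show "\<exists>y. (G has_real_derivative y) (at s) \<and> y \<le> 0" by blast
    qed
    then show ?thesis
      using True by (simp add: G_def exp_minus field_simps)
  next
    case False
    define G where "G s = exp (L * s) * (E s + c / L)" for s
    have "G t \<le> G 0"
    proof (rule DERIV_nonneg_imp_nondecreasing[where f = G])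
      fix s assume s: "t \<le> s" "s \<le> 0"
      have "(G has_real_derivative exp (L * s) * (E' s + L * E s + c)) (at s)"
        unfolding G_def using L
        by (auto intro!: derivative_eq_intros E simp: field_simps)
      moreover have "exp (L * s) * (E' s + L * E s + c) \<ge> 0"
        using bound[of s] s by (intro mult_nonneg_nonneg) auto
      ultimately show "\<exists>y. (G has_real_derivative y) (at s) \<and> 0 \<le> y" by blast
    qed (use False in auto)
    then show ?thesis
      using False by (simp add: G_def exp_minus field_simps)
  qed
  moreover have "c / L \<ge> 0"
    using L c by simp
  ultimately show ?thesis by linarith
qed

section \<open>The cubic nonlinearity and pointwise consequences of the equation\<close>

definition cubic :: "complex \<Rightarrow> complex" where
  "cubic z = of_real ((norm z)\<^sup>2) * z"

text \<open>Splitting off \<open>(norm a)\<^sup>2 * (a - b)\<close> contributes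
  \<open>M\<^sup>2\<close>; the remaining difference of squares factors into a sum and a difference
  of norms and contributes \<open>2 * M * M\<close>.\<close>

lemma cubic_lipschitz:
  assumes "norm a \<le> M" "norm b \<le> M"
  shows "norm (cubic a - cubic b) \<le> 3 * M\<^sup>2 * norm (a - b)"
proof -
  have M: "M \<ge> 0" using assms(1) norm_ge_zero order_trans by blast
  have "cubic a - cubic b =
      of_real ((norm a)\<^sup>2) * (a - b) + of_real ((norm a)\<^sup>2 - (norm b)\<^sup>2) * b"
    by (simp add: cubic_def algebra_simps)
  also have "norm \<dots> \<le> (norm a)\<^sup>2 * norm (a - b) + \<bar>(norm a)\<^sup>2 - (norm b)\<^sup>2\<bar> * norm b"
    by (rule order_trans[OF norm_triangle_ineq]) (simp add: norm_mult del: of_real_diff of_real_power)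
  also have "\<dots> \<le> M\<^sup>2 * norm (a - b) + (2 * M * norm (a - b)) * M"
  proof (intro add_mono mult_mono)
    show "(norm a)\<^sup>2 \<le> M\<^sup>2" using assms(1) by (simp add: power_mono)
    have "\<bar>(norm a)\<^sup>2 - (norm b)\<^sup>2\<bar> = (norm a + norm b) * \<bar>norm a - norm b\<bar>"
      by (simp add: power2_eq_square square_diff_square_factored abs_mult)
    also have "\<dots> \<le> (2 * M) * norm (a - b)"
      using assms M by (intro mult_mono norm_triangle_ineq3) auto
    finally show "\<bar>(norm a)\<^sup>2 - (norm b)\<^sup>2\<bar> \<le> 2 * M * norm (a - b)" by simp
  qed (use assms M in auto)
  finally show ?thesis by (simp add: power2_eq_square algebra_simps)
qed

lemma classical_solutionD:
  assumes "classical_solution \<kappa> v"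
  shows "((\<lambda>s. v s x) has_vector_derivative dt v t x) (at t)"
    and "(v t has_vector_derivative dx v t x) (at x)"
    and "(dx v t has_vector_derivative dx (dx v) t x) (at x)"
    and "dt v t x = (\<i> / 2) * dx (dx v) t x - \<i> * of_real \<kappa> * cubic (v t x)"
proof -
  show "((\<lambda>s. v s x) has_vector_derivative dt v t x) (at t)"
    "(v t has_vector_derivative dx v t x) (at x)"
    "(dx v t has_vector_derivative dx (dx v) t x) (at x)"
    using assms has_vector_derivative_vderiv[of "\<lambda>s. v s x" t] has_vector_derivative_vderiv[of "v t" x]
      has_vector_derivative_vderiv[of "dx v t" x]
    by (auto simp: classical_solution_def dt_def dx_def)
  have "\<i> * dt v t x = - (1 / 2) * dx (dx v) t x + of_real \<kappa> * cubic (v t x)"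
    using assms by (simp add: classical_solution_def cubic_def)
  note eq = this
  have "dt v t x = - \<i> * (\<i> * dt v t x)" by simp
  also have "\<dots> = (\<i> / 2) * dx (dx v) t x - \<i> * of_real \<kappa> * cubic (v t x)"
    unfolding eq by (simp add: algebra_simps)
  finally show "dt v t x = (\<i> / 2) * dx (dx v) t x - \<i> * of_real \<kappa> * cubic (v t x)" .
qed

text \<open>Stated for arbitrary continuous arguments so that spatial slices at a fixed time and the
  two-variable integrand in the Leibniz rule are both instances.\<close>

lemma classical_solution_continuous:
  assumes "classical_solution \<kappa> v" "continuous_on S f" "continuous_on S g"
  shows "continuous_on S (\<lambda>p. v (f p) (g p))"
    and "continuous_on S (\<lambda>p. dt v (f p) (g p))"
    and "continuous_on S (\<lambda>p. dx v (f p) (g p))"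
    and "continuous_on S (\<lambda>p. dx (dx v) (f p) (g p))"
proof -
  have *: "continuous_on S (\<lambda>p. h (f p) (g p))"
    if "continuous_on UNIV (\<lambda>(t, x). h t x)" for h :: "real \<Rightarrow> real \<Rightarrow> complex"
    using continuous_on_compose2[OF that, of S "\<lambda>p. (f p, g p)"] assms(2,3)
    by (simp add: continuous_on_Pair)
  show "continuous_on S (\<lambda>p. v (f p) (g p))"
    "continuous_on S (\<lambda>p. dt v (f p) (g p))"
    "continuous_on S (\<lambda>p. dx v (f p) (g p))"
    "continuous_on S (\<lambda>p. dx (dx v) (f p) (g p))"
    using assms(1) by (auto intro!: * simp: classical_solution_def)
qed

section \<open>The localized \<open>L^2\<close> energy of a difference of solutions\<close>

text \<open>A polynomial profile that is integrated only over \<open>{a - R..a + R}\<close>, at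
  whose ends it vanishes. The outer square makes the derivative comparable to the square root of the
  profile, so that the flux can be absorbed into the energy.\<close>

definition bump :: "real \<Rightarrow> real \<Rightarrow> real \<Rightarrow> real" where
  "bump a R x = (1 - ((x - a) / R)\<^sup>2)\<^sup>2"

definition bump' :: "real \<Rightarrow> real \<Rightarrow> real \<Rightarrow> real" where
  "bump' a R x = - (4 * (x - a) / R\<^sup>2) * (1 - ((x - a) / R)\<^sup>2)"

lemma bump_deriv: "R > 0 \<Longrightarrow> (bump a R has_real_derivative bump' a R x) (at x)"
  unfolding bump_def bump'_def
  by (auto intro!: derivative_eq_intros simp: power2_eq_square field_simps)

lemma bump_continuous: "R > 0 \<Longrightarrow> continuous_on S (bump a R)" "R > 0 \<Longrightarrow> continuous_on S (bump' a R)"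
  unfolding bump_def bump'_def by (auto intro!: continuous_intros)

lemma bump_nonneg: "bump a R x \<ge> 0"
  by (simp add: bump_def)

lemma bump_le_1:
  assumes "R > 0" "x \<in> {a - R..a + R}"
  shows "bump a R x \<le> 1"
proof -
  have "\<bar>(x - a) / R\<bar> \<le> 1" using assms by (simp add: abs_le_iff field_simps)
  then have "((x - a) / R)\<^sup>2 \<le> 1" by (simp add: abs_square_le_1)
  then show ?thesis by (simp add: bump_def power_le_one)
qed

lemma bump_ends: "R > 0 \<Longrightarrow> bump a R (a + R) = 0" "R > 0 \<Longrightarrow> bump a R (a - R) = 0"
  by (simp_all add: bump_def)

text \<open>With \<open>y = (x - a) / R\<close> the derivative is
  \<open>- (4 * y / R) * (1 - y\<^sup>2)\<close>; the last factor is the square root of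
  \<open>bump\<close> up to sign, and \<open>\<bar>y\<bar> \<le> 1\<close>.\<close>

lemma bump'_bound:
  assumes "R > 0" "x \<in> {a - R..a + R}"
  shows "\<bar>bump' a R x\<bar> \<le> 4 / R * sqrt (bump a R x)"
proof -
  have 1: "\<bar>(x - a) / R\<bar> \<le> 1" using assms by (simp add: abs_le_iff field_simps)
  then have "((x - a) / R)\<^sup>2 \<le> 1" by (simp add: abs_square_le_1)
  have "\<bar>bump' a R x\<bar> = 4 / R * \<bar>(x - a) / R\<bar> * sqrt (bump a R x)"
  proof -
    have "\<bar>bump' a R x\<bar> = \<bar>4 * (x - a) / R\<^sup>2\<bar> * \<bar>1 - ((x - a) / R)\<^sup>2\<bar>"
      unfolding bump'_def by (simp only: abs_mult abs_minus_cancel)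
    also have "\<bar>1 - ((x - a) / R)\<^sup>2\<bar> = sqrt (bump a R x)"
      unfolding bump_def by (rule real_sqrt_abs[symmetric])
    also have "\<bar>4 * (x - a) / R\<^sup>2\<bar> = 4 / R * \<bar>(x - a) / R\<bar>"
      using assms(1) by (simp only: abs_mult abs_divide abs_numeral) (simp add: power2_eq_square)
    finally show ?thesis .
  qed
  also have "\<dots> \<le> 4 / R * 1 * sqrt (bump a R x)"
    using assms(1) 1 by (intro mult_right_mono mult_left_mono) (auto simp: bump_nonneg)
  finally show ?thesis by simp
qed

definition energy ::
  "real \<Rightarrow> real \<Rightarrow> (real \<Rightarrow> real \<Rightarrow> complex) \<Rightarrow> (real \<Rightarrow> real \<Rightarrow> complex) \<Rightarrow> real \<Rightarrow> real" where
  "energy a R u v t = integral {a - R..a + R} (\<lambda>x. bump a R x * (norm (u t x - v t x))\<^sup>2)"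

text \<open>The integrand of the time derivative of the energy after removal of the exact derivative of
  \<open>bump a R * (w \<bullet> \<i> w\<^sub>x)\<close> with \<open>w = u - v\<close>, which integrates to zero.\<close>

definition energy_flux ::
  "real \<Rightarrow> real \<Rightarrow> real \<Rightarrow> (real \<Rightarrow> real \<Rightarrow> complex) \<Rightarrow> (real \<Rightarrow> real \<Rightarrow> complex) \<Rightarrow> real \<Rightarrow> real \<Rightarrow> real" where
  "energy_flux \<kappa> a R u v t x =
     - bump' a R x * ((u t x - v t x) \<bullet> (\<i> * (dx u t x - dx v t x))) +
     2 * bump a R x * ((u t x - v t x) \<bullet> (- \<i> * of_real \<kappa> * (cubic (u t x) - cubic (v t x))))"

text \<open>For the real inner product, multiplication by \<open>\<i>\<close> is a rotation by a
  right angle. This removes the term quadratic in \<open>w\<^sub>x\<close> that integration by parts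
  produces.\<close>

lemma inner_ii_self: "z \<bullet> (\<i> * z) = 0" for z :: complex
  by (simp add: inner_complex_def)

text \<open>Differentiation under the integral gives
  \<open>2 * bump * (w \<bullet> w\<^sub>t)\<close>. After inserting the equation, the dispersive
  part \<open>bump * (w \<bullet> \<i> w\<^sub>x\<^sub>x)\<close> is integrated by parts; what
  survives is a term with \<open>bump'\<close> that contains one derivative of \<open>w\<close>, and
  the nonlinear term.\<close>

lemma energy_derivative:
  assumes u: "classical_solution \<kappa> u" and v: "classical_solution \<kappa> v" and R: "R > 0"
  shows "(energy a R u v has_real_derivative integral {a - R..a + R} (energy_flux \<kappa> a R u v t)) (at t)"
    and "energy_flux \<kappa> a R u v t integrable_on {a - R..a + R}"
proof -
  define w where "w t x = u t x - v t x" for t x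
  define wt where "wt t x = dt u t x - dt v t x" for t x
  define wx where "wx t x = dx u t x - dx v t x" for t x
  define wxx where "wxx t x = dx (dx u) t x - dx (dx v) t x" for t x
  note cont = classical_solution_continuous[OF u] classical_solution_continuous[OF v]
  note D = classical_solutionD[OF u] classical_solutionD[OF v]
  have wt: "((\<lambda>s. w s x) has_vector_derivative wt t x) (at t)" for t x
    unfolding w_def wt_def by (intro derivative_intros D)
  have wx: "(w t has_vector_derivative wx t x) (at x)" for t x
    unfolding w_def wx_def by (intro derivative_intros D)
  have wxx: "(wx t has_vector_derivative wxx t x) (at x)" for t x
    unfolding wx_def wxx_def by (intro derivative_intros D)
  have cw [continuous_intros]: "continuous_on S (\<lambda>p. w (f p) (g p))"
    "continuous_on S (\<lambda>p. wt (f p) (g p))" "continuous_on S (\<lambda>p. wx (f p) (g p))"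
    "continuous_on S (\<lambda>p. cubic (u (f p) (g p)) - cubic (v (f p) (g p)))"
    if "continuous_on S f" "continuous_on S g" for S :: "'x::topological_space set" and f g
    unfolding w_def wt_def wx_def cubic_def using cont that by (auto intro!: continuous_intros)
  have cb [continuous_intros]: "continuous_on S (\<lambda>p. bump a R (g p))" "continuous_on S (\<lambda>p. bump' a R (g p))"
    if "continuous_on S g" for S :: "'x::topological_space set" and g
    using R that unfolding bump_def bump'_def by (auto intro!: continuous_intros)
  have flux: "energy_flux \<kappa> a R u v t x = - bump' a R x * (w t x \<bullet> (\<i> * wx t x)) +
     2 * bump a R x * (w t x \<bullet> (- \<i> * of_real \<kappa> * (cubic (u t x) - cubic (v t x))))" for t x
    by (simp add: energy_flux_def w_def wx_def)
  have flux_cont: "continuous_on {a - R..a + R} (energy_flux \<kappa> a R u v t)" for t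
    unfolding flux by (intro continuous_intros)
  then show flux_int: "energy_flux \<kappa> a R u v t integrable_on {a - R..a + R}"
    by (rule integrable_continuous_real)
  have "((\<lambda>t. integral (cbox (a - R) (a + R)) (\<lambda>x. bump a R x * (norm (w t x))\<^sup>2)) has_vector_derivative
      integral (cbox (a - R) (a + R)) (\<lambda>x. 2 * bump a R x * (w t x \<bullet> wt t x))) (at t within UNIV)"
  proof (rule leibniz_rule_vector_derivative)
    fix t x
    have "((\<lambda>t. bump a R x * (w t x \<bullet> w t x)) has_vector_derivative
        bump a R x * (w t x \<bullet> wt t x + wt t x \<bullet> w t x)) (at t)"
      by (intro derivative_intros wt bounded_bilinear.has_vector_derivative[OF bounded_bilinear_inner])
    then show "((\<lambda>t. bump a R x * (norm (w t x))\<^sup>2) has_vector_derivative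
        2 * bump a R x * (w t x \<bullet> wt t x)) (at t within UNIV)"
      by (simp add: power2_norm_eq_inner inner_commute mult_ac)
  next
    fix t show "(\<lambda>x. bump a R x * (norm (w t x))\<^sup>2) integrable_on cbox (a - R) (a + R)"
      by (intro integrable_continuous continuous_intros)
  next
    show "continuous_on (UNIV \<times> cbox (a - R) (a + R)) (\<lambda>(t, x). 2 * bump a R x * (w t x \<bullet> wt t x))"
      by (auto simp: split_beta intro!: continuous_intros)
  qed auto
  moreover have "integral {a - R..a + R} (\<lambda>x. 2 * bump a R x * (w t x \<bullet> wt t x)) =
      integral {a - R..a + R} (energy_flux \<kappa> a R u v t)"
  proof -
    define P where "P x = bump a R x * (w t x \<bullet> (\<i> * wx t x))" for x
    define P' where "P' x = 2 * bump a R x * (w t x \<bullet> wt t x) - energy_flux \<kappa> a R u v t x" for x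
    have wt_eq: "wt t x = (\<i> / 2) * wxx t x + - \<i> * of_real \<kappa> * (cubic (u t x) - cubic (v t x))" for x
      unfolding wt_def wxx_def D(4) D(8) by (simp add: algebra_simps)
    have half: "z \<bullet> (\<i> * y / 2) = (z \<bullet> (\<i> * y)) / 2" for z y :: complex
      by (simp add: inner_complex_def field_simps)
    have P': "(P has_vector_derivative P' x) (at x)" for x
    proof -
      have "(P has_vector_derivative
          (bump a R x * (w t x \<bullet> (\<i> * wxx t x) + wx t x \<bullet> (\<i> * wx t x)) +
           bump' a R x * (w t x \<bullet> (\<i> * wx t x)))) (at x)"
        unfolding P_def using bump_deriv[OF R, of a x]
        by (intro derivative_intros wx wxx bounded_bilinear.has_vector_derivative[OF bounded_bilinear_inner])
          (auto simp: has_real_derivative_iff_has_vector_derivative)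
      then show ?thesis
        by (simp add: inner_ii_self P'_def flux wt_eq inner_add_right half algebra_simps)
    qed
    have "(P' has_integral (P (a + R) - P (a - R))) {a - R..a + R}"
      using R by (intro fundamental_theorem_of_calculus) (auto intro: has_vector_derivative_at_within[OF P'])
    then have "integral {a - R..a + R} P' = 0"
      using R by (simp add: P_def bump_ends integral_unique)
    moreover have "integral {a - R..a + R} P' =
        integral {a - R..a + R} (\<lambda>x. 2 * bump a R x * (w t x \<bullet> wt t x)) -
        integral {a - R..a + R} (energy_flux \<kappa> a R u v t)"
      unfolding P'_def by (intro integral_diff flux_int integrable_continuous_real continuous_intros)
    ultimately show ?thesis by simp
  qed
  ultimately show "(energy a R u v has_real_derivative
      integral {a - R..a + R} (energy_flux \<kappa> a R u v t)) (at t)"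
    by (simp add: energy_def[abs_def] w_def has_real_derivative_iff_has_vector_derivative)
qed

text \<open>The flux carries only \<open>sqrt (bump a R x)\<close>, so it is split by
  \<open>2 * p * q \<le> p\<^sup>2 + q\<^sup>2\<close> with \<open>p = r * w\<close> and
  \<open>q = 4 * M / R\<close>: the first square is energy density, which accounts for the
  coefficient \<open>1\<close>, and the second is the error. The coefficient
  \<open>6 * M\<^sup>2\<close> is twice the Lipschitz constant of the cubic.\<close>

lemma energy_flux_bound:
  assumes R: "R > 0" and x: "x \<in> {a - R..a + R}" and \<kappa>: "\<bar>\<kappa>\<bar> \<le> 1"
    and M: "norm (u t x) \<le> M" "norm (v t x) \<le> M" "norm (dx u t x) \<le> M" "norm (dx v t x) \<le> M"
  shows "\<bar>energy_flux \<kappa> a R u v t x\<bar> \<le>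
    (6 * M\<^sup>2 + 1) * (bump a R x * (norm (u t x - v t x))\<^sup>2) + 16 * M\<^sup>2 / R\<^sup>2"
proof -
  define w where "w = norm (u t x - v t x)"
  define r where "r = sqrt (bump a R x)"
  have r: "r \<ge> 0" "bump a R x = r\<^sup>2" by (simp_all add: r_def bump_nonneg)
  have M0: "M \<ge> 0" using order_trans[OF norm_ge_zero M(1)] .
  have "\<bar>bump' a R x * ((u t x - v t x) \<bullet> (\<i> * (dx u t x - dx v t x)))\<bar> \<le> (4 / R * r) * (w * (2 * M))"
    unfolding abs_mult r_def w_def
  proof (intro mult_mono bump'_bound R x)
    have "\<bar>(u t x - v t x) \<bullet> (\<i> * (dx u t x - dx v t x))\<bar> \<le>
        norm (u t x - v t x) * norm (\<i> * (dx u t x - dx v t x))"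
      by (rule Cauchy_Schwarz_ineq2)
    also have "\<dots> \<le> norm (u t x - v t x) * (2 * M)"
      using norm_triangle_ineq4[of "dx u t x" "dx v t x"] M by (intro mult_left_mono) (auto simp: norm_mult)
    finally show "\<bar>(u t x - v t x) \<bullet> (\<i> * (dx u t x - dx v t x))\<bar> \<le> norm (u t x - v t x) * (2 * M)" .
  qed (use R in \<open>auto simp: bump_nonneg\<close>)
  also have "\<dots> = 2 * ((r * w) * (4 * M / R))" by simp
  also have "\<dots> \<le> (r * w)\<^sup>2 + (4 * M / R)\<^sup>2"
    using sum_squares_bound[of "r * w" "4 * M / R"] by simp
  finally have 1: "\<bar>bump' a R x * ((u t x - v t x) \<bullet> (\<i> * (dx u t x - dx v t x)))\<bar> \<le>
      r\<^sup>2 * w\<^sup>2 + 16 * M\<^sup>2 / R\<^sup>2"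
    by (simp add: power_mult_distrib power_divide)
  have "\<bar>(u t x - v t x) \<bullet> (- \<i> * of_real \<kappa> * (cubic (u t x) - cubic (v t x)))\<bar> \<le>
      norm (u t x - v t x) * norm (- \<i> * of_real \<kappa> * (cubic (u t x) - cubic (v t x)))"
    by (rule Cauchy_Schwarz_ineq2)
  also have "\<dots> \<le> w * (3 * M\<^sup>2 * w)"
  proof -
    have "norm (- \<i> * of_real \<kappa> * (cubic (u t x) - cubic (v t x))) \<le> 1 * (3 * M\<^sup>2 * w)"
      unfolding norm_mult w_def using \<kappa> M
      by (intro mult_mono cubic_lipschitz) auto
    then show ?thesis unfolding w_def by (intro mult_left_mono) auto
  qed
  finally have "\<bar>2 * bump a R x * ((u t x - v t x) \<bullet> (- \<i> * of_real \<kappa> * (cubic (u t x) - cubic (v t x))))\<bar>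
      \<le> 2 * r\<^sup>2 * (w * (3 * M\<^sup>2 * w))"
    unfolding abs_mult r(2) by (intro mult_mono) auto
  with 1 show ?thesis
    unfolding energy_flux_def r(2) w_def[symmetric]
    by (simp add: power2_eq_square algebra_simps abs_le_iff)
qed

text \<open>A difference of height \<open>d\<close> at \<open>a\<close> and slope at most
  \<open>2 * M\<close> stays above \<open>d / 2\<close> within distance
  \<open>l = d / (4 * M)\<close>. There the weight is at least \<open>9 / 16\<close>, because
  \<open>l \<le> 1 / 2\<close> and \<open>R \<ge> 1\<close>. Integrating over length
  \<open>2 * l\<close> gives the cube and the constant \<open>9 / (128 * M)\<close>.\<close>

lemma energy_ge_point:
  assumes u: "classical_solution \<kappa> u" and v: "classical_solution \<kappa> v" and R: "R \<ge> 1" and M0: "M > 0"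
    and M: "\<And>x. norm (u t x) \<le> M" "\<And>x. norm (v t x) \<le> M"
      "\<And>x. norm (dx u t x) \<le> M" "\<And>x. norm (dx v t x) \<le> M"
  shows "9 / (128 * M) * norm (u t a - v t a) ^ 3 \<le> energy a R u v t"
proof -
  define w where "w x = u t x - v t x" for x
  define d where "d = norm (w a)"
  define l where "l = d / (4 * M)"
  have "d \<le> 2 * M"
    using norm_triangle_ineq4[of "u t a" "v t a"] M[of a] by (simp add: d_def w_def)
  then have l: "0 \<le> l" "l \<le> 1 / 2"
    using M0 by (auto simp: l_def d_def field_simps)
  have cont: "continuous_on S (\<lambda>x. bump a R x * (norm (w x))\<^sup>2)" for S
    unfolding w_def using R
    by (intro continuous_intros classical_solution_continuous[OF u] classical_solution_continuous[OF v] bump_continuous) auto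
  have low: "9 / 16 * (d\<^sup>2 / 4) \<le> bump a R x * (norm (w x))\<^sup>2" if x: "x \<in> {a - l..a + l}" for x
  proof (rule mult_mono)
    have "\<bar>x - a\<bar> \<le> 1 / 2" using x l unfolding abs_le_iff atLeastAtMost_iff by linarith
    then have "\<bar>(x - a) / R\<bar> \<le> 1 / 2"
      using R by (simp add: divide_le_eq)
    then have "((x - a) / R)\<^sup>2 \<le> (1 / 2)\<^sup>2"
      by (rule power2_le_iff_abs_le[THEN iffD2, rotated]) simp
    then have "(3 / 4)\<^sup>2 \<le> bump a R x"
      unfolding bump_def by (intro power_mono) (auto simp: power2_eq_square)
    then show "9 / 16 \<le> bump a R x" by (simp add: power2_eq_square)
    have "norm (w x - w a) \<le> (2 * M) * norm (x - a)"
    proof (rule differentiable_bound[where S = UNIV and f' = "\<lambda>x h. h *\<^sub>R (dx u t x - dx v t x)"])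
      fix y
      have "(w has_vector_derivative (dx u t y - dx v t y)) (at y)"
        unfolding w_def by (intro derivative_intros classical_solutionD[OF u] classical_solutionD[OF v])
      then show "(w has_derivative (\<lambda>h. h *\<^sub>R (dx u t y - dx v t y))) (at y within UNIV)"
        by (simp add: has_vector_derivative_def)
      have "norm (dx u t y - dx v t y) \<le> 2 * M"
        using norm_triangle_ineq4[of "dx u t y" "dx v t y"] M[of y] by simp
      then show "onorm (\<lambda>h. h *\<^sub>R (dx u t y - dx v t y)) \<le> 2 * M"
        by (intro onorm_le) (auto simp: mult.commute[of "2 * M"] intro: mult_left_mono)
    qed auto
    also have "\<dots> \<le> (2 * M) * l"
      using x M0 by (intro mult_left_mono) (auto simp: abs_le_iff)
    also have "\<dots> = d / 2" using M0 by (simp add: l_def)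
    finally have "d / 2 \<le> norm (w x)"
      using norm_triangle_ineq2[of "w a" "w x"] by (simp add: d_def norm_minus_commute)
    then have "(d / 2)\<^sup>2 \<le> (norm (w x))\<^sup>2"
      by (intro power_mono) (auto simp: d_def)
    then show "d\<^sup>2 / 4 \<le> (norm (w x))\<^sup>2" by (simp add: power_divide)
  qed (auto simp: bump_nonneg)
  have "9 / (128 * M) * d ^ 3 = (2 * l) * (9 / 16 * (d\<^sup>2 / 4))"
    using M0 by (simp add: l_def field_simps power2_eq_square power3_eq_cube)
  also have "\<dots> = integral {a - l..a + l} (\<lambda>x. 9 / 16 * (d\<^sup>2 / 4))"
    using l by simp
  also have "\<dots> \<le> integral {a - l..a + l} (\<lambda>x. bump a R x * (norm (w x))\<^sup>2)"
    using low by (intro integral_le integrable_continuous_real cont) auto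
  also have "\<dots> \<le> integral {a - R..a + R} (\<lambda>x. bump a R x * (norm (w x))\<^sup>2)"
    using l R by (intro integral_subset_le integrable_continuous_real cont) (auto simp: bump_nonneg)
  finally show ?thesis by (simp add: d_def w_def energy_def)
qed

lemma energy_initial:
  assumes "classical_solution \<kappa> u" "classical_solution \<kappa> v" and R: "R > 0"
    and d: "\<And>x. norm (u 0 x - v 0 x) \<le> \<delta>"
  shows "energy a R u v 0 \<le> 2 * R * \<delta>\<^sup>2"
proof -
  have "energy a R u v 0 \<le> integral {a - R..a + R} (\<lambda>x. \<delta>\<^sup>2)"
    unfolding energy_def
  proof (intro integral_le integrable_continuous_real)
    fix x assume x: "x \<in> {a - R..a + R}"
    have "bump a R x * (norm (u 0 x - v 0 x))\<^sup>2 \<le> 1 * \<delta>\<^sup>2"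
      using d by (intro mult_mono bump_le_1 R x power_mono) auto
    then show "bump a R x * (norm (u 0 x - v 0 x))\<^sup>2 \<le> \<delta>\<^sup>2" by simp
  qed (use R in \<open>auto intro!: continuous_intros bump_continuous
      classical_solution_continuous[OF assms(1)] classical_solution_continuous[OF assms(2)]\<close>)
  also have "\<dots> = 2 * R * \<delta>\<^sup>2" using R by simp
  finally show ?thesis .
qed

text \<open>Integrating the error \<open>16 * M\<^sup>2 / R\<^sup>2\<close> over length
  \<open>2 * R\<close> gives the inhomogeneity \<open>32 * M\<^sup>2 / R\<close> for Gronwall's
  inequality, while data that are uniformly \<delta>-close have energy at most
  \<open>2 * R * \<delta>\<^sup>2\<close>. The radius stays free because the two contributions pull
  it in opposite directions.\<close>

lemma classical_solution_stability_estimate: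
  assumes u: "classical_solution \<kappa> u" and v: "classical_solution \<kappa> v" and \<kappa>: "\<bar>\<kappa>\<bar> \<le> 1"
    and R: "R \<ge> 1" and M0: "M > 0" and t: "\<bar>t\<bar> \<le> T"
    and M: "\<And>s x. \<bar>s\<bar> \<le> T \<Longrightarrow> norm (u s x) \<le> M" "\<And>s x. \<bar>s\<bar> \<le> T \<Longrightarrow> norm (v s x) \<le> M"
      "\<And>s x. \<bar>s\<bar> \<le> T \<Longrightarrow> norm (dx u s x) \<le> M" "\<And>s x. \<bar>s\<bar> \<le> T \<Longrightarrow> norm (dx v s x) \<le> M"
    and d: "\<And>x. norm (u 0 x - v 0 x) \<le> \<delta>"
  shows "norm (u t a - v t a) ^ 3 \<le>
    128 * M / 9 * exp ((6 * M\<^sup>2 + 1) * T) * (2 * R * \<delta>\<^sup>2 + 32 * M\<^sup>2 / R)"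
proof -
  define L where "L = 6 * M\<^sup>2 + 1"
  have L: "L \<ge> 1" by (simp add: L_def)
  have R0: "R > 0" using R by simp
  have flux: "\<bar>integral {a - R..a + R} (energy_flux \<kappa> a R u v s)\<bar> \<le> L * energy a R u v s + 32 * M\<^sup>2 / R"
    if s: "\<bar>s\<bar> \<le> \<bar>t\<bar>" for s
  proof -
    have int: "(\<lambda>x. bump a R x * (norm (u s x - v s x))\<^sup>2) integrable_on {a - R..a + R}"
      using R0 by (auto intro!: integrable_continuous_real continuous_intros bump_continuous
          classical_solution_continuous[OF u] classical_solution_continuous[OF v])
    have int': "(\<lambda>x. L * (bump a R x * (norm (u s x - v s x))\<^sup>2) + 16 * M\<^sup>2 / R\<^sup>2)
        integrable_on {a - R..a + R}"
      using R0 by (auto intro!: integrable_continuous_real continuous_intros bump_continuous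
          classical_solution_continuous[OF u] classical_solution_continuous[OF v])
    have "norm (integral {a - R..a + R} (energy_flux \<kappa> a R u v s)) \<le>
        integral {a - R..a + R} (\<lambda>x. L * (bump a R x * (norm (u s x - v s x))\<^sup>2) + 16 * M\<^sup>2 / R\<^sup>2)"
    proof (rule integral_norm_bound_integral)
      fix x assume "x \<in> {a - R..a + R}"
      then show "norm (energy_flux \<kappa> a R u v s x) \<le>
          L * (bump a R x * (norm (u s x - v s x))\<^sup>2) + 16 * M\<^sup>2 / R\<^sup>2"
        unfolding L_def real_norm_def using s t by (intro energy_flux_bound R0 \<kappa> M) auto
    qed (rule energy_derivative(2)[OF u v R0] int')+
    also have "\<dots> = L * energy a R u v s + integral {a - R..a + R} (\<lambda>x. 16 * M\<^sup>2 / R\<^sup>2)"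
      unfolding energy_def using int
      by (subst integral_add) (auto intro: integrable_on_mult_right)
    also have "integral {a - R..a + R} (\<lambda>x. 16 * M\<^sup>2 / R\<^sup>2) = 32 * M\<^sup>2 / R"
      using R0 by (simp add: power2_eq_square)
    finally show ?thesis by simp
  qed
  have "9 / (128 * M) * norm (u t a - v t a) ^ 3 \<le> energy a R u v t"
    using t by (intro energy_ge_point[OF u v R M0] M)
  also have "\<dots> \<le> exp (L * \<bar>t\<bar>) * (energy a R u v 0 + 32 * M\<^sup>2 / R / L)"
    using L R0 M0 by (intro gronwall_two_sided[OF energy_derivative(1)[OF u v R0] flux]) auto
  also have "\<dots> \<le> exp (L * T) * (2 * R * \<delta>\<^sup>2 + 32 * M\<^sup>2 / R)"
  proof (intro mult_mono add_mono energy_initial[OF u v R0 d])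
    show "32 * M\<^sup>2 / R / L \<le> 32 * M\<^sup>2 / R"
      using L R0 by (simp add: divide_le_eq mult_le_cancel_left1)
    have "energy a R u v 0 \<ge> 0"
      unfolding energy_def using R0
      by (intro integral_nonneg integrable_continuous_real continuous_intros bump_continuous
          classical_solution_continuous[OF u] classical_solution_continuous[OF v]) (auto simp: bump_nonneg)
    then show "0 \<le> energy a R u v 0 + 32 * M\<^sup>2 / R / L"
      using L R0 by simp
  qed (use L t in auto)
  finally show ?thesis
    using M0 by (simp add: L_def field_simps)
qed

text \<open>The radius is fixed first, so large that its error takes at most half of
  \<open>\<eta> ^ 3\<close>; then \<open>\<delta>\<close> is chosen to use up the other half. All
  solutions are quantified after \<open>\<delta>\<close>, so it works for every pair obeying the
  bound \<open>M\<close> up to time \<open>T\<close>.\<close>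

lemma classical_solution_stability:
  fixes M T \<eta> :: real
  assumes "M > 0" "\<eta> > 0"
  obtains \<delta> where "\<delta> > 0"
    "\<And>\<kappa> u v t x. \<lbrakk>classical_solution \<kappa> u; classical_solution \<kappa> v; \<bar>\<kappa>\<bar> \<le> 1; \<bar>t\<bar> \<le> T;
      \<And>s x. \<bar>s\<bar> \<le> T \<Longrightarrow> norm (u s x) \<le> M; \<And>s x. \<bar>s\<bar> \<le> T \<Longrightarrow> norm (v s x) \<le> M;
      \<And>s x. \<bar>s\<bar> \<le> T \<Longrightarrow> norm (dx u s x) \<le> M; \<And>s x. \<bar>s\<bar> \<le> T \<Longrightarrow> norm (dx v s x) \<le> M;
      \<And>x. norm (u 0 x - v 0 x) \<le> \<delta>\<rbrakk> \<Longrightarrow> norm (u t x - v t x) \<le> \<eta>"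
proof -
  define C where "C = 128 * M / 9 * exp ((6 * M\<^sup>2 + 1) * T)"
  have C: "C > 0" using assms by (simp add: C_def)
  define R where "R = 1 + 64 * C * M\<^sup>2 / \<eta> ^ 3"
  have R: "R \<ge> 1" using C assms by (simp add: R_def)
  have "C * 32 * M\<^sup>2 \<le> R * (\<eta> ^ 3 / 2)"
    using assms C by (simp add: R_def field_simps)
  then have CR: "C * (32 * M\<^sup>2 / R) \<le> \<eta> ^ 3 / 2"
    using R by (simp add: divide_le_eq mult_ac)
  define \<delta> where "\<delta> = sqrt (\<eta> ^ 3 / (4 * C * R))"
  have \<delta>: "\<delta> > 0" using assms C R by (simp add: \<delta>_def)
  have "\<delta>\<^sup>2 = \<eta> ^ 3 / (4 * C * R)" using assms C R by (simp add: \<delta>_def)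
  then have C\<delta>: "C * (2 * R * \<delta>\<^sup>2) = \<eta> ^ 3 / 2" using C R by (simp add: field_simps)
  show thesis
  proof (rule that[OF \<delta>])
    fix \<kappa> u v t x
    assume *: "classical_solution \<kappa> u" "classical_solution \<kappa> v" "\<bar>\<kappa>\<bar> \<le> 1"
      and t: "\<bar>t\<bar> \<le> T" and M: "\<And>s x. \<bar>s\<bar> \<le> T \<Longrightarrow> norm (u s x) \<le> M" "\<And>s x. \<bar>s\<bar> \<le> T \<Longrightarrow> norm (v s x) \<le> M"
      "\<And>s x. \<bar>s\<bar> \<le> T \<Longrightarrow> norm (dx u s x) \<le> M" "\<And>s x. \<bar>s\<bar> \<le> T \<Longrightarrow> norm (dx v s x) \<le> M"
      and d: "\<And>x. norm (u 0 x - v 0 x) \<le> \<delta>"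
    have "norm (u t x - v t x) ^ 3 \<le> C * (2 * R * \<delta>\<^sup>2 + 32 * M\<^sup>2 / R)"
      unfolding C_def by (rule classical_solution_stability_estimate[OF * R assms(1) t M d])
    also have "\<dots> \<le> \<eta> ^ 3"
      using CR C\<delta> by (simp add: distrib_left)
    finally show "norm (u t x - v t x) \<le> \<eta>"
      using assms by (simp add: power_mono_iff)
  qed
qed

section \<open>Bochner-Fejer approximation\<close>

abbreviation chr :: "real \<Rightarrow> real \<Rightarrow> complex" where
  "chr \<omega> x \<equiv> exp (\<i> * of_real \<omega> * of_real x)"

definition avg :: "real \<Rightarrow> (real \<Rightarrow> complex) \<Rightarrow> complex" where
  "avg T f = integral {-T..T} f / of_real (2 * T)"

text \<open>Uniform continuity of \<open>g\<close> under translations, measured by a Bohr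
  neighbourhood of \<open>0\<close>: whatever is nearly a period of the characters in
  \<open>\<Lambda>\<close> is nearly a period of \<open>g\<close>. Recording
  \<open>\<Lambda>\<close> is what carries frequency information through the nonlinear flow, since
  the condition passes from one function to another with the same \<open>\<Lambda>\<close>.\<close>

definition ap_modulus :: "(real \<Rightarrow> complex) \<Rightarrow> real set \<Rightarrow> real \<Rightarrow> real \<Rightarrow> bool" where
  "ap_modulus g \<Lambda> \<delta> \<eta> \<longleftrightarrow>
     (\<forall>\<tau>. (\<forall>\<omega>\<in>\<Lambda>. norm (chr \<omega> \<tau> - 1) \<le> \<delta>) \<longrightarrow> (\<forall>x. norm (g (x + \<tau>) - g x) \<le> \<eta>))"

definition trig_over :: "real set \<Rightarrow> (real \<Rightarrow> complex) \<Rightarrow> bool" where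
  "trig_over S p \<longleftrightarrow> (\<exists>F c. finite F \<and> F \<subseteq> S \<and> p = (\<lambda>x. \<Sum>\<omega>\<in>F. c \<omega> * chr \<omega> x))"

lemma norm_chr [simp]: "norm (chr \<omega> x) = 1"
  by simp

lemma chr_add_right: "chr \<omega> (x + y) = chr \<omega> x * chr \<omega> y"
  by (simp add: exp_add[symmetric] algebra_simps)

lemma chr_add_left: "chr (\<omega> + \<mu>) x = chr \<omega> x * chr \<mu> x"
  by (simp add: exp_add[symmetric] algebra_simps)

lemma chr_0 [simp]: "chr 0 x = 1" "chr \<omega> 0 = 1"
  by simp_all

lemma chr_minus: "chr (- \<omega>) x = cnj (chr \<omega> x)"
  by (simp add: exp_cnj)

lemma chr_mult_minus [simp]: "chr \<omega> x * chr (- \<omega>) x = 1" "chr (- \<omega>) x * chr \<omega> x = 1"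
  by (simp_all add: exp_add[symmetric])

lemma trig_poly_iff: "trig_poly p \<longleftrightarrow> trig_over UNIV p"
  by (simp add: trig_poly_def trig_over_def)

lemma trig_over_mono: "trig_over S p \<Longrightarrow> S \<subseteq> S' \<Longrightarrow> trig_over S' p"
  unfolding trig_over_def by blast

text \<open>Equal frequencies are collected into one coefficient. Those with zero weight are exempt
  from \<open>S\<close>; this is how vanishing mean values drop out of the spectrum of the Fejer
  polynomial.\<close>

lemma trig_over_sum:
  assumes I: "finite I" and \<mu>: "\<And>i. i \<in> I \<Longrightarrow> w i \<noteq> 0 \<Longrightarrow> \<mu> i \<in> S"
  shows "trig_over S (\<lambda>x. \<Sum>i\<in>I. w i * chr (\<mu> i) x)"
proof -
  define J where "J = {i \<in> I. w i \<noteq> 0}"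
  have J: "finite J" "\<mu> ` J \<subseteq> S" using assms by (auto simp: J_def)
  have "(\<Sum>i\<in>I. w i * chr (\<mu> i) x) = (\<Sum>\<omega>\<in>\<mu> ` J. (\<Sum>i\<in>{i\<in>J. \<mu> i = \<omega>}. w i) * chr \<omega> x)" for x
  proof -
    have "(\<Sum>i\<in>I. w i * chr (\<mu> i) x) = (\<Sum>i\<in>J. w i * chr (\<mu> i) x)"
      using I unfolding J_def by (intro sum.mono_neutral_right) auto
    also have "\<dots> = (\<Sum>\<omega>\<in>\<mu> ` J. \<Sum>i\<in>{i\<in>J. \<mu> i = \<omega>}. w i * chr (\<mu> i) x)"
      by (rule sum.image_gen[OF J(1)])
    also have "\<dots> = (\<Sum>\<omega>\<in>\<mu> ` J. (\<Sum>i\<in>{i\<in>J. \<mu> i = \<omega>}. w i) * chr \<omega> x)"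
      by (intro sum.cong refl) (auto simp: sum_distrib_right)
    finally show ?thesis .
  qed
  then show ?thesis
    unfolding trig_over_def using J
    by (intro exI[of _ "\<mu> ` J"] exI[of _ "\<lambda>\<omega>. \<Sum>i\<in>{i\<in>J. \<mu> i = \<omega>}. w i"]) auto
qed

lemma trig_over_continuous: "trig_over S p \<Longrightarrow> continuous_on A p"
  by (auto simp: trig_over_def intro!: continuous_intros)

text \<open>Each term moves by at most its coefficient times
  \<open>norm (chr \<omega> \<tau> - 1)\<close>, so \<open>\<delta>\<close> is \<open>\<eta>\<close>
  over the sum of the coefficients; the \<open>1\<close> added to that sum keeps it
  positive.\<close>

lemma trig_over_ap_modulus:
  assumes "trig_over S p" "\<eta> > 0"
  obtains \<Lambda> \<delta> where "finite \<Lambda>" "\<Lambda> \<subseteq> S" "\<delta> > 0" "ap_modulus p \<Lambda> \<delta> \<eta>"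
proof -
  obtain F c where F: "finite F" "F \<subseteq> S" and p: "p = (\<lambda>x. \<Sum>\<omega>\<in>F. c \<omega> * chr \<omega> x)"
    using assms(1) by (auto simp: trig_over_def)
  define C where "C = (\<Sum>\<omega>\<in>F. norm (c \<omega>)) + 1"
  have C: "C > 0" by (simp add: C_def sum_nonneg add_nonneg_pos)
  show thesis
  proof (rule that[OF F])
    show "\<eta> / C > 0" using C assms by simp
    show "ap_modulus p F (\<eta> / C) \<eta>"
      unfolding ap_modulus_def
    proof (intro allI impI)
      fix \<tau> x assume *: "\<forall>\<omega>\<in>F. norm (chr \<omega> \<tau> - 1) \<le> \<eta> / C"
      have "p (x + \<tau>) - p x = (\<Sum>\<omega>\<in>F. c \<omega> * chr \<omega> x * (chr \<omega> \<tau> - 1))"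
        unfolding p chr_add_right by (simp add: sum_subtractf[symmetric] algebra_simps)
      also have "norm \<dots> \<le> (\<Sum>\<omega>\<in>F. norm (c \<omega>) * (\<eta> / C))"
        by (rule sum_norm_le) (use * in \<open>auto simp: norm_mult simp del: times_divide_eq_right intro!: mult_left_mono\<close>)
      also have "\<dots> \<le> C * (\<eta> / C)"
        unfolding sum_distrib_right[symmetric] C_def
        using assms(2) C by (intro mult_right_mono) (auto simp: C_def)
      finally show "norm (p (x + \<tau>) - p x) \<le> \<eta>" using C by simp
    qed
  qed
qed

lemma ap_modulus_perturb:
  assumes "ap_modulus p \<Lambda> \<delta> \<eta>" "\<And>x. norm (f x - p x) \<le> \<epsilon>"
  shows "ap_modulus f \<Lambda> \<delta> (\<eta> + 2 * \<epsilon>)"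
  unfolding ap_modulus_def
proof (intro allI impI)
  fix \<tau> x assume "\<forall>\<omega>\<in>\<Lambda>. norm (chr \<omega> \<tau> - 1) \<le> \<delta>"
  then have 1: "norm (p (x + \<tau>) - p x) \<le> \<eta>" using assms(1) by (auto simp: ap_modulus_def)
  have "f (x + \<tau>) - f x = (f (x + \<tau>) - p (x + \<tau>)) + (p (x + \<tau>) - p x) - (f x - p x)" by simp
  also have "norm \<dots> \<le> \<epsilon> + \<eta> + \<epsilon>"
    using 1 assms(2)[of x] assms(2)[of "x + \<tau>"]
      norm_triangle_ineq4[of "(f (x + \<tau>) - p (x + \<tau>)) + (p (x + \<tau>) - p x)" "f x - p x"]
      norm_triangle_ineq[of "f (x + \<tau>) - p (x + \<tau>)" "p (x + \<tau>) - p x"]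
    by linarith
  finally show "norm (f (x + \<tau>) - f x) \<le> \<eta> + 2 * \<epsilon>" by simp
qed

lemma avg_sum:
  assumes "finite I" "\<And>i. i \<in> I \<Longrightarrow> continuous_on UNIV (f i)"
  shows "avg T (\<lambda>x. \<Sum>i\<in>I. f i x) = (\<Sum>i\<in>I. avg T (f i))"
  unfolding avg_def
  by (subst integral_sum)
    (use assms in \<open>auto intro!: integrable_continuous_real intro: continuous_on_subset simp: sum_divide_distrib\<close>)

lemma avg_diff: "continuous_on UNIV f \<Longrightarrow> continuous_on UNIV g \<Longrightarrow> avg T (\<lambda>x. f x - g x) = avg T f - avg T g"
  unfolding avg_def
  by (subst integral_diff)
    (auto intro!: integrable_continuous_real simp: diff_divide_distrib elim: continuous_on_subset)

lemma avg_cmult: "avg T (\<lambda>x. c * f x) = c * avg T f"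
  by (simp add: avg_def)

lemma avg_norm_le:
  assumes "continuous_on UNIV f" "continuous_on UNIV h" "\<And>x. norm (f x) \<le> h x" "T > 0"
  shows "norm (avg T f) \<le> integral {-T..T} h / (2 * T)"
proof -
  have "norm (integral {-T..T} f) \<le> integral {-T..T} h"
    using assms by (intro integral_norm_bound_integral integrable_continuous_real)
      (auto elim: continuous_on_subset)
  then show ?thesis
    using assms(4) by (simp add: avg_def norm_divide divide_right_mono)
qed

lemma avg_norm_le_const:
  assumes "continuous_on UNIV f" "\<And>x. norm (f x) \<le> B" "T > 0"
  shows "norm (avg T f) \<le> B"
  using avg_norm_le[OF assms(1) continuous_on_const assms(2,3)] assms(3) by simp

lemma avg_const: "T > 0 \<Longrightarrow> avg T (\<lambda>x. c) = c"
  by (simp add: avg_def scaleR_conv_of_real)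

text \<open>The two integrals differ only on end pieces of length \<open>\<bar>y\<bar>\<close>, a
  bounded amount that is divided by \<open>2 * T\<close>. The claim concerns the difference of
  averages, so that it applies along a sequence of times even when the mean itself is not known to
  converge.\<close>

lemma avg_shift_tendsto:
  assumes f: "continuous_on UNIV f" and B: "\<And>x. norm (f x) \<le> B"
  shows "((\<lambda>T. avg T (\<lambda>x. f (x + y)) - avg T f) \<longlongrightarrow> 0) at_top"
proof (rule Lim_null_comparison)
  have int: "f integrable_on {a..b}" for a b
    using f by (intro integrable_continuous_real) (auto elim: continuous_on_subset)
  have B0: "B \<ge> 0" using order_trans[OF norm_ge_zero B] .
  show "\<forall>\<^sub>F T in at_top. norm (avg T (\<lambda>x. f (x + y)) - avg T f) \<le> \<bar>y\<bar> * B / T"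
    using eventually_gt_at_top[of "\<bar>y\<bar>"]
  proof eventually_elim
    case (elim T)
    have small: "norm (integral {a..b} f) \<le> B * (b - a)" if "a \<le> b" for a b
      using that by (intro integral_bound) (auto intro: continuous_on_subset[OF f] B)
    have "integral {-T..T} (\<lambda>x. f (x + y)) = integral {-T + y..T + y} f"
      using integral_shift_Icc_real[of "- T" T f y] by (simp add: o_def add.commute)
    also have "norm (\<dots> - integral {-T..T} f) \<le> 2 * (\<bar>y\<bar> * B)"
    proof (cases "y \<ge> 0")
      case True
      have "integral {-T..T + y} f = integral {-T..T} f + integral {T..T + y} f"
        "integral {-T..T + y} f = integral {-T..-T + y} f + integral {-T + y..T + y} f"
        using True elim by (auto intro!: Henstock_Kurzweil_Integration.integral_combine[symmetric] int)
      then have "integral {-T + y..T + y} f - integral {-T..T} f =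
          integral {T..T + y} f - integral {-T..-T + y} f"
        by (simp add: algebra_simps)
      also have "norm \<dots> \<le> B * y + B * y"
        using small[of T "T + y"] small[of "-T" "-T + y"] True
        by (intro order_trans[OF norm_triangle_ineq4] add_mono) auto
      finally show ?thesis using True by (simp add: mult.commute)
    next
      case False
      have "integral {-T + y..T} f = integral {-T + y..T + y} f + integral {T + y..T} f"
        "integral {-T + y..T} f = integral {-T + y..-T} f + integral {-T..T} f"
        using False elim by (auto intro!: Henstock_Kurzweil_Integration.integral_combine[symmetric] int)
      then have "integral {-T + y..T + y} f - integral {-T..T} f =
          integral {-T + y..-T} f - integral {T + y..T} f"
        by (simp add: algebra_simps)
      also have "norm \<dots> \<le> B * (- y) + B * (- y)"
        using small[of "T + y" T] small[of "-T + y" "-T"] False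
        by (intro order_trans[OF norm_triangle_ineq4] add_mono) auto
      finally show ?thesis using False by (simp add: mult.commute)
    qed
    finally have "norm (integral {-T..T} (\<lambda>x. f (x + y)) - integral {-T..T} f) / (2 * T) \<le> 2 * (\<bar>y\<bar> * B) / (2 * T)"
      using elim by (intro divide_right_mono) auto
    then show ?case
      using elim by (simp add: avg_def norm_divide flip: diff_divide_distrib)
  qed
  show "((\<lambda>T. \<bar>y\<bar> * B / T) \<longlongrightarrow> 0) at_top"
    by (rule real_tendsto_divide_at_top[OF tendsto_const filterlim_ident])
qed

lemma avg_chr_tendsto:
  "((\<lambda>T. avg T (chr \<omega>)) \<longlongrightarrow> (if \<omega> = 0 then 1 else 0)) at_top"
proof (cases "\<omega> = 0")
  case True
  have "\<forall>\<^sub>F T in at_top. avg T (chr \<omega>) = 1"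
    using eventually_gt_at_top[of 0]
    by eventually_elim (simp add: True avg_const)
  then show ?thesis
    using True by (simp add: tendsto_eventually)
next
  case False
  show ?thesis
  proof (simp add: False, rule Lim_null_comparison)
    show "\<forall>\<^sub>F T in at_top. norm (avg T (chr \<omega>)) \<le> 1 / (\<bar>\<omega>\<bar> * T)"
      using eventually_gt_at_top[of 0]
    proof eventually_elim
      case (elim T)
      have "(chr \<omega> has_integral (chr \<omega> T / (\<i> * of_real \<omega>) - chr \<omega> (- T) / (\<i> * of_real \<omega>))) {-T..T}"
      proof (rule fundamental_theorem_of_calculus)
        fix x
        show "((\<lambda>x. chr \<omega> x / (\<i> * of_real \<omega>)) has_vector_derivative chr \<omega> x) (at x within {-T..T})"
          using False
          by (auto intro!: has_vector_derivative_real_field derivative_eq_intros)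
      qed (use elim in simp)
      then have "norm (integral {-T..T} (chr \<omega>)) = norm (chr \<omega> T - chr \<omega> (- T)) / \<bar>\<omega>\<bar>"
        by (simp add: integral_unique norm_divide norm_mult flip: diff_divide_distrib)
      also have "\<dots> \<le> 2 / \<bar>\<omega>\<bar>"
        by (intro divide_right_mono order_trans[OF norm_triangle_ineq4]) auto
      finally have "norm (integral {-T..T} (chr \<omega>)) / (2 * T) \<le> 2 / \<bar>\<omega>\<bar> / (2 * T)"
        using elim by (intro divide_right_mono) auto
      then show ?case
        using elim by (simp add: avg_def norm_divide)
    qed
    show "((\<lambda>T. 1 / (\<bar>\<omega>\<bar> * T)) \<longlongrightarrow> 0) at_top"
      using False by (intro real_tendsto_divide_at_top[OF tendsto_const]
          filterlim_tendsto_pos_mult_at_top[OF tendsto_const] filterlim_ident) auto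
  qed
qed

lemma avg_trig_tendsto:
  assumes "finite I"
  shows "((\<lambda>T. avg T (\<lambda>x. \<Sum>i\<in>I. w i * chr (\<mu> i) x)) \<longlongrightarrow> (\<Sum>i\<in>I. if \<mu> i = 0 then w i else 0)) at_top"
proof -
  have "avg T (\<lambda>x. \<Sum>i\<in>I. w i * chr (\<mu> i) x) = (\<Sum>i\<in>I. w i * avg T (chr (\<mu> i)))" for T
    using assms by (subst avg_sum) (auto intro!: continuous_intros simp: avg_cmult)
  moreover have "((\<lambda>T. \<Sum>i\<in>I. w i * avg T (chr (\<mu> i))) \<longlongrightarrow> (\<Sum>i\<in>I. w i * (if \<mu> i = 0 then 1 else 0))) at_top"
    by (intro tendsto_sum tendsto_mult tendsto_const avg_chr_tendsto)
  moreover have "(\<Sum>i\<in>I. w i * (if \<mu> i = 0 then 1 else 0)) = (\<Sum>i\<in>I. if \<mu> i = 0 then w i else 0)"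
    by (intro sum.cong) auto
  ultimately show ?thesis by simp
qed

section \<open>The Bochner-Fejer kernel and its approximation property\<close>

text \<open>Binomial expansion of every factor: \<open>a\<close> records the power taken at each
  frequency, and \<open>\<phi> a\<close> is the corresponding integer combination of
  \<open>\<Lambda>\<close>. Frequencies may be rationally dependent, so different \<open>a\<close>
  can share a value of \<open>\<phi>\<close>; indexing by \<open>a\<close> keeps the number of terms
  explicit.\<close>

lemma fejer_expansion:
  fixes \<Lambda> :: "real set" and N :: nat
  assumes \<Lambda>: "finite \<Lambda>"
  obtains A :: "(real \<Rightarrow> nat) set" and c :: "(real \<Rightarrow> nat) \<Rightarrow> real" and \<phi> :: "(real \<Rightarrow> nat) \<Rightarrow> real"
  where "finite A" "card A = (N + 1) ^ card \<Lambda>" "\<And>a. a \<in> A \<Longrightarrow> 0 \<le> c a"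
    "\<And>a. a \<in> A \<Longrightarrow> \<phi> a \<in> group_closure \<Lambda>"
    "\<And>\<tau>. (\<Prod>\<omega>\<in>\<Lambda>. ((1 + chr \<omega> \<tau>) / 2) ^ N) = (\<Sum>a\<in>A. of_real (c a) * chr (\<phi> a) \<tau>)"
proof -
  define A where "A = Pi\<^sub>E \<Lambda> (\<lambda>_. {..N})"
  define c where "c a = (\<Prod>\<omega>\<in>\<Lambda>. real (N choose a \<omega>) / 2 ^ N)" for a :: "real \<Rightarrow> nat"
  define \<phi> where "\<phi> a = (\<Sum>\<omega>\<in>\<Lambda>. of_nat (a \<omega>) * \<omega>)" for a :: "real \<Rightarrow> nat"
  show thesis
  proof (rule that[of A c \<phi>])
    show "finite A" using \<Lambda> by (auto simp: A_def intro: finite_PiE)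
    show "card A = (N + 1) ^ card \<Lambda>" using \<Lambda> by (simp add: A_def card_PiE)
    fix a show "0 \<le> c a" by (auto simp: c_def intro: prod_nonneg)
    have "\<phi> a \<in> group_closure \<Lambda>" if "F \<subseteq> \<Lambda>" "\<phi> a = (\<Sum>\<omega>\<in>F. of_nat (a \<omega>) * \<omega>)" for F
    proof -
      have "finite F" using that \<Lambda> finite_subset by blast
      then have "(\<Sum>\<omega>\<in>F. of_nat (a \<omega>) * \<omega>) \<in> group_closure \<Lambda>"
        using that(1)
        by (induction F) (auto intro!: group_closure_add[OF group_closure_scalar_mult_left] intro: group_closure.base)
      then show ?thesis using that by simp
    qed
    then show "\<phi> a \<in> group_closure \<Lambda>" by (auto simp: \<phi>_def)
    fix \<tau>
    have factor: "((1 + chr \<omega> \<tau>) / 2) ^ N =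
        (\<Sum>j\<le>N. of_real (real (N choose j) / 2 ^ N) * exp (\<i> * of_real (real j * \<omega>) * of_real \<tau>))" for \<omega>
    proof -
      have "(chr \<omega> \<tau> + 1) ^ N = (\<Sum>j\<le>N. of_nat (N choose j) * chr \<omega> \<tau> ^ j * 1 ^ (N - j))"
        by (rule binomial_ring)
      also have "\<dots> = (\<Sum>j\<le>N. of_nat (N choose j) * exp (\<i> * of_real (real j * \<omega>) * of_real \<tau>))"
        by (intro sum.cong refl) (simp add: exp_of_nat_mult[symmetric] mult_ac)
      finally show ?thesis
        by (simp add: power_divide add.commute sum_divide_distrib)
    qed
    have "(\<Prod>\<omega>\<in>\<Lambda>. ((1 + chr \<omega> \<tau>) / 2) ^ N) =
        (\<Sum>a\<in>A. \<Prod>\<omega>\<in>\<Lambda>. of_real (real (N choose a \<omega>) / 2 ^ N) *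
          exp (\<i> * of_real (real (a \<omega>) * \<omega>) * of_real \<tau>))"
      unfolding factor A_def using \<Lambda> by (intro prod_sum_PiE) auto
    also have "\<dots> = (\<Sum>a\<in>A. of_real (c a) * chr (\<phi> a) \<tau>)"
    proof (rule sum.cong[OF refl])
      fix a
      have "chr (\<phi> a) \<tau> = (\<Prod>\<omega>\<in>\<Lambda>. exp (\<i> * of_real (real (a \<omega>) * \<omega>) * of_real \<tau>))"
        by (simp add: \<phi>_def exp_sum[OF \<Lambda>, symmetric] sum_distrib_left sum_distrib_right)
      then show "(\<Prod>\<omega>\<in>\<Lambda>. of_real (real (N choose a \<omega>) / 2 ^ N) *
          exp (\<i> * of_real (real (a \<omega>) * \<omega>) * of_real \<tau>)) = of_real (c a) * chr (\<phi> a) \<tau>"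
        by (simp only: prod.distrib c_def of_real_prod)
    qed
    finally show "(\<Prod>\<omega>\<in>\<Lambda>. ((1 + chr \<omega> \<tau>) / 2) ^ N) = (\<Sum>a\<in>A. of_real (c a) * chr (\<phi> a) \<tau>)" .
  qed
qed

text \<open>With \<open>r = s ^ m\<close> the expression is the \<open>m\<close>-th power of
  \<open>(N + 1) * s ^ N\<close>, which tends to \<open>0\<close>. The case \<open>m = 0\<close> is
  separate, there being no root to take.\<close>

lemma power_times_geometric_tendsto_0:
  fixes r :: real
  assumes "0 \<le> r" "r < 1"
  shows "(\<lambda>N. real (N + 1) ^ m * r ^ N) \<longlonglongrightarrow> 0"
proof (cases "m = 0")
  case True
  then show ?thesis using assms by (simp add: LIMSEQ_realpow_zero)
next
  case False
  define s where "s = root m r"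
  have s: "0 \<le> s" "s < 1" "s ^ m = r"
    using False assms by (auto simp: s_def real_root_pow_pos2)
  have "(\<lambda>N. of_nat N * s ^ N + s ^ N) \<longlonglongrightarrow> 0 + 0"
    using s by (intro tendsto_add powser_times_n_limit_0 LIMSEQ_realpow_zero) auto
  then have "(\<lambda>N. (of_nat N * s ^ N + s ^ N) ^ m) \<longlonglongrightarrow> (0 + 0) ^ m"
    by (rule tendsto_power)
  moreover have "(of_nat N * s ^ N + s ^ N) ^ m = real (N + 1) ^ m * r ^ N" for N
  proof -
    have "of_nat N * s ^ N + s ^ N = real (N + 1) * s ^ N" by (simp add: algebra_simps)
    then show ?thesis
      by (simp add: power_mult_distrib s(3)[symmetric] power_mult[symmetric] mult.commute)
  qed
  ultimately show ?thesis using False by (simp add: zero_power)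
qed

lemma finite_family_convergent_subsequence:
  fixes X :: "'i \<Rightarrow> nat \<Rightarrow> 'a::heine_borel"
  assumes "finite S" "\<And>i. i \<in> S \<Longrightarrow> bounded (range (X i))"
  obtains r where "strict_mono r" "\<And>i. i \<in> S \<Longrightarrow> convergent (X i \<circ> r)"
proof -
  from assms have "\<exists>r. strict_mono r \<and> (\<forall>i\<in>S. convergent (X i \<circ> r))"
  proof (induction S)
    case empty
    then show ?case by (auto intro: exI[of _ id] simp: strict_mono_def)
  next
    case (insert i S)
    have "\<exists>r. strict_mono r \<and> (\<forall>i\<in>S. convergent (X i \<circ> r))"
      by (rule insert.IH) (use insert.prems in auto)
    then obtain r where r: "strict_mono r" "\<forall>i\<in>S. convergent (X i \<circ> r)" by blast
    have "bounded (range (X i \<circ> r))"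
      using insert.prems[of i] by (rule bounded_subset) auto
    then obtain l q where q: "strict_mono q" "(X i \<circ> r \<circ> q) \<longlonglongrightarrow> l"
      using bounded_imp_convergent_subsequence by blast
    have "convergent (X j \<circ> (r \<circ> q))" if "j \<in> insert i S" for j
    proof (cases "j = i")
      case True
      then show ?thesis using q by (auto simp: convergent_def o_assoc)
    next
      case False
      then show ?thesis
        using r that convergent_subseq_convergent[OF _ q(1), of "X j \<circ> r"] by (auto simp: o_assoc)
    qed
    then show ?case using strict_mono_o[OF r(1) q(1)] by blast
  qed
  then show thesis using that by blast
qed

text \<open>The parallelogram law for \<open>1\<close> and \<open>z\<close>.\<close>

lemma norm_half_one_plus_unit:
  fixes z :: complex
  assumes "norm z = 1"
  shows "(norm ((1 + z) / 2))\<^sup>2 = 1 - (norm (z - 1))\<^sup>2 / 4"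
proof -
  have "(Re z)\<^sup>2 + (Im z)\<^sup>2 = 1" using assms cmod_power2[of z] by simp
  then show ?thesis
    unfolding norm_divide power_divide cmod_power2 by (simp add: power2_eq_square field_simps)
qed

text \<open>Every factor has modulus at most \<open>1\<close>, and by the parallelogram law the one
  at \<open>\<omega>\<close> is bounded away from \<open>1\<close>. The bound
  \<open>\<delta> \<le> 1\<close> keeps \<open>1 - \<delta>\<^sup>2 / 4\<close> nonnegative, as
  multiplying the two estimates requires.\<close>

lemma fejer_kernel_small:
  fixes \<delta> :: real
  assumes "finite \<Lambda>" and \<delta>: "0 < \<delta>" "\<delta> \<le> 1" and \<omega>: "\<omega> \<in> \<Lambda>" "norm (chr \<omega> \<tau> - 1) > \<delta>"
  shows "(norm (\<Prod>\<omega>\<in>\<Lambda>. ((1 + chr \<omega> \<tau>) / 2) ^ N))\<^sup>2 \<le> (1 - \<delta>\<^sup>2 / 4) ^ N"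
proof -
  have "(norm (\<Prod>\<omega>\<in>\<Lambda>. ((1 + chr \<omega> \<tau>) / 2) ^ N))\<^sup>2 = (\<Prod>\<omega>\<in>\<Lambda>. ((norm ((1 + chr \<omega> \<tau>) / 2))\<^sup>2) ^ N)"
    by (simp add: prod_norm[symmetric] norm_power prod_power_distrib[symmetric] power_mult[symmetric] mult.commute)
  also have "\<dots> = (\<Prod>\<omega>\<in>\<Lambda>. (1 - (norm (chr \<omega> \<tau> - 1))\<^sup>2 / 4) ^ N)"
    using norm_half_one_plus_unit[OF norm_chr] by simp
  also have "\<dots> = (1 - (norm (chr \<omega> \<tau> - 1))\<^sup>2 / 4) ^ N *
      (\<Prod>\<omega>\<in>\<Lambda> - {\<omega>}. (1 - (norm (chr \<omega> \<tau> - 1))\<^sup>2 / 4) ^ N)"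
    using assms by (intro prod.remove) auto
  also have "\<dots> \<le> (1 - \<delta>\<^sup>2 / 4) ^ N * 1"
  proof (rule mult_mono)
    have nn: "0 \<le> 1 - (norm (chr \<mu> \<tau> - 1))\<^sup>2 / 4" for \<mu>
      using norm_half_one_plus_unit[OF norm_chr[of \<mu> \<tau>]] by (metis zero_le_power2)
    have "\<delta>\<^sup>2 \<le> (norm (chr \<omega> \<tau> - 1))\<^sup>2" using \<omega>(2) \<delta> by (intro power_mono) auto
    then show "(1 - (norm (chr \<omega> \<tau> - 1))\<^sup>2 / 4) ^ N \<le> (1 - \<delta>\<^sup>2 / 4) ^ N"
      by (intro power_mono nn) auto
    show "(\<Prod>\<omega>\<in>\<Lambda> - {\<omega>}. (1 - (norm (chr \<omega> \<tau> - 1))\<^sup>2 / 4) ^ N) \<le> 1"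
      using nn by (intro prod_le_1) (auto intro: power_le_one)
    show "0 \<le> (\<Prod>\<omega>\<in>\<Lambda> - {\<omega>}. (1 - (norm (chr \<omega> \<tau> - 1))\<^sup>2 / 4) ^ N)"
      using nn by (intro prod_nonneg) auto
    have "\<delta>\<^sup>2 \<le> 1" using \<delta> by (simp add: power_le_one)
    then show "0 \<le> (1 - \<delta>\<^sup>2 / 4) ^ N" by simp
  qed
  finally show ?thesis by simp
qed

text \<open>The mean values of \<open>g\<close> need not be known to exist, so the averages are taken along a sequence of
  times on which the finitely many relevant ones converge. The mean of the kernel is at least
  \<open>(N + 1)\<close> to the power \<open>- card \<Lambda>\<close> by the Cauchy-Schwarz inequality for its nonnegative coefficients,
  while outside the almost periods the kernel is exponentially small in \<open>N\<close>.\<close>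

lemma fejer_approximation:
  fixes g :: "real \<Rightarrow> complex"
  assumes cont: "continuous_on UNIV g" and B: "\<And>x. norm (g x) \<le> B" and \<Lambda>: "finite \<Lambda>"
    and \<delta>: "\<delta> > 0" and ap: "ap_modulus g \<Lambda> \<delta> \<eta>" and \<eta>: "\<eta> \<ge> 0" and \<epsilon>: "\<epsilon> > 0"
  obtains P where
    "trig_over (group_closure \<Lambda> \<inter> {\<omega>. \<not> ((\<lambda>T. avg T (\<lambda>x. g x * chr (- \<omega>) x)) \<longlongrightarrow> 0) at_top}) P"
    "\<And>x. norm (P x - g x) \<le> \<eta> + \<epsilon>"
proof -
  \<comment> \<open>A smaller tolerance admits fewer \<open>\<tau>\<close>, so the hypothesis on
    \<open>g\<close> persists; \<open>\<delta>' \<le> 1\<close> is what the smallness of the kernel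
    requires.\<close>
  define \<delta>' where "\<delta>' = min \<delta> 1"
  have \<delta>': "0 < \<delta>'" "\<delta>' \<le> 1" "\<delta>' \<le> \<delta>" using \<delta> by (auto simp: \<delta>'_def)
  define r where "r = 1 - \<delta>'\<^sup>2 / 4"
  have r: "0 \<le> r" "r < 1"
    using \<delta>' power_le_one[of \<delta>' 2] by (auto simp: r_def)
  define m where "m = card \<Lambda>"
  have B0: "B \<ge> 0" using order_trans[OF norm_ge_zero B] .
  have "(\<lambda>N. 2 * B * (real (N + 1) ^ m * r ^ N)) \<longlonglongrightarrow> 2 * B * 0"
    by (intro tendsto_mult tendsto_const power_times_geometric_tendsto_0 r)
  then have "\<forall>\<^sub>F N in sequentially. 2 * B * (real (N + 1) ^ m * r ^ N) < \<epsilon>"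
    using \<epsilon> by (intro order_tendstoD(2)) auto
  \<comment> \<open>The factor \<open>(N + 1) ^ m\<close> is the reserve for dividing by the mean of
    the kernel, which is bounded below by its reciprocal.\<close>
  then obtain N where N: "2 * B * (real (N + 1) ^ m * r ^ N) < \<epsilon>"
    using eventually_happens trivial_limit_sequentially by blast
  obtain A :: "(real \<Rightarrow> nat) set" and c \<phi> where A: "finite A" "card A = (N + 1) ^ card \<Lambda>"
    and c: "\<And>a. a \<in> A \<Longrightarrow> 0 \<le> c a" and \<phi>: "\<And>a. a \<in> A \<Longrightarrow> \<phi> a \<in> group_closure \<Lambda>"
    and D: "\<And>\<tau>. (\<Prod>\<omega>\<in>\<Lambda>. ((1 + chr \<omega> \<tau>) / 2) ^ N) = (\<Sum>a\<in>A. of_real (c a) * chr (\<phi> a) \<tau>)"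
    by (rule fejer_expansion[OF \<Lambda>, of N]) (use that in blast)
  \<comment> \<open>The squared modulus is nonnegative and still has nonnegative coefficients. Its
    frequencies are the differences \<open>\<phi> a - \<phi> b\<close>, indexed by pairs, and they
    stay in the group generated by \<open>\<Lambda>\<close>.\<close>
  define k where "k \<tau> = (norm (\<Prod>\<omega>\<in>\<Lambda>. ((1 + chr \<omega> \<tau>) / 2) ^ N))\<^sup>2" for \<tau>
  define w where "w = (\<lambda>(a, b). c a * c b)"
  define \<mu> where "\<mu> = (\<lambda>(a, b). \<phi> a - \<phi> b)"
  define I where "I = A \<times> A"
  have I: "finite I" using A by (simp add: I_def)
  have w0: "w i \<ge> 0" if "i \<in> I" for i using that c by (auto simp: w_def I_def)
  have \<mu>_mem: "\<mu> i \<in> group_closure \<Lambda>" if "i \<in> I" for i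
    using that \<phi> by (auto simp: \<mu>_def I_def intro: group_closure.diff)
  have k_eq: "of_real (k \<tau>) = (\<Sum>i\<in>I. of_real (w i) * chr (\<mu> i) \<tau>)" for \<tau>
  proof -
    have "of_real (k \<tau>) = (\<Sum>a\<in>A. of_real (c a) * chr (\<phi> a) \<tau>) * cnj (\<Sum>a\<in>A. of_real (c a) * chr (\<phi> a) \<tau>)"
      unfolding k_def D by (rule complex_norm_square)
    also have "cnj (\<Sum>a\<in>A. of_real (c a) * chr (\<phi> a) \<tau>) = (\<Sum>b\<in>A. of_real (c b) * chr (- \<phi> b) \<tau>)"
      unfolding chr_minus by simp
    also have "(\<Sum>a\<in>A. of_real (c a) * chr (\<phi> a) \<tau>) * (\<Sum>b\<in>A. of_real (c b) * chr (- \<phi> b) \<tau>) =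
        (\<Sum>a\<in>A. \<Sum>b\<in>A. of_real (c a * c b) * chr (\<phi> a - \<phi> b) \<tau>)"
      unfolding sum_product diff_conv_add_uminus chr_add_left
      by (intro sum.cong refl) (simp only: of_real_mult mult_ac)
    also have "\<dots> = (\<Sum>i\<in>I. of_real (w i) * chr (\<mu> i) \<tau>)"
      unfolding I_def sum.cartesian_product w_def \<mu>_def by (simp add: case_prod_beta)
    finally show ?thesis .
  qed
  \<comment> \<open>The mean of the kernel: only pairs with \<open>\<mu> i = 0\<close> survive
    averaging. The diagonal pairs are among them and already give the lower bound.\<close>
  define J where "J = (\<Sum>i\<in>I. if \<mu> i = 0 then w i else 0)"
  have k_cont: "continuous_on S k" for S
    unfolding k_def by (intro continuous_intros) auto
  have J_lim: "((\<lambda>T. avg T (\<lambda>\<tau>. of_real (k \<tau>))) \<longlongrightarrow> of_real J) at_top"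
  proof -
    have "((\<lambda>T. avg T (\<lambda>\<tau>. of_real (k \<tau>))) \<longlongrightarrow>
        (\<Sum>i\<in>I. if \<mu> i = 0 then of_real (w i) else 0)) at_top"
      unfolding k_eq by (rule avg_trig_tendsto[OF I])
    also have "(\<Sum>i\<in>I. if \<mu> i = 0 then of_real (w i) else 0) = complex_of_real J"
      unfolding J_def of_real_sum by (intro sum.cong) auto
    finally show ?thesis .
  qed
  have "1 = (\<Sum>a\<in>A. complex_of_real (c a))"
    using D[of 0] by simp
  then have sum_c: "(\<Sum>a\<in>A. c a) = 1"
    by (metis of_real_eq_1_iff of_real_sum)
  have "1 \<le> (\<Sum>a\<in>A. (c a)\<^sup>2) * real (card A)"
    using sum_squared_le_sum_of_squares[of c A] sum_c by simp
  also have "(\<Sum>a\<in>A. (c a)\<^sup>2) = (\<Sum>i\<in>(\<lambda>a. (a, a)) ` A. if \<mu> i = 0 then w i else 0)"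
    by (subst sum.reindex) (auto simp: inj_on_def \<mu>_def w_def power2_eq_square)
  also have "\<dots> \<le> J"
    unfolding J_def using I w0 by (intro sum_mono2) (auto simp: I_def)
  finally have J: "1 \<le> J * real (N + 1) ^ m"
    using A by (simp add: m_def mult_right_mono)
  then have J0: "J > 0"
    by (metis mult_nonpos_nonneg not_le of_nat_0_le_iff order_trans zero_le_power zero_less_one not_one_le_zero)
  have k0: "k \<tau> \<ge> 0" for \<tau> by (simp add: k_def)
  have point: "norm ((g (x + \<tau>) - g x) * of_real (k \<tau>)) \<le> \<eta> * k \<tau> + 2 * B * r ^ N" for x \<tau>
  proof (cases "\<forall>\<omega>\<in>\<Lambda>. norm (chr \<omega> \<tau> - 1) \<le> \<delta>'")
    case True
    then have "norm (g (x + \<tau>) - g x) \<le> \<eta>"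
      using ap \<delta>'(3) unfolding ap_modulus_def by (meson order_trans)
    then have "norm ((g (x + \<tau>) - g x) * of_real (k \<tau>)) \<le> \<eta> * k \<tau>"
      by (simp add: norm_mult k0 mult_right_mono)
    then show ?thesis using B0 r by (smt (verit) mult_nonneg_nonneg zero_le_power)
  next
    case False
    then obtain \<omega> where "\<omega> \<in> \<Lambda>" "norm (chr \<omega> \<tau> - 1) > \<delta>'" by auto
    then have "k \<tau> \<le> r ^ N"
      unfolding k_def r_def using fejer_kernel_small[OF \<Lambda> \<delta>'(1,2)] by blast
    moreover have "norm (g (x + \<tau>) - g x) \<le> 2 * B"
      using norm_triangle_ineq4[of "g (x + \<tau>)" "g x"] B[of x] B[of "x + \<tau>"] by simp
    ultimately have "norm ((g (x + \<tau>) - g x) * of_real (k \<tau>)) \<le> 2 * B * r ^ N"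
      unfolding norm_mult using k0 B0 by (intro mult_mono) auto
    moreover have "\<eta> * k \<tau> \<ge> 0" using k0 \<eta> by simp
    ultimately show ?thesis by linarith
  qed
  have g_shift: "continuous_on S (\<lambda>\<tau>. g (x + \<tau>))" for S x
    by (rule continuous_on_compose2[OF cont]) (auto intro!: continuous_intros)
  have estimate: "norm (avg T (\<lambda>\<tau>. g (x + \<tau>) * of_real (k \<tau>)) - avg T (\<lambda>\<tau>. of_real (k \<tau>)) * g x) \<le>
      \<eta> * Re (avg T (\<lambda>\<tau>. of_real (k \<tau>))) + 2 * B * r ^ N" if "T > 0" for T x
  proof -
    have kint: "k integrable_on {-T..T}" by (intro integrable_continuous_real k_cont)
    have "avg T (\<lambda>\<tau>. (g (x + \<tau>) - g x) * of_real (k \<tau>)) =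
        avg T (\<lambda>\<tau>. g (x + \<tau>) * of_real (k \<tau>)) - avg T (\<lambda>\<tau>. g x * of_real (k \<tau>))"
      unfolding left_diff_distrib by (intro avg_diff continuous_intros g_shift k_cont)
    also have "avg T (\<lambda>\<tau>. g x * of_real (k \<tau>)) = avg T (\<lambda>\<tau>. of_real (k \<tau>)) * g x"
      by (simp add: avg_cmult)
    finally have eq: "avg T (\<lambda>\<tau>. g (x + \<tau>) * of_real (k \<tau>)) - avg T (\<lambda>\<tau>. of_real (k \<tau>)) * g x =
        avg T (\<lambda>\<tau>. (g (x + \<tau>) - g x) * of_real (k \<tau>))" by simp
    have "norm (avg T (\<lambda>\<tau>. g (x + \<tau>) * of_real (k \<tau>)) - avg T (\<lambda>\<tau>. of_real (k \<tau>)) * g x)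
      \<le> integral {-T..T} (\<lambda>\<tau>. \<eta> * k \<tau> + 2 * B * r ^ N) / (2 * T)"
      unfolding eq by (intro avg_norm_le[OF _ _ point that] continuous_intros g_shift k_cont)
    also have "integral {-T..T} (\<lambda>\<tau>. \<eta> * k \<tau> + 2 * B * r ^ N) = \<eta> * integral {-T..T} k + 2 * T * (2 * B * r ^ N)"
      using that kint by (subst integral_add) (auto intro: integrable_on_mult_right)
    also have "\<dots> / (2 * T) = \<eta> * (integral {-T..T} k / (2 * T)) + 2 * B * r ^ N"
      using that by (simp add: field_simps)
    also have "integral {-T..T} k / (2 * T) = Re (avg T (\<lambda>\<tau>. of_real (k \<tau>)))"
    proof -
      have "integral {-T..T} (\<lambda>\<tau>. complex_of_real (k \<tau>)) = of_real (integral {-T..T} k)"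
        using integral_linear[OF kint bounded_linear_of_real] by (simp add: o_def)
      then show ?thesis by (simp add: avg_def del: of_real_mult flip: of_real_divide)
    qed
    finally show ?thesis .
  qed
  \<comment> \<open>Means of \<open>g\<close> against the finitely many frequencies of the kernel,
    sampled at positive integer times; boundedness lets one subsequence serve all of them.\<close>
  define X where "X i n = avg (real (Suc n)) (\<lambda>\<tau>. g \<tau> * chr (\<mu> i) \<tau>)" for i n
  have "bounded (range (X i))" for i
    unfolding X_def by (rule boundedI[of _ B])
      (auto intro!: avg_norm_le_const continuous_intros cont simp: norm_mult B)
  then obtain q where q: "strict_mono q" "\<And>i. i \<in> I \<Longrightarrow> convergent (X i \<circ> q)"
    using finite_family_convergent_subsequence[OF I] by metis
  define L where "L i = lim (X i \<circ> q)" for i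
  have L: "(X i \<circ> q) \<longlonglongrightarrow> L i" if "i \<in> I" for i
    using q(2)[OF that] by (simp add: L_def convergent_LIMSEQ_iff)
  define Tn where "Tn n = real (Suc (q n))" for n
  have Tn: "filterlim Tn at_top sequentially"
    unfolding Tn_def
    by (intro filterlim_compose[OF filterlim_real_sequentially] filterlim_compose[OF filterlim_Suc] filterlim_subseq q)
  have Tn0: "Tn n > 0" for n by (simp add: Tn_def)
  \<comment> \<open>The limit along \<open>Tn\<close> of the averages of
    \<open>g (x + \<tau>) * k \<tau>\<close>, divided by \<open>J\<close>. Substituting
    \<open>\<tau> + x\<close> moves \<open>x\<close> into the characters, and shift invariance of
    the means makes the coefficients independent of \<open>x\<close>.\<close>
  define P where "P x = (\<Sum>i\<in>I. (of_real (w i / J) * L i) * chr (- \<mu> i) x)" for x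
  show thesis
  proof (rule that[of P])
    fix x
    have "(\<lambda>n. avg (Tn n) (\<lambda>\<tau>. g (x + \<tau>) * of_real (k \<tau>))) \<longlonglongrightarrow> of_real J * P x"
    proof -
      have "avg T (\<lambda>\<tau>. g (x + \<tau>) * of_real (k \<tau>)) =
          (\<Sum>i\<in>I. of_real (w i) * (chr (- \<mu> i) x * avg T (\<lambda>\<tau>. g (\<tau> + x) * chr (\<mu> i) (\<tau> + x))))" for T
      proof -
        have "avg T (\<lambda>\<tau>. g (x + \<tau>) * of_real (k \<tau>)) =
            avg T (\<lambda>\<tau>. \<Sum>i\<in>I. of_real (w i) * (chr (- \<mu> i) x * (g (\<tau> + x) * chr (\<mu> i) (\<tau> + x))))"
        proof (rule arg_cong[where f = "avg T"], rule ext)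
          fix \<tau>
          have "chr (- \<mu> i) x * (g (\<tau> + x) * chr (\<mu> i) (\<tau> + x)) = g (x + \<tau>) * chr (\<mu> i) \<tau>" for i
          proof -
            have "chr (- \<mu> i) x * (g (\<tau> + x) * chr (\<mu> i) (\<tau> + x)) =
                g (x + \<tau>) * chr (\<mu> i) \<tau> * (chr (\<mu> i) x * chr (- \<mu> i) x)"
              unfolding chr_add_right by (simp only: mult_ac add.commute)
            then show ?thesis by (simp only: chr_mult_minus mult_1_right)
          qed
          then show "g (x + \<tau>) * of_real (k \<tau>) =
            (\<Sum>i\<in>I. of_real (w i) * (chr (- \<mu> i) x * (g (\<tau> + x) * chr (\<mu> i) (\<tau> + x))))"
            unfolding k_eq by (simp only: sum_distrib_left mult_ac)
        qed
        also have "\<dots> = (\<Sum>i\<in>I. of_real (w i) * (chr (- \<mu> i) x * avg T (\<lambda>\<tau>. g (\<tau> + x) * chr (\<mu> i) (\<tau> + x))))"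
          using g_shift[of UNIV x]
          by (subst avg_sum[OF I]) (auto intro!: continuous_intros simp: avg_cmult add.commute)
        finally show ?thesis .
      qed
      moreover have "(\<lambda>n. \<Sum>i\<in>I. of_real (w i) * (chr (- \<mu> i) x *
          avg (Tn n) (\<lambda>\<tau>. g (\<tau> + x) * chr (\<mu> i) (\<tau> + x)))) \<longlonglongrightarrow>
          (\<Sum>i\<in>I. of_real (w i) * (chr (- \<mu> i) x * L i))"
      proof (intro tendsto_sum tendsto_mult tendsto_const)
        fix i assume i: "i \<in> I"
        define h where "h \<tau> = g \<tau> * chr (\<mu> i) \<tau>" for \<tau>
        have "((\<lambda>T. avg T (\<lambda>\<tau>. h (\<tau> + x)) - avg T h) \<longlongrightarrow> 0) at_top"
          by (rule avg_shift_tendsto[of h B])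
            (auto simp: h_def norm_mult B intro!: continuous_intros cont)
        then have "(\<lambda>n. avg (Tn n) (\<lambda>\<tau>. h (\<tau> + x)) - avg (Tn n) h) \<longlonglongrightarrow> 0"
          by (rule filterlim_compose[OF _ Tn])
        from tendsto_add[OF this L[OF i]]
        show "(\<lambda>n. avg (Tn n) (\<lambda>\<tau>. g (\<tau> + x) * chr (\<mu> i) (\<tau> + x))) \<longlonglongrightarrow> L i"
          by (simp add: h_def[abs_def] X_def Tn_def o_def)
      qed
      moreover have "(\<Sum>i\<in>I. of_real (w i) * (chr (- \<mu> i) x * L i)) = of_real J * P x"
        unfolding P_def sum_distrib_left using J0 by (intro sum.cong refl) (simp add: field_simps)
      ultimately show ?thesis by simp
    qed
    then have lim1: "(\<lambda>n. norm (avg (Tn n) (\<lambda>\<tau>. g (x + \<tau>) * of_real (k \<tau>)) - avg (Tn n) (\<lambda>\<tau>. of_real (k \<tau>)) * g x))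
        \<longlonglongrightarrow> norm (of_real J * P x - of_real J * g x)"
      by (intro tendsto_intros filterlim_compose[OF J_lim Tn])
    have lim2: "(\<lambda>n. \<eta> * Re (avg (Tn n) (\<lambda>\<tau>. of_real (k \<tau>))) + 2 * B * r ^ N) \<longlonglongrightarrow> \<eta> * Re (of_real J) + 2 * B * r ^ N"
      by (intro tendsto_intros filterlim_compose[OF J_lim Tn])
    have "norm (of_real J * P x - of_real J * g x) \<le> \<eta> * Re (of_real J) + 2 * B * r ^ N"
      using estimate[OF Tn0] by (intro LIMSEQ_le[OF lim1 lim2]) auto
    also have "of_real J * P x - of_real J * g x = of_real J * (P x - g x)" by (simp add: algebra_simps)
    finally have "J * norm (P x - g x) \<le> \<eta> * J + 2 * B * r ^ N"
      using J0 by (simp add: norm_mult)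
    also have "\<dots> \<le> \<eta> * J + J * \<epsilon>"
    proof -
      have "2 * B * r ^ N * 1 \<le> 2 * B * r ^ N * (J * real (N + 1) ^ m)"
        using J B0 r by (intro mult_left_mono) auto
      also have "\<dots> = J * (2 * B * (real (N + 1) ^ m * r ^ N))" by simp
      also have "\<dots> \<le> J * \<epsilon>" using N J0 by (intro mult_left_mono) auto
      finally show ?thesis by simp
    qed
    finally have "J * norm (P x - g x) \<le> J * (\<eta> + \<epsilon>)" by (simp add: algebra_simps)
    then show "norm (P x - g x) \<le> \<eta> + \<epsilon>" using J0 by simp
  next
    show "trig_over (group_closure \<Lambda> \<inter> {\<omega>. \<not> ((\<lambda>T. avg T (\<lambda>x. g x * chr (- \<omega>) x)) \<longlongrightarrow> 0) at_top}) P"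
      unfolding P_def
    proof (rule trig_over_sum[OF I])
      fix i assume i: "i \<in> I" "of_real (w i / J) * L i \<noteq> 0"
      \<comment> \<open>A nonzero limit along the chosen times excludes convergence of the full
        averages to \<open>0\<close>; this is the claimed restriction on the spectrum of
        \<open>P\<close>.\<close>
      have "\<not> ((\<lambda>T. avg T (\<lambda>x. g x * chr (\<mu> i) x)) \<longlongrightarrow> 0) at_top"
      proof
        assume "((\<lambda>T. avg T (\<lambda>x. g x * chr (\<mu> i) x)) \<longlongrightarrow> 0) at_top"
        then have "(\<lambda>n. avg (Tn n) (\<lambda>x. g x * chr (\<mu> i) x)) \<longlonglongrightarrow> 0"
          by (rule filterlim_compose[OF _ Tn])
        then have "(X i \<circ> q) \<longlonglongrightarrow> 0" by (simp add: X_def o_def Tn_def)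
        then have "L i = 0" using L[OF i(1)] LIMSEQ_unique by blast
        then show False using i by simp
      qed
      then show "- \<mu> i \<in> group_closure \<Lambda> \<inter> {\<omega>. \<not> ((\<lambda>T. avg T (\<lambda>x. g x * chr (- \<omega>) x)) \<longlongrightarrow> 0) at_top}"
        using \<mu>_mem[OF i(1)] by simp
    qed
  qed
qed


section \<open>Bohr coefficients, and almost periodicity relative to a spectrum\<close>

lemma trig_avg_chr_tendsto:
  assumes "trig_over S p"
  obtains L where "((\<lambda>T. avg T (\<lambda>x. p x * chr (- \<omega>) x)) \<longlongrightarrow> L) at_top" "\<omega> \<notin> S \<Longrightarrow> L = 0"
proof -
  obtain F c where F: "finite F" "F \<subseteq> S" and p: "p = (\<lambda>x. \<Sum>\<omega>\<in>F. c \<omega> * chr \<omega> x)"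
    using assms by (auto simp: trig_over_def)
  have "p x * chr (- \<omega>) x = (\<Sum>\<mu>\<in>F. c \<mu> * chr (\<mu> - \<omega>) x)" for x
    unfolding p sum_distrib_right diff_conv_add_uminus chr_add_left by (simp only: mult.assoc)
  then have "((\<lambda>T. avg T (\<lambda>x. p x * chr (- \<omega>) x)) \<longlongrightarrow> (\<Sum>\<mu>\<in>F. if \<mu> - \<omega> = 0 then c \<mu> else 0)) at_top"
    using avg_trig_tendsto[OF F(1), of c "\<lambda>\<mu>. \<mu> - \<omega>"] by simp
  then show thesis
    by (rule that) (use F in \<open>auto intro!: sum.neutral\<close>)
qed

lemma avg_dist_le:
  assumes "continuous_on UNIV f" "continuous_on UNIV p" "\<And>x. norm (f x - p x) \<le> \<epsilon>" "T > 0"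
  shows "norm (avg T (\<lambda>x. f x * chr \<omega> x) - avg T (\<lambda>x. p x * chr \<omega> x)) \<le> \<epsilon>"
proof -
  have "avg T (\<lambda>x. f x * chr \<omega> x) - avg T (\<lambda>x. p x * chr \<omega> x) = avg T (\<lambda>x. f x * chr \<omega> x - p x * chr \<omega> x)"
    by (intro avg_diff[symmetric] continuous_intros assms)
  also have "norm \<dots> \<le> \<epsilon>"
    using assms(3,4)
    by (intro avg_norm_le_const continuous_intros assms) (auto simp: norm_mult simp flip: left_diff_distrib)
  finally show ?thesis .
qed

text \<open>\<open>bohr_coeff\<close> is defined through \<open>Lim\<close>, which carries no
  information until convergence is known. Uniform approximation makes the means of the approximating
  polynomials a Cauchy sequence, and the averages of \<open>f\<close> inherit its limit; for
  \<open>\<omega>\<close> outside \<open>S\<close> all these means are \<open>0\<close>.\<close>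

lemma trig_limit_mean_exists:
  assumes f: "continuous_on UNIV f" and ap: "\<And>\<epsilon>. \<epsilon> > 0 \<Longrightarrow> \<exists>p. trig_over S p \<and> (\<forall>x. norm (f x - p x) \<le> \<epsilon>)"
  shows "((\<lambda>T. avg T (\<lambda>x. f x * chr (- \<omega>) x)) \<longlongrightarrow> bohr_coeff f \<omega>) at_top"
    and "\<omega> \<notin> S \<Longrightarrow> bohr_coeff f \<omega> = 0"
proof -
  define M where "M T = avg T (\<lambda>x. f x * chr (- \<omega>) x)" for T
  have bohr: "bohr_coeff f \<omega> = Lim at_top M"
    by (simp add: bohr_coeff_def M_def[abs_def] avg_def)
  have "\<exists>p. \<forall>n. trig_over S (p n) \<and> (\<forall>x. norm (f x - p n x) \<le> 1 / real (Suc n))"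
    using ap by (intro choice allI) simp
  then obtain p where p: "\<And>n. trig_over S (p n)" "\<And>n x. norm (f x - p n x) \<le> 1 / real (Suc n)"
    by blast
  have "\<exists>L. \<forall>n. ((\<lambda>T. avg T (\<lambda>x. p n x * chr (- \<omega>) x)) \<longlongrightarrow> L n) at_top \<and> (\<omega> \<notin> S \<longrightarrow> L n = 0)"
    by (intro choice allI) (metis trig_avg_chr_tendsto[OF p(1)])
  then obtain L where L: "\<And>n. ((\<lambda>T. avg T (\<lambda>x. p n x * chr (- \<omega>) x)) \<longlongrightarrow> L n) at_top"
    and L0: "\<And>n. \<omega> \<notin> S \<Longrightarrow> L n = 0" by blast
  have close: "\<forall>\<^sub>F T in at_top. norm (M T - avg T (\<lambda>x. p n x * chr (- \<omega>) x)) \<le> 1 / real (Suc n)" for n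
    using eventually_gt_at_top[of 0] unfolding M_def
    by eventually_elim (intro avg_dist_le f trig_over_continuous[OF p(1)] p(2))
  have near: "\<forall>\<^sub>F T in at_top. norm (M T - L n) \<le> 2 / real (Suc n)" for n
  proof -
    have "\<forall>\<^sub>F T in at_top. dist (avg T (\<lambda>x. p n x * chr (- \<omega>) x)) (L n) < 1 / real (Suc n)"
      using L by (intro tendstoD) auto
    with close[of n] show ?thesis
    proof eventually_elim
      case (elim T)
      then show ?case
        using norm_triangle_ineq[of "M T - avg T (\<lambda>x. p n x * chr (- \<omega>) x)" "avg T (\<lambda>x. p n x * chr (- \<omega>) x) - L n"]
        by (simp add: dist_norm)
    qed
  qed
  have LL: "dist (L m) (L n) \<le> 2 / real (Suc m) + 2 / real (Suc n)" for m n
  proof -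
    obtain T where "norm (M T - L m) \<le> 2 / real (Suc m)" "norm (M T - L n) \<le> 2 / real (Suc n)"
      using eventually_happens[OF eventually_conj[OF near[of m] near[of n]]] by auto
    then show ?thesis
      using dist_triangle3[of "L m" "L n" "M T"] by (simp add: dist_norm)
  qed
  have small: "(\<lambda>n. 2 / real (Suc n)) \<longlonglongrightarrow> 0"
    using tendsto_mult[OF tendsto_const[of 2] LIMSEQ_inverse_real_of_nat] by (simp add: divide_inverse)
  have "Cauchy L"
  proof (rule metric_CauchyI)
    fix e :: real assume "e > 0"
    then have "\<forall>\<^sub>F n in sequentially. 2 / real (Suc n) < e / 2"
      using small by (intro order_tendstoD(2)) auto
    then obtain N where N: "\<And>n. n \<ge> N \<Longrightarrow> 2 / real (Suc n) < e / 2"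
      by (auto simp: eventually_sequentially)
    show "\<exists>N. \<forall>m\<ge>N. \<forall>n\<ge>N. dist (L m) (L n) < e"
    proof (intro exI allI impI)
      fix m n assume "N \<le> m" "N \<le> n"
      then show "dist (L m) (L n) < e"
        using N[of m] N[of n] LL[of m n] by linarith
    qed
  qed
  then obtain l where l: "L \<longlonglongrightarrow> l" by (auto simp: Cauchy_convergent_iff convergent_def)
  have "(M \<longlongrightarrow> l) at_top"
  proof (rule tendstoI)
    fix e :: real assume e: "e > 0"
    have "\<forall>\<^sub>F n in sequentially. 2 / real (Suc n) < e / 2"
      using small e by (intro order_tendstoD(2)) auto
    moreover have "\<forall>\<^sub>F n in sequentially. dist (L n) l < e / 2"
      using l e by (intro tendstoD) auto
    ultimately obtain n where n: "2 / real (Suc n) < e / 2" "dist (L n) l < e / 2"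
      using eventually_happens[OF eventually_conj] trivial_limit_sequentially by blast
    show "\<forall>\<^sub>F T in at_top. dist (M T) l < e"
      using near[of n]
    proof eventually_elim
      case (elim T)
      then show ?case
        using n dist_triangle[of "M T" l "L n"] by (simp add: dist_norm)
    qed
  qed
  then have "bohr_coeff f \<omega> = l"
    unfolding bohr by (intro tendsto_Lim) auto
  with \<open>(M \<longlongrightarrow> l) at_top\<close> show "((\<lambda>T. avg T (\<lambda>x. f x * chr (- \<omega>) x)) \<longlongrightarrow> bohr_coeff f \<omega>) at_top"
    by (simp add: M_def[abs_def])
  show "bohr_coeff f \<omega> = 0" if "\<omega> \<notin> S"
    using L0[OF that] l \<open>bohr_coeff f \<omega> = l\<close> LIMSEQ_const_iff by (metis (no_types, lifting) LIMSEQ_unique ext tendsto_const)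
qed

lemma AP_approx:
  assumes "f \<in> AP" "\<epsilon> > 0"
  obtains p where "trig_over UNIV p" "\<And>x. norm (f x - p x) \<le> \<epsilon>"
proof -
  obtain P where P: "\<And>n. trig_poly (P n)" "uniform_limit UNIV P f sequentially"
    using assms(1) by (auto simp: AP_def)
  have "\<forall>\<^sub>F n in sequentially. \<forall>x\<in>UNIV. dist (P n x) (f x) < \<epsilon>"
    using P(2) assms(2) by (rule uniform_limitD)
  then obtain n where "\<forall>x\<in>UNIV. dist (P n x) (f x) < \<epsilon>"
    using eventually_happens trivial_limit_sequentially by blast
  then show thesis
    using that[of "P n"] P(1)[of n]
    by (auto simp: trig_poly_iff dist_norm norm_minus_commute intro: less_imp_le)
qed

text \<open>Polynomials approximating an element of \<open>AP\<close> may contain frequencies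
  foreign to \<open>f\<close>. One Fejer step replaces them by a polynomial supported where the mean
  of \<open>f\<close> does not vanish, so that almost periods are governed by the spectrum of
  \<open>f\<close> alone. The budget: an error \<open>\<eta> / 24\<close> yields the modulus
  \<open>\<eta> / 8\<close>, Fejer summation the error \<open>\<eta> / 4\<close>, and the last
  perturbation \<open>\<eta>\<close>.\<close>

lemma AP_ap_modulus:
  assumes f: "f \<in> AP" and cont: "continuous_on UNIV f" and B: "\<And>x. norm (f x) \<le> B" and \<eta>: "\<eta> > 0"
  obtains \<Lambda> \<delta> where "finite \<Lambda>" "\<Lambda> \<subseteq> {\<omega>. bohr_coeff f \<omega> \<noteq> 0}" "\<delta> > 0" "ap_modulus f \<Lambda> \<delta> \<eta>"
proof -
  have approx: "\<exists>p. trig_over UNIV p \<and> (\<forall>x. norm (f x - p x) \<le> \<epsilon>)" if "\<epsilon> > 0" for \<epsilon>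
    using AP_approx[OF f that] by metis
  have lim: "((\<lambda>T. avg T (\<lambda>x. f x * chr (- \<omega>) x)) \<longlongrightarrow> bohr_coeff f \<omega>) at_top" for \<omega>
    by (rule trig_limit_mean_exists(1)[OF cont approx])
  have spec: "{\<omega>. \<not> ((\<lambda>T. avg T (\<lambda>x. f x * chr (- \<omega>) x)) \<longlongrightarrow> 0) at_top} \<subseteq> {\<omega>. bohr_coeff f \<omega> \<noteq> 0}"
    using lim by (metis (mono_tags, lifting) Collect_mono)
  obtain p where p: "trig_over UNIV p" "\<And>x. norm (f x - p x) \<le> \<eta> / 24"
    using AP_approx[OF f, of "\<eta> / 24"] \<eta> by auto
  obtain \<Lambda>\<^sub>0 \<delta>\<^sub>0 where *: "finite \<Lambda>\<^sub>0" "\<delta>\<^sub>0 > 0" "ap_modulus p \<Lambda>\<^sub>0 \<delta>\<^sub>0 (\<eta> / 24)"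
    using trig_over_ap_modulus[OF p(1), of "\<eta> / 24"] \<eta> by (metis divide_pos_pos zero_less_numeral)
  have "ap_modulus f \<Lambda>\<^sub>0 \<delta>\<^sub>0 (\<eta> / 24 + 2 * (\<eta> / 24))"
    by (rule ap_modulus_perturb[OF *(3) p(2)])
  then have "ap_modulus f \<Lambda>\<^sub>0 \<delta>\<^sub>0 (\<eta> / 8)" by simp
  moreover have "\<eta> / 8 \<ge> 0" "\<eta> / 8 > 0" using \<eta> by auto
  ultimately obtain P where P: "trig_over (group_closure \<Lambda>\<^sub>0 \<inter> {\<omega>. \<not> ((\<lambda>T. avg T (\<lambda>x. f x * chr (- \<omega>) x)) \<longlongrightarrow> 0) at_top}) P"
    "\<And>x. norm (P x - f x) \<le> \<eta> / 8 + \<eta> / 8"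
    using fejer_approximation[OF cont B *(1,2)] by blast
  have "trig_over {\<omega>. bohr_coeff f \<omega> \<noteq> 0} P"
    by (rule trig_over_mono[OF P(1)]) (use spec in blast)
  then obtain \<Lambda> \<delta> where \<Lambda>: "finite \<Lambda>" "\<Lambda> \<subseteq> {\<omega>. bohr_coeff f \<omega> \<noteq> 0}" "\<delta> > 0" "ap_modulus P \<Lambda> \<delta> (\<eta> / 2)"
    using trig_over_ap_modulus[of _ P "\<eta> / 2"] \<eta> by (metis half_gt_zero)
  have "ap_modulus f \<Lambda> \<delta> (\<eta> / 2 + 2 * (\<eta> / 4))"
    by (rule ap_modulus_perturb[OF \<Lambda>(4)]) (use P(2) in \<open>simp add: norm_minus_commute\<close>)
  then show thesis using that \<Lambda> by simp
qed

lemma group_closure_subset_group_closure: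
  assumes "S \<subseteq> group_closure S'"
  shows "group_closure S \<subseteq> group_closure S'"
proof
  fix x assume "x \<in> group_closure S"
  then show "x \<in> group_closure S'"
    by induction (use assms in \<open>auto intro: group_closure.diff\<close>)
qed

text \<open>A converse to \<open>AP_ap_modulus\<close>: Fejer polynomials built from finite subsets
  of \<open>S\<close> have frequencies in the group generated by \<open>S\<close> and converge
  uniformly, so Bohr coefficients outside that group vanish. For the flow, \<open>S\<close> is the
  spectrum of the initial function.\<close>

lemma AP_of_ap_modulus:
  assumes cont: "continuous_on UNIV g" and B: "\<And>x. norm (g x) \<le> B"
    and ap: "\<And>\<eta>. \<eta> > 0 \<Longrightarrow> \<exists>\<Lambda> \<delta>. finite \<Lambda> \<and> \<Lambda> \<subseteq> S \<and> \<delta> > 0 \<and> ap_modulus g \<Lambda> \<delta> \<eta>"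
  shows "g \<in> AP" "frequency_module g \<subseteq> group_closure S"
proof -
  have approx: "\<exists>p. trig_over (group_closure S) p \<and> (\<forall>x. norm (g x - p x) \<le> \<epsilon>)" if \<epsilon>: "\<epsilon> > 0" for \<epsilon>
  proof -
    obtain \<Lambda> \<delta> where *: "finite \<Lambda>" "\<Lambda> \<subseteq> S" "\<delta> > 0" "ap_modulus g \<Lambda> \<delta> (\<epsilon> / 2)"
      using ap[of "\<epsilon> / 2"] \<epsilon> by auto
    have "\<epsilon> / 2 \<ge> 0" "\<epsilon> / 2 > 0" using \<epsilon> by auto
    then obtain P where P: "trig_over (group_closure \<Lambda> \<inter> {\<omega>. \<not> ((\<lambda>T. avg T (\<lambda>x. g x * chr (- \<omega>) x)) \<longlongrightarrow> 0) at_top}) P"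
      "\<And>x. norm (P x - g x) \<le> \<epsilon> / 2 + \<epsilon> / 2"
      using fejer_approximation[OF cont B *(1,3,4)] by blast
    have "group_closure \<Lambda> \<subseteq> group_closure S"
      using *(2) by (intro group_closure_subset_group_closure) (auto intro: group_closure.base)
    then have "trig_over (group_closure S) P"
      by (intro trig_over_mono[OF P(1)]) blast
    then show ?thesis using P(2) by (auto simp: norm_minus_commute)
  qed
  have "\<exists>p. \<forall>n. trig_over (group_closure S) (p n) \<and> (\<forall>x. norm (g x - p n x) \<le> 1 / real (Suc n))"
    using approx by (intro choice allI) simp
  then obtain p where p: "\<And>n. trig_over (group_closure S) (p n)" "\<And>n x. norm (g x - p n x) \<le> 1 / real (Suc n)"
    by blast
  have "uniform_limit UNIV p g sequentially"
  proof (rule uniform_limitI)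
    fix e :: real assume e: "e > 0"
    have "\<forall>\<^sub>F n in sequentially. 1 / real (Suc n) < e"
      using e LIMSEQ_inverse_real_of_nat by (intro order_tendstoD(2)) (auto simp: divide_inverse)
    then show "\<forall>\<^sub>F n in sequentially. \<forall>x\<in>UNIV. dist (p n x) (g x) < e"
      by eventually_elim (use p(2) in \<open>auto simp: dist_norm norm_minus_commute intro: le_less_trans\<close>)
  qed
  then show "g \<in> AP"
    using trig_over_mono[OF p(1) subset_UNIV] by (auto simp: AP_def trig_poly_iff)
  have "{\<omega>. bohr_coeff g \<omega> \<noteq> 0} \<subseteq> group_closure S"
    using trig_limit_mean_exists(2)[OF cont approx] by blast
  then show "frequency_module g \<subseteq> group_closure S"
    unfolding frequency_module_def by (rule group_closure_subset_group_closure)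
qed

section \<open>Frequency-uniform decomposition\<close>

lemma integrable_inverse_one_plus_square: "integrable lborel (\<lambda>x::real. 1 / (1 + x\<^sup>2))"
  using integrable_inverse_1_plus_square by (simp add: set_integrable_def divide_inverse)

lemma integrable_quadratic_decay:
  fixes g :: "real \<Rightarrow> complex"
  assumes "g \<in> borel_measurable lborel" "\<And>x. norm (g x) \<le> C / (1 + x\<^sup>2)"
  shows "integrable lborel g"
proof (rule Bochner_Integration.integrable_bound)
  show "integrable lborel (\<lambda>x::real. C * (1 / (1 + x\<^sup>2)))"
    by (intro integrable_mult_right integrable_inverse_one_plus_square)
  show "AE x in lborel. norm (g x) \<le> norm (C * (1 / (1 + x\<^sup>2)))"
  proof (rule AE_I2)
    fix x
    have "norm (g x) \<le> C * (1 / (1 + x\<^sup>2))" using assms(2)[of x] by simp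
    also have "\<dots> \<le> norm (C * (1 / (1 + x\<^sup>2)))" unfolding real_norm_def by (rule abs_ge_self)
    finally show "norm (g x) \<le> norm (C * (1 / (1 + x\<^sup>2)))" .
  qed
qed (fact assms(1))

text \<open>Two integrations by parts in one: \<open>F\<close> has derivative
  \<open>e * h'' + \<xi>\<^sup>2 * e * h\<close> and vanishes at both ends, so
  \<open>1 + \<xi>\<^sup>2\<close> times the transform is the integral of
  \<open>e * h - e * h''\<close>. The bound refers to a majorant \<open>u\<close> and not to
  \<open>R\<close>, hence stays uniform while the support grows.\<close>

lemma fourier_decay:
  fixes h h' h'' :: "real \<Rightarrow> complex"
  assumes h: "\<And>x. (h has_vector_derivative h' x) (at x)"
    and h': "\<And>x. (h' has_vector_derivative h'' x) (at x)"
    and h'': "continuous_on UNIV h''"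
    and supp: "\<And>x. R \<le> \<bar>x\<bar> \<Longrightarrow> h x = 0" "\<And>x. R \<le> \<bar>x\<bar> \<Longrightarrow> h' x = 0" "\<And>x. R \<le> \<bar>x\<bar> \<Longrightarrow> h'' x = 0"
    and R: "R \<ge> 0" and bound: "\<And>x. norm (h x) + norm (h'' x) \<le> u x" and u: "integrable lborel u"
  shows "norm (fourier h \<xi>) \<le> (LINT x|lborel. u x) / (1 + \<xi>\<^sup>2)"
    and "integrable lborel (\<lambda>x. exp (- (\<i> * of_real x * of_real \<xi>)) * h x)"
proof -
  define e where "e x = exp (- (\<i> * of_real x * of_real \<xi>))" for x :: real
  have e: "(e has_vector_derivative (- \<i> * of_real \<xi>) * e x) (at x)" for x
    unfolding e_def
    by (auto intro!: has_vector_derivative_real_field derivative_eq_intros)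
  have norm_e: "norm (e x) = 1" for x by (simp add: e_def)
  have hc: "continuous_on UNIV h" "continuous_on UNIV h'"
    using h h' by (auto intro!: continuous_at_imp_continuous_on has_vector_derivative_continuous)
  have ec: "continuous_on UNIV e" unfolding e_def by (intro continuous_intros)
  have int: "integrable lborel (\<lambda>x. e x * g x)"
    if "continuous_on UNIV g" "\<And>x. R \<le> \<bar>x\<bar> \<Longrightarrow> g x = 0" for g
  proof -
    have "integrable lborel (\<lambda>x. indicator {-R..R} x *\<^sub>R (e x * g x))"
      by (intro borel_integrable_compact continuous_on_subset[OF continuous_on_mult[OF ec that(1)]]) auto
    also have "(\<lambda>x. indicator {-R..R} x *\<^sub>R (e x * g x)) = (\<lambda>x. e x * g x)"
      using that(2) by (auto simp: indicator_def fun_eq_iff)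
    finally show ?thesis .
  qed
  have int_h: "integrable lborel (\<lambda>x. e x * h x)" and int_h'': "integrable lborel (\<lambda>x. e x * h'' x)"
    using supp by (auto intro!: int hc h'')
  then show "integrable lborel (\<lambda>x. exp (- (\<i> * of_real x * of_real \<xi>)) * h x)"
    by (simp add: e_def)
  define F where "F x = e x * (h' x + \<i> * of_real \<xi> * h x)" for x
  have F: "(F has_vector_derivative (e x * h'' x + of_real (\<xi>\<^sup>2) * (e x * h x))) (at x)" for x
  proof -
    have "(F has_vector_derivative (e x * (h'' x + \<i> * of_real \<xi> * h' x) +
        ((- \<i> * of_real \<xi>) * e x) * (h' x + \<i> * of_real \<xi> * h x))) (at x)"
      unfolding F_def by (intro derivative_intros e h h')
    also have "e x * (h'' x + \<i> * of_real \<xi> * h' x) + ((- \<i> * of_real \<xi>) * e x) * (h' x + \<i> * of_real \<xi> * h x) =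
        e x * h'' x - (\<i> * \<i>) * of_real (\<xi> * \<xi>) * (e x * h x)"
      unfolding of_real_mult by (simp only: algebra_simps) simp
    finally show ?thesis by (simp add: power2_eq_square)
  qed
  have "(LINT x|lborel. indicator {-R..R} x *\<^sub>R (e x * h'' x + of_real (\<xi>\<^sup>2) * (e x * h x))) = F R - F (- R)"
    using R by (intro integral_FTC_Icc has_vector_derivative_at_within[OF F] continuous_intros
        continuous_on_subset[OF ec] continuous_on_subset[OF h''] continuous_on_subset[OF hc(1)]) auto
  also have "\<dots> = 0"
    using R by (simp add: F_def supp)
  also have "(\<lambda>x. indicator {-R..R} x *\<^sub>R (e x * h'' x + of_real (\<xi>\<^sup>2) * (e x * h x))) =
      (\<lambda>x. e x * h'' x + of_real (\<xi>\<^sup>2) * (e x * h x))"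
    using supp by (auto simp: indicator_def fun_eq_iff)
  finally have "(LINT x|lborel. e x * h'' x) + of_real (\<xi>\<^sup>2) * fourier h \<xi> = 0"
    using int_h int_h'' by (simp add: fourier_def e_def)
  then have "of_real (1 + \<xi>\<^sup>2) * fourier h \<xi> = fourier h \<xi> - (LINT x|lborel. e x * h'' x)"
    by (simp add: algebra_simps eq_neg_iff_add_eq_0)
  also have "\<dots> = (LINT x|lborel. e x * h x - e x * h'' x)"
    using int_h int_h'' by (simp add: fourier_def e_def)
  also have "norm \<dots> \<le> (LINT x|lborel. u x)"
  proof (rule Bochner_Integration.integral_norm_bound_integral)
    fix x
    have "norm (e x * h x - e x * h'' x) \<le> norm (e x * h x) + norm (e x * h'' x)"
      by (rule norm_triangle_ineq4)
    also have "\<dots> \<le> u x" using bound[of x] by (simp add: norm_mult norm_e)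
    finally show "norm (e x * h x - e x * h'' x) \<le> u x" .
  qed (use int_h int_h'' u in auto)
  finally have "(1 + \<xi>\<^sup>2) * norm (fourier h \<xi>) \<le> (LINT x|lborel. u x)"
    unfolding norm_mult norm_of_real by simp
  then show "norm (fourier h \<xi>) \<le> (LINT x|lborel. u x) / (1 + \<xi>\<^sup>2)"
    by (simp add: pos_le_divide_eq add_pos_nonneg mult.commute)
qed

text \<open>The power is at most \<open>exp (k * \<bar>x\<bar>)\<close>, and completing the square
  in \<open>\<bar>x - a\<bar>\<close> bounds the exponent.\<close>

lemma power_times_gaussian_bounded:
  fixes a c :: real
  assumes "c > 0"
  shows "\<exists>C. \<forall>x. \<bar>x\<bar> ^ k * exp (- (c * (x - a)\<^sup>2)) \<le> C"
proof (intro exI allI)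
  fix x :: real
  have "\<bar>x\<bar> \<le> exp \<bar>x\<bar>"
    using exp_ge_add_one_self[of "\<bar>x\<bar>"] by linarith
  then have "\<bar>x\<bar> ^ k \<le> exp \<bar>x\<bar> ^ k"
    by (intro power_mono) auto
  also have "\<dots> = exp (real k * \<bar>x\<bar>)" by (simp add: exp_of_nat_mult)
  finally have "\<bar>x\<bar> ^ k * exp (- (c * (x - a)\<^sup>2)) \<le> exp (real k * \<bar>x\<bar>) * exp (- (c * (x - a)\<^sup>2))"
    by (intro mult_right_mono) auto
  also have "\<dots> = exp (real k * \<bar>x\<bar> - c * (x - a)\<^sup>2)" by (simp add: exp_add[symmetric])
  also have "\<dots> \<le> exp (real k * \<bar>a\<bar> + (real k)\<^sup>2 / (4 * c))"
  proof -
    define y where "y = \<bar>x - a\<bar>"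
    have "real k * \<bar>x\<bar> \<le> real k * (\<bar>a\<bar> + y)"
      unfolding y_def by (intro mult_left_mono) auto
    moreover have "real k * y \<le> c * y\<^sup>2 + (real k)\<^sup>2 / (4 * c)"
    proof -
      have "0 \<le> c * (y - real k / (2 * c))\<^sup>2" using assms by simp
      also have "\<dots> = c * y\<^sup>2 + (real k)\<^sup>2 / (4 * c) - real k * y"
        using assms by (simp add: power2_eq_square field_simps)
      finally show ?thesis by simp
    qed
    moreover have "(x - a)\<^sup>2 = y\<^sup>2" by (simp add: y_def)
    ultimately show ?thesis by (simp add: algebra_simps)
  qed
  finally show "\<bar>x\<bar> ^ k * exp (- (c * (x - a)\<^sup>2)) \<le> exp (real k * \<bar>a\<bar> + (real k)\<^sup>2 / (4 * c))" .
qed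

lemma normal_density_eq_exp:
  "normal_density a s x = 1 / sqrt (2 * pi * s\<^sup>2) * exp (- ((1 / (2 * s\<^sup>2)) * (x - a)\<^sup>2))"
  by (simp add: normal_density_def)

lemma poly_times_normal_density_bounded:
  assumes "s > 0"
  shows "\<exists>C. \<forall>x. \<bar>poly p x * normal_density a s x\<bar> \<le> C"
proof -
  have c: "1 / (2 * s\<^sup>2) > 0" using assms by simp
  have "\<exists>C. \<forall>k x. \<bar>x\<bar> ^ k * exp (- ((1 / (2 * s\<^sup>2)) * (x - a)\<^sup>2)) \<le> C k"
    using power_times_gaussian_bounded[OF c] by (intro choice allI)
  then obtain C where C: "\<And>k x. \<bar>x\<bar> ^ k * exp (- ((1 / (2 * s\<^sup>2)) * (x - a)\<^sup>2)) \<le> C k" by blast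
  show ?thesis
  proof (intro exI allI)
    fix x
    have "\<bar>poly p x * normal_density a s x\<bar> =
        1 / sqrt (2 * pi * s\<^sup>2) * (\<bar>\<Sum>i\<le>degree p. coeff p i * x ^ i\<bar> * exp (- ((1 / (2 * s\<^sup>2)) * (x - a)\<^sup>2)))"
      by (simp add: normal_density_eq_exp poly_altdef abs_mult)
    also have "\<dots> \<le> 1 / sqrt (2 * pi * s\<^sup>2) *
        ((\<Sum>i\<le>degree p. \<bar>coeff p i\<bar> * \<bar>x\<bar> ^ i) * exp (- ((1 / (2 * s\<^sup>2)) * (x - a)\<^sup>2)))"
      using sum_abs[of "\<lambda>i. coeff p i * x ^ i" "{..degree p}"]
      by (intro mult_left_mono mult_right_mono) (auto simp: abs_mult power_abs)
    also have "\<dots> \<le> 1 / sqrt (2 * pi * s\<^sup>2) * (\<Sum>i\<le>degree p. \<bar>coeff p i\<bar> * C i)"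
      unfolding sum_distrib_right mult.assoc
      by (intro mult_left_mono sum_mono C) auto
    finally show "\<bar>poly p x * normal_density a s x\<bar> \<le> 1 / sqrt (2 * pi * s\<^sup>2) * (\<Sum>i\<le>degree p. \<bar>coeff p i\<bar> * C i)" .
  qed
qed

text \<open>Normal densities are the probes for distributions: they are Schwartz functions of total
  mass \<open>1\<close>, they concentrate at points, and their transforms have closed form.\<close>

definition gauss :: "real \<Rightarrow> real \<Rightarrow> real \<Rightarrow> complex" where
  "gauss a s x = of_real (normal_density a s x)"

text \<open>Polynomials times the density are closed under differentiation, with \<open>D\<close>
  acting on the polynomial, so every weighted derivative is again of this bounded form.\<close>

lemma gauss_schwartz:
  assumes s: "s > 0"
  shows "gauss a s \<in> schwartz"
proof -
  define D where "D p = pderiv p - [: - a / s\<^sup>2, 1 / s\<^sup>2 :] * p" for p :: "real poly"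
  define G where "G p x = complex_of_real (poly p x * normal_density a s x)" for p x
  have "(normal_density a s has_real_derivative (- (x - a) / s\<^sup>2 * normal_density a s x)) (at x)" for x
  proof -
    define A where "A = 1 / sqrt (2 * pi * s\<^sup>2)"
    show ?thesis
      unfolding normal_density_eq_exp A_def[symmetric] using s
      by (auto intro!: derivative_eq_intros simp: power2_eq_square field_simps)
  qed
  then have "((\<lambda>x. poly p x * normal_density a s x) has_real_derivative poly (D p) x * normal_density a s x) (at x)" for p x
    by (auto intro!: derivative_eq_intros simp: D_def algebra_simps diff_divide_distrib)
  then have G: "(G p has_vector_derivative G (D p) x) (at x)" for p x
    unfolding G_def by (intro has_vector_derivative_of_real) (simp add: has_real_derivative_iff_has_vector_derivative)
  then have "vderiv (G p) = G (D p)" for p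
    by (intro ext vderiv_eqI)
  then have iter: "(vderiv ^^ n) (G p) = G ((D ^^ n) p)" for n p
    by (induction n) auto
  have gauss_eq: "gauss a s = G 1" by (simp add: gauss_def[abs_def] G_def[abs_def])
  have "smooth (gauss a s)"
    unfolding smooth_def gauss_eq iter using G differentiableI_vector by blast
  moreover have "bounded (range (\<lambda>x. x ^ m *\<^sub>R (vderiv ^^ n) (gauss a s) x))" for m n
  proof -
    obtain C where C: "\<And>x. \<bar>poly (monom 1 m * (D ^^ n) 1) x * normal_density a s x\<bar> \<le> C"
      using poly_times_normal_density_bounded[OF s] by blast
    have "norm (x ^ m *\<^sub>R (vderiv ^^ n) (gauss a s) x) \<le> C" for x
      using C[of x] unfolding gauss_eq iter G_def
      by (simp add: poly_monom norm_mult abs_mult power_abs mult.assoc del: of_real_mult)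
    then show ?thesis by (intro boundedI) auto
  qed
  ultimately show ?thesis by (simp add: schwartz_def)
qed

lemma integrable_gauss [simp]: "s > 0 \<Longrightarrow> integrable lborel (gauss a s)"
  unfolding gauss_def by simp

lemma norm_gauss: "norm (gauss a s x) = normal_density a s x"
  by (simp add: gauss_def)

text \<open>Rescaling to \<open>a + s * z\<close> moves the width into the argument of
  \<open>g\<close>; \<open>B * std_normal_density z\<close> then dominates.\<close>

lemma gauss_approximate_identity:
  fixes g :: "real \<Rightarrow> complex"
  assumes g: "continuous_on UNIV g" and B: "\<And>x. norm (g x) \<le> B"
  shows "(\<lambda>n. LINT x|lborel. g x * gauss a (1 / real (Suc n)) x) \<longlonglongrightarrow> g a"
proof -
  have [measurable]: "g \<in> borel_measurable borel"
    using g by (rule borel_measurable_continuous_onI)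
  have subst: "(LINT x|lborel. g x * gauss a s x) = (LINT z|lborel. g (a + s * z) * of_real (std_normal_density z))"
    if s: "s > 0" for s
  proof -
    have "(LINT x|lborel. g x * gauss a s x) = \<bar>s\<bar> *\<^sub>R (LINT z|lborel. g (a + s * z) * gauss a s (a + s * z))"
      using s by (intro lborel_integral_real_affine) auto
    also have "\<dots> = (LINT z|lborel. s *\<^sub>R (g (a + s * z) * gauss a s (a + s * z)))"
      using s by simp
    also have "(\<lambda>z. s *\<^sub>R (g (a + s * z) * gauss a s (a + s * z))) =
        (\<lambda>z. g (a + s * z) * of_real (std_normal_density z))"
      using s by (simp add: fun_eq_iff gauss_def normal_density_def scaleR_conv_of_real real_sqrt_mult power_mult_distrib)
    finally show ?thesis .
  qed
  have "(\<lambda>n. LINT z|lborel. g (a + 1 / real (Suc n) * z) * of_real (std_normal_density z)) \<longlonglongrightarrow>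
      (LINT z|lborel. g a * of_real (std_normal_density z))"
  proof (rule integral_dominated_convergence[where w = "\<lambda>z. B * std_normal_density z"])
    show "AE z in lborel. (\<lambda>n. g (a + 1 / real (Suc n) * z) * of_real (std_normal_density z))
        \<longlonglongrightarrow> g a * of_real (std_normal_density z)"
    proof (rule AE_I2, intro tendsto_mult tendsto_const)
      fix z
      have lim: "(\<lambda>n. a + 1 / real (Suc n) * z) \<longlonglongrightarrow> a + 0 * z"
        using LIMSEQ_inverse_real_of_nat unfolding inverse_eq_divide
        by (intro tendsto_intros)
      have "isCont g (a + 0 * z)"
        using g by (simp add: continuous_on_eq_continuous_at)
      from isCont_tendsto_compose[OF this lim]
      show "(\<lambda>n. g (a + 1 / real (Suc n) * z)) \<longlonglongrightarrow> g a" by simp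
    qed
    show "AE z in lborel. norm (g (a + 1 / real (Suc n) * z) * of_real (std_normal_density z)) \<le> B * std_normal_density z" for n
      by (rule AE_I2) (auto simp: norm_mult B intro!: mult_right_mono)
  qed auto
  also have "(LINT z|lborel. g a * of_real (std_normal_density z)) = g a"
    by simp
  finally show ?thesis by (simp add: subst)
qed

text \<open>A rescaling of the characteristic function of the standard normal distribution.\<close>

lemma gaussian_integral:
  fixes t s :: real
  assumes s: "s > 0"
  shows "(LINT x|lborel. exp (\<i> * of_real t * of_real x) * of_real (exp (- (s\<^sup>2 * x\<^sup>2 / 2)))) =
    of_real (sqrt (2 * pi) / s * exp (- (t\<^sup>2 / (2 * s\<^sup>2))))"
    and "integrable lborel (\<lambda>x. exp (\<i> * of_real t * of_real x) * complex_of_real (exp (- (s\<^sup>2 * x\<^sup>2 / 2))))"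
proof -
  have base: "(LINT x|lborel. exp (\<i> * of_real t * of_real x) * complex_of_real (std_normal_density x)) =
      of_real (exp (- (t\<^sup>2 / 2)))" for t
  proof -
    have "char std_normal_distribution t = (LINT x|lborel. std_normal_density x *\<^sub>R iexp (t * x))"
      unfolding char_def by (subst integral_density) (auto simp: normal_density_nonneg)
    then show ?thesis
      by (simp add: char_std_normal_distribution scaleR_conv_of_real mult_ac)
  qed
  have std: "of_real (exp (- (s\<^sup>2 * x\<^sup>2 / 2))) = complex_of_real (sqrt (2 * pi)) * of_real (std_normal_density (s * x))" for x
    unfolding std_normal_density_def of_real_mult[symmetric]
    by (simp add: power_mult_distrib)
  have int_std: "integrable lborel (\<lambda>x. exp (\<i> * of_real t * of_real x) * complex_of_real (std_normal_density x))" for t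
    by (rule Bochner_Integration.integrable_bound[OF integrable_normal_density[of 1 0]])
      (auto simp: norm_mult)
  have ts: "exp (\<i> * of_real t * of_real x) = exp (\<i> * of_real (t / s) * of_real (s * x))" for x
    using s by (simp add: mult.assoc)
  have "(LINT x|lborel. exp (\<i> * of_real (t / s) * of_real x) * complex_of_real (std_normal_density x)) =
      \<bar>s\<bar> *\<^sub>R (LINT x|lborel. exp (\<i> * of_real (t / s) * of_real (0 + s * x)) * complex_of_real (std_normal_density (0 + s * x)))"
    using s by (intro lborel_integral_real_affine) auto
  then have *: "(LINT x|lborel. exp (\<i> * of_real (t / s) * of_real (s * x)) * complex_of_real (std_normal_density (s * x))) =
      of_real (exp (- ((t / s)\<^sup>2 / 2)) / s)"
    using s unfolding base by (simp add: scaleR_conv_of_real field_simps)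
  have "(LINT x|lborel. exp (\<i> * of_real t * of_real x) * of_real (exp (- (s\<^sup>2 * x\<^sup>2 / 2)))) =
      (LINT x|lborel. of_real (sqrt (2 * pi)) * (exp (\<i> * of_real (t / s) * of_real (s * x)) * of_real (std_normal_density (s * x))))"
    unfolding std ts by (simp only: mult.left_commute)
  also have "\<dots> = of_real (sqrt (2 * pi)) * of_real (exp (- ((t / s)\<^sup>2 / 2)) / s)"
    unfolding integral_mult_right_zero * ..
  finally show "(LINT x|lborel. exp (\<i> * of_real t * of_real x) * of_real (exp (- (s\<^sup>2 * x\<^sup>2 / 2)))) =
    of_real (sqrt (2 * pi) / s * exp (- (t\<^sup>2 / (2 * s\<^sup>2))))"
    by (simp add: power_divide mult.commute)
  have "integrable lborel (\<lambda>x. of_real (sqrt (2 * pi)) * (exp (\<i> * of_real (t / s) * of_real (0 + s * x)) * complex_of_real (std_normal_density (0 + s * x))))"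
    using s by (intro integrable_mult_right lborel_integrable_real_affine[OF int_std]) auto
  then show "integrable lborel (\<lambda>x. exp (\<i> * of_real t * of_real x) * complex_of_real (exp (- (s\<^sup>2 * x\<^sup>2 / 2))))"
    unfolding std ts by (simp only: mult.left_commute add_0)
qed

lemma inv_fourier_gauss:
  assumes s: "s > 0"
  shows "inv_fourier (gauss a s) = (\<lambda>\<xi>. exp (\<i> * of_real a * of_real \<xi>) * of_real (exp (- (s\<^sup>2 * \<xi>\<^sup>2 / 2)) / (2 * pi)))"
proof
  fix \<xi>
  have "(LINT x|lborel. exp (\<i> * of_real \<xi> * of_real x) * gauss a s x) =
      \<bar>1\<bar> *\<^sub>R (LINT x|lborel. exp (\<i> * of_real \<xi> * of_real (a + 1 * x)) * gauss a s (a + 1 * x))"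
    by (intro lborel_integral_real_affine) auto
  also have "\<dots> = (LINT x|lborel. (exp (\<i> * of_real a * of_real \<xi>) / of_real (sqrt (2 * pi) * s)) *
      (exp (\<i> * of_real \<xi> * of_real x) * of_real (exp (- ((1 / s)\<^sup>2 * x\<^sup>2 / 2)))))"
    using s by (simp add: gauss_def normal_density_def exp_add algebra_simps real_sqrt_mult power_divide)
  also have "\<dots> = (exp (\<i> * of_real a * of_real \<xi>) / of_real (sqrt (2 * pi) * s)) *
      of_real (sqrt (2 * pi) / (1 / s) * exp (- (\<xi>\<^sup>2 / (2 * (1 / s)\<^sup>2))))"
    unfolding integral_mult_right_zero using s by (subst gaussian_integral) auto
  also have "\<dots> = exp (\<i> * of_real a * of_real \<xi>) * of_real (exp (- (s\<^sup>2 * \<xi>\<^sup>2 / 2)))"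
    using s by (simp add: field_simps)
  finally show "inv_fourier (gauss a s) \<xi> = exp (\<i> * of_real a * of_real \<xi>) * of_real (exp (- (s\<^sup>2 * \<xi>\<^sup>2 / 2)) / (2 * pi))"
    by (simp add: inv_fourier_def)
qed

text \<open>Both transforms are evaluated in closed form. This inversion identifies the limit when
  the partition of unity is summed up in frequency.\<close>

lemma fourier_inv_fourier_gauss:
  assumes s: "s > 0"
  shows "fourier (inv_fourier (gauss a s)) = gauss a s"
    and "integrable lborel (inv_fourier (gauss a s))"
proof -
  show "fourier (inv_fourier (gauss a s)) = gauss a s"
  proof
    fix x
    have "fourier (inv_fourier (gauss a s)) x =
        (LINT \<xi>|lborel. of_real (1 / (2 * pi)) * (exp (\<i> * of_real (a - x) * of_real \<xi>) * of_real (exp (- (s\<^sup>2 * \<xi>\<^sup>2 / 2)))))"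
      unfolding fourier_def inv_fourier_gauss[OF s]
      by (intro Bochner_Integration.integral_cong refl)
        (simp add: exp_add[symmetric] exp_diff field_simps)
    also have "\<dots> = of_real (1 / (2 * pi)) * of_real (sqrt (2 * pi) / s * exp (- ((a - x)\<^sup>2 / (2 * s\<^sup>2))))"
      unfolding integral_mult_right_zero using s by (subst gaussian_integral) auto
    also have "\<dots> = gauss a s x"
    proof -
      have "1 / (2 * pi) * (sqrt (2 * pi) / s) = 1 / sqrt (2 * pi * s\<^sup>2)"
        using s by (simp add: real_sqrt_mult field_simps)
      then have "1 / (2 * pi) * (sqrt (2 * pi) / s * exp (- ((a - x)\<^sup>2 / (2 * s\<^sup>2)))) = normal_density a s x"
        unfolding normal_density_def by (simp only: power2_commute[of a x] mult.assoc[symmetric]) simp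
      then show ?thesis
        unfolding of_real_mult[symmetric] gauss_def by (rule arg_cong)
    qed
    finally show "fourier (inv_fourier (gauss a s)) x = gauss a s x" .
  qed
  have "integrable lborel (\<lambda>\<xi>. (exp (\<i> * of_real a * of_real \<xi>) * of_real (exp (- (s\<^sup>2 * \<xi>\<^sup>2 / 2)))) * of_real (1 / (2 * pi)))"
    by (intro integrable_mult_left gaussian_integral s)
  then show "integrable lborel (inv_fourier (gauss a s))"
    unfolding inv_fourier_gauss[OF s] by (simp add: mult.assoc)
qed

lemma vderiv_zero_on_open:
  fixes f :: "real \<Rightarrow> 'a::real_normed_vector"
  assumes "open U" "\<And>y. y \<in> U \<Longrightarrow> f y = 0" "x \<in> U"
  shows "vderiv f x = 0"
proof (rule vderiv_eqI)
  have "((\<lambda>_. 0) has_vector_derivative 0) (at x)" by simp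
  then show "(f has_vector_derivative 0) (at x)"
    by (rule has_vector_derivative_transform_within_open[OF _ assms(1,3)]) (simp add: assms(2))
qed

lemma schwartz_decay:
  assumes "\<phi> \<in> schwartz"
  shows "norm (\<phi> x) \<le> (schwartz_seminorm 0 0 \<phi> + schwartz_seminorm 2 0 \<phi>) / (1 + x\<^sup>2)"
proof -
  have b: "bdd_above (range (\<lambda>x. norm (x ^ m *\<^sub>R (vderiv ^^ n) \<phi> x)))" for m n
  proof -
    have "bounded (range (\<lambda>x. x ^ m *\<^sub>R (vderiv ^^ n) \<phi> x))"
      using assms by (simp add: schwartz_def)
    then show ?thesis by (auto simp: bounded_iff bdd_above_def)
  qed
  have "norm (x ^ m *\<^sub>R (vderiv ^^ 0) \<phi> x) \<le> schwartz_seminorm m 0 \<phi>" for m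
    unfolding schwartz_seminorm_def by (intro cSUP_upper b) auto
  from this[of 0] this[of 2] have "(1 + x\<^sup>2) * norm (\<phi> x) \<le> schwartz_seminorm 0 0 \<phi> + schwartz_seminorm 2 0 \<phi>"
    by (simp add: algebra_simps)
  then show ?thesis
    by (simp add: pos_le_divide_eq add_pos_nonneg mult.commute)
qed

lemma schwartz_continuous: "\<phi> \<in> schwartz \<Longrightarrow> continuous_on UNIV \<phi>"
proof -
  assume \<phi>: "\<phi> \<in> schwartz"
  have "(vderiv ^^ 0) \<phi> differentiable (at x)" for x
    using \<phi> unfolding schwartz_def smooth_def by blast
  then show ?thesis
    by (auto intro!: continuous_at_imp_continuous_on differentiable_imp_continuous_within)
qed

lemma schwartz_integrable: "\<phi> \<in> schwartz \<Longrightarrow> integrable lborel \<phi>"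
  by (rule integrable_quadratic_decay[OF _ schwartz_decay])
    (auto intro!: borel_measurable_continuous_onI schwartz_continuous)

lemma inv_fourier_eq_fourier: "inv_fourier g x = fourier g (- x) / of_real (2 * pi)"
  by (simp add: inv_fourier_def fourier_def mult_ac)

section \<open>The essential supremum of a distribution, tested on Gaussians\<close>

lemma Linf_norm_le:
  assumes "g \<in> borel_measurable lborel" "\<And>x. norm (g x) \<le> C"
    "\<And>\<phi>. \<phi> \<in> schwartz \<Longrightarrow> u \<phi> = regular_dist g \<phi>"
  shows "Linf_norm u \<le> ennreal C"
  unfolding Linf_norm_def by (rule Inf_lower) (use assms in auto)

text \<open>A Gaussian is a probability density, so testing against it cannot exceed any essential
  bound. If there is no bounded representative, the right-hand side is
  \<open>\<infinity>\<close>.\<close>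

lemma Linf_norm_gauss_bound:
  assumes "s > 0"
  shows "ennreal (norm (u (gauss a s))) \<le> Linf_norm u"
  unfolding Linf_norm_def
proof (rule Inf_greatest, safe)
  fix C g
  assume g: "g \<in> borel_measurable lborel" "AE x in lborel. norm (g x) \<le> C"
    "\<forall>\<phi>\<in>schwartz. u \<phi> = regular_dist g \<phi>"
  have "u (gauss a s) = (LINT x|lborel. g x * gauss a s x)"
    using g(3) gauss_schwartz[OF assms] by (simp add: regular_dist_def)
  also have "norm \<dots> \<le> (LINT x|lborel. norm (g x * gauss a s x))"
    by (rule integral_norm_bound)
  also have "\<dots> \<le> (LINT x|lborel. C * normal_density a s x)"
  proof (rule integral_mono_AE')
    show ae: "AE x in lborel. norm (g x * gauss a s x) \<le> C * normal_density a s x"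
      using g(2) by eventually_elim (auto simp: norm_mult norm_gauss intro: mult_right_mono)
    show "AE x in lborel. 0 \<le> C * normal_density a s x"
      using ae by eventually_elim (rule order_trans[OF norm_ge_zero])
    show "integrable lborel (\<lambda>x. C * normal_density a s x)" using assms by simp
  qed
  also have "\<dots> = C" using assms by simp
  finally show "ennreal (norm (u (gauss a s))) \<le> ennreal C" by (rule ennreal_leI)
qed

lemma Linf_norm_ge_point:
  assumes g: "continuous_on UNIV g" "\<And>x. norm (g x) \<le> B"
    and u: "\<And>\<phi>. \<phi> \<in> schwartz \<Longrightarrow> u \<phi> = regular_dist g \<phi>"
  shows "ennreal (norm (g a)) \<le> Linf_norm u"
proof (rule LIMSEQ_le_const2)
  show "(\<lambda>n. ennreal (norm (LINT x|lborel. g x * gauss a (1 / real (Suc n)) x))) \<longlonglongrightarrow> ennreal (norm (g a))"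
    by (intro tendsto_ennrealI tendsto_norm gauss_approximate_identity[OF g])
  show "\<exists>N. \<forall>n\<ge>N. ennreal (norm (LINT x|lborel. g x * gauss a (1 / real (Suc n)) x)) \<le> Linf_norm u"
    using Linf_norm_gauss_bound[of "1 / real (Suc n)" u a for n]
    by (intro exI[of _ 0] allI impI) (auto simp: u gauss_schwartz regular_dist_def)
qed

text \<open>One inequality takes \<open>g\<close> itself as competitor in the infimum, the other
  recovers \<open>g a\<close> by narrowing Gaussians. It replaces essential suprema by suprema of a
  function.\<close>

lemma Linf_norm_continuous:
  assumes "continuous_on UNIV g" "\<And>x. norm (g x) \<le> B"
    and "\<And>\<phi>. \<phi> \<in> schwartz \<Longrightarrow> u \<phi> = regular_dist g \<phi>"
  shows "Linf_norm u = (SUP x. ennreal (norm (g x)))"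
proof (rule antisym)
  have B: "(SUP x. ennreal (norm (g x))) \<le> ennreal B"
    using assms(2) by (intro SUP_least ennreal_leI)
  then obtain C where C: "(SUP x. ennreal (norm (g x))) = ennreal C" "C \<ge> 0"
    by (metis ennreal_cases ennreal_neq_top neq_top_trans)
  have "norm (g x) \<le> C" for x
  proof -
    have "ennreal (norm (g x)) \<le> ennreal C" unfolding C(1)[symmetric] by (rule SUP_upper) simp
    then show ?thesis using C(2) by simp
  qed
  then show "Linf_norm u \<le> (SUP x. ennreal (norm (g x)))"
    unfolding C(1) by (intro Linf_norm_le) (auto intro: borel_measurable_continuous_onI assms(1,3))
  show "(SUP x. ennreal (norm (g x))) \<le> Linf_norm u"
    by (intro SUP_least Linf_norm_ge_point[OF assms])
qed

section \<open>Box operators as convolutions with integrable kernels\<close>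

locale cutoff =
  fixes \<sigma> :: "real \<Rightarrow> real"
  assumes uniform_cutoff: "uniform_cutoff \<sigma>"
begin

definition \<sigma>' :: "real \<Rightarrow> real" where "\<sigma>' = vderiv \<sigma>"

definition \<sigma>'' :: "real \<Rightarrow> real" where "\<sigma>'' = vderiv \<sigma>'"

lemma cutoff_derivs:
  "(\<sigma> has_vector_derivative \<sigma>' x) (at x)" "(\<sigma>' has_vector_derivative \<sigma>'' x) (at x)"
  "continuous_on S \<sigma>" "continuous_on S \<sigma>'" "continuous_on S \<sigma>''"
proof -
  have d: "((vderiv ^^ n) \<sigma>) differentiable (at x)" for n x
    using uniform_cutoff by (auto simp: uniform_cutoff_def smooth_def)
  have "\<sigma> differentiable (at x)" "\<sigma>' differentiable (at x)" "\<sigma>'' differentiable (at x)" for x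
    using d[of 0 x] d[of 1 x] d[of 2 x] by (simp_all add: \<sigma>'_def \<sigma>''_def numeral_2_eq_2)
  then show "(\<sigma> has_vector_derivative \<sigma>' x) (at x)" "(\<sigma>' has_vector_derivative \<sigma>'' x) (at x)"
    "continuous_on S \<sigma>" "continuous_on S \<sigma>'" "continuous_on S \<sigma>''"
    by (auto simp: \<sigma>'_def \<sigma>''_def intro!: has_vector_derivative_vderiv
        continuous_at_imp_continuous_on differentiable_imp_continuous_within)
qed

lemma cutoff_support:
  assumes "\<bar>x\<bar> \<ge> 1"
  shows "\<sigma> x = 0" "\<sigma>' x = 0" "\<sigma>'' x = 0"
proof -
  define U where "U = - closure {\<xi>. \<sigma> \<xi> \<noteq> 0}"
  have U: "open U" unfolding U_def by (intro open_Compl closed_closure)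
  have x: "x \<in> U"
    using uniform_cutoff assms by (auto simp: U_def uniform_cutoff_def abs_le_iff subset_iff) 
  have 0: "\<sigma> y = 0" if "y \<in> U" for y
    using that closure_subset[of "{\<xi>. \<sigma> \<xi> \<noteq> 0}"] by (auto simp: U_def)
  have 1: "\<sigma>' y = 0" if "y \<in> U" for y
    unfolding \<sigma>'_def by (rule vderiv_zero_on_open[OF U 0 that])
  have 2: "\<sigma>'' y = 0" if "y \<in> U" for y
    unfolding \<sigma>''_def by (rule vderiv_zero_on_open[OF U 1 that])
  show "\<sigma> x = 0" "\<sigma>' x = 0" "\<sigma>'' x = 0" using 0 1 2 x by auto
qed

lemma cutoff_bounded:
  obtains M where "M > 0" "\<And>x. \<bar>\<sigma> x\<bar> \<le> M" "\<And>x. \<bar>\<sigma>' x\<bar> \<le> M" "\<And>x. \<bar>\<sigma>'' x\<bar> \<le> M"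
proof -
  have "\<exists>C. \<forall>x. \<bar>g x\<bar> \<le> C" if c: "continuous_on {-1..1} g" and z: "\<And>x. \<bar>x\<bar> \<ge> 1 \<Longrightarrow> g x = 0" for g :: "real \<Rightarrow> real"
  proof -
    have "bounded (g ` {-1..1})"
      using c by (intro compact_imp_bounded compact_continuous_image) auto
    then obtain C where C: "\<forall>x\<in>{-1..1}. norm (g x) \<le> C"
      by (auto simp: bounded_iff)
    have "\<bar>g x\<bar> \<le> C" for x
    proof (cases "\<bar>x\<bar> \<ge> 1")
      case True
      then show ?thesis using z[of x] bspec[OF C, of 0] norm_ge_zero[of "g 0"] by simp
    next
      case False
      then have "x \<in> {-1..1}" by (auto simp: abs_if split: if_splits)
      then show ?thesis using C by auto
    qed
    then show ?thesis by blast
  qed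
  then obtain C0 C1 C2 where C: "\<And>x. \<bar>\<sigma> x\<bar> \<le> C0" "\<And>x. \<bar>\<sigma>' x\<bar> \<le> C1" "\<And>x. \<bar>\<sigma>'' x\<bar> \<le> C2"
    using cutoff_derivs cutoff_support by metis
  show thesis
  proof (rule that[of "max 1 (max C0 (max C1 C2))"])
    fix x
    show "\<bar>\<sigma> x\<bar> \<le> max 1 (max C0 (max C1 C2))" "\<bar>\<sigma>' x\<bar> \<le> max 1 (max C0 (max C1 C2))"
      "\<bar>\<sigma>'' x\<bar> \<le> max 1 (max C0 (max C1 C2))"
      using C[of x] by auto
  qed simp
qed

lemma shifted_cutoff_derivs:
  "((\<lambda>x. complex_of_real (\<sigma> (x - c))) has_vector_derivative complex_of_real (\<sigma>' (x - c))) (at x)"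
  "((\<lambda>x. complex_of_real (\<sigma>' (x - c))) has_vector_derivative complex_of_real (\<sigma>'' (x - c))) (at x)"
proof -
  have *: "((\<lambda>x. complex_of_real (g (x - c))) has_vector_derivative complex_of_real (g' (x - c))) (at x)"
    if "\<And>x. (g has_vector_derivative g' x) (at x)" for g g' :: "real \<Rightarrow> real"
    using that[of "x - c"] has_vector_derivative_shift_iff[of g "- c" "g' (x - c)" x]
    by (intro has_vector_derivative_of_real) (simp add: has_real_derivative_iff_has_vector_derivative)
  show "((\<lambda>x. complex_of_real (\<sigma> (x - c))) has_vector_derivative complex_of_real (\<sigma>' (x - c))) (at x)"
    "((\<lambda>x. complex_of_real (\<sigma>' (x - c))) has_vector_derivative complex_of_real (\<sigma>'' (x - c))) (at x)"
    by (rule * cutoff_derivs)+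
qed

lemma shifted_cutoff_continuous:
  "continuous_on S (\<lambda>x. \<sigma> (x - c))" "continuous_on S (\<lambda>x. \<sigma>' (x - c))" "continuous_on S (\<lambda>x. \<sigma>'' (x - c))"
  by (rule continuous_on_compose2[OF cutoff_derivs(3)[of UNIV]] continuous_on_compose2[OF cutoff_derivs(4)[of UNIV]]
      continuous_on_compose2[OF cutoff_derivs(5)[of UNIV]]; auto intro!: continuous_intros)+

lemma shifted_cutoff_measurable [measurable]: "(\<lambda>x. \<sigma> (x - c)) \<in> borel_measurable borel"
  by (intro borel_measurable_continuous_onI shifted_cutoff_continuous)

lemma shifted_cutoff_integrable: "integrable lborel (\<lambda>x. complex_of_real (\<sigma> (x - c)))"
proof -
  have "integrable lborel (\<lambda>x. indicator {c - 1..c + 1} x *\<^sub>R complex_of_real (\<sigma> (x - c)))"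
    by (intro borel_integrable_compact continuous_intros shifted_cutoff_continuous) auto
  also have "(\<lambda>x. indicator {c - 1..c + 1} x *\<^sub>R complex_of_real (\<sigma> (x - c))) = (\<lambda>x. complex_of_real (\<sigma> (x - c)))"
  proof (rule ext)
    fix x show "indicator {c - 1..c + 1} x *\<^sub>R complex_of_real (\<sigma> (x - c)) = complex_of_real (\<sigma> (x - c))"
      using cutoff_support(1)[of "x - c"] by (auto simp: indicator_def abs_if)
  qed
  finally show ?thesis .
qed

definition box_kernel :: "int \<Rightarrow> real \<Rightarrow> complex" where
  "box_kernel k = inv_fourier (\<lambda>\<xi>. of_real (\<sigma> (\<xi> - of_int k)))"

text \<open>For bounded continuous \<open>f\<close> this is the continuous representative of
  \<open>box_op \<sigma> k (regular_dist f)\<close>.\<close>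

definition box_fun :: "int \<Rightarrow> (real \<Rightarrow> complex) \<Rightarrow> real \<Rightarrow> complex" where
  "box_fun k f y = (LINT x|lborel. f x * box_kernel k (y - x))"

lemma box_kernel_measurable [measurable]: "box_kernel k \<in> borel_measurable borel"
  unfolding box_kernel_def inv_fourier_def by measurable

text \<open>The symbol is twice continuously differentiable with compact support, so two
  integrations by parts apply; the quadratic decay serves to make the kernel integrable.\<close>

lemma box_kernel_decay:
  obtains C where "\<And>z. norm (box_kernel k z) \<le> C / (1 + z\<^sup>2)"
proof -
  obtain M where M: "M > 0" "\<And>x. \<bar>\<sigma> x\<bar> \<le> M" "\<And>x. \<bar>\<sigma>'' x\<bar> \<le> M"
    using cutoff_bounded by metis
  define u where "u x = 2 * M * indicator {real_of_int k - 1..real_of_int k + 1} x" for x :: real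
  have "norm (fourier (\<lambda>\<xi>. of_real (\<sigma> (\<xi> - of_int k))) \<xi>) \<le> (LINT x|lborel. u x) / (1 + \<xi>\<^sup>2)" for \<xi>
  proof (rule fourier_decay(1)[OF shifted_cutoff_derivs])
    fix x :: real assume x: "\<bar>real_of_int k\<bar> + 1 \<le> \<bar>x\<bar>"
    then have "1 \<le> \<bar>x - real_of_int k\<bar>" by linarith
    then show "complex_of_real (\<sigma> (x - of_int k)) = 0" "complex_of_real (\<sigma>' (x - of_int k)) = 0"
      "complex_of_real (\<sigma>'' (x - of_int k)) = 0"
      using cutoff_support by auto
  next
    fix x :: real
    show "norm (complex_of_real (\<sigma> (x - of_int k))) + norm (complex_of_real (\<sigma>'' (x - of_int k))) \<le> u x"
      using M(2)[of "x - of_int k"] M(3)[of "x - of_int k"] cutoff_support[of "x - of_int k"]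
      by (cases "\<bar>x - real_of_int k\<bar> \<ge> 1") (auto simp: u_def indicator_def M(1) less_imp_le)
  qed (auto simp: u_def intro!: continuous_intros shifted_cutoff_continuous)
  note decay = this
  have "norm (box_kernel k z) \<le> ((LINT x|lborel. u x) / (2 * pi)) / (1 + z\<^sup>2)" for z
  proof -
    have "norm (box_kernel k z) = norm (fourier (\<lambda>\<xi>. of_real (\<sigma> (\<xi> - of_int k))) (- z)) / (2 * pi)"
      unfolding box_kernel_def inv_fourier_eq_fourier norm_divide norm_of_real by simp
    also have "\<dots> \<le> ((LINT x|lborel. u x) / (1 + (- z)\<^sup>2)) / (2 * pi)"
      by (intro divide_right_mono decay) simp
    finally show ?thesis by (simp add: mult.commute)
  qed
  then show thesis by (rule that)
qed

lemma box_kernel_integrable: "integrable lborel (box_kernel k)"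
proof -
  obtain C where "\<And>z. norm (box_kernel k z) \<le> C / (1 + z\<^sup>2)"
    using box_kernel_decay by blast
  then show ?thesis by (intro integrable_quadratic_decay) auto
qed

definition kernel_mass :: "int \<Rightarrow> real" where
  "kernel_mass k = (LINT z|lborel. norm (box_kernel k z))"

lemma kernel_mass_nonneg: "kernel_mass k \<ge> 0"
  by (simp add: kernel_mass_def)

lemma box_fun_eq: "box_fun k f y = (LINT z|lborel. f (y - z) * box_kernel k z)"
  unfolding box_fun_def
  using lborel_integral_real_affine[of "-1" "\<lambda>x. f x * box_kernel k (y - x)" y] by simp

lemma box_fun_integrable:
  assumes f: "f \<in> borel_measurable borel" "\<And>x. norm (f x) \<le> B"
  shows "integrable lborel (\<lambda>z. f (y - z) * box_kernel k z)"
proof (rule Bochner_Integration.integrable_bound)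
  show "integrable lborel (\<lambda>z. B * norm (box_kernel k z))"
    using box_kernel_integrable by auto
  have "norm (f (y - z)) * norm (box_kernel k z) \<le> \<bar>B\<bar> * norm (box_kernel k z)" for z
    using f(2)[of "y - z"] by (intro mult_right_mono) auto
  then show "AE z in lborel. norm (f (y - z) * box_kernel k z) \<le> norm (B * norm (box_kernel k z))"
    by (auto simp: norm_mult abs_mult)
qed (use f in measurable)

lemma box_fun_bound:
  assumes f: "f \<in> borel_measurable borel" "\<And>x. norm (f x) \<le> B"
  shows "norm (box_fun k f y) \<le> B * kernel_mass k"
proof -
  have "norm (box_fun k f y) \<le> (LINT z|lborel. B * norm (box_kernel k z))"
    unfolding box_fun_eq
    by (rule Bochner_Integration.integral_norm_bound_integral[OF box_fun_integrable[OF f]])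
      (use box_kernel_integrable f(2) in \<open>auto simp: norm_mult intro: mult_right_mono\<close>)
  then show ?thesis by (simp add: kernel_mass_def)
qed

lemma box_fun_continuous:
  assumes f: "continuous_on UNIV f" "\<And>x. norm (f x) \<le> B"
  shows "continuous_on UNIV (box_fun k f)"
  unfolding continuous_on_eq_continuous_at[OF open_UNIV]
proof (intro ballI)
  have [measurable]: "f \<in> borel_measurable borel" using f by (intro borel_measurable_continuous_onI)
  fix y
  show "isCont (box_fun k f) y"
    unfolding continuous_at_sequentially o_def box_fun_eq
  proof (intro allI impI)
    fix Y assume Y: "Y \<longlonglongrightarrow> y"
    show "(\<lambda>n. LINT z|lborel. f (Y n - z) * box_kernel k z) \<longlonglongrightarrow> (LINT z|lborel. f (y - z) * box_kernel k z)"
    proof (rule integral_dominated_convergence[where w = "\<lambda>z. B * norm (box_kernel k z)"])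
      show "AE z in lborel. (\<lambda>n. f (Y n - z) * box_kernel k z) \<longlonglongrightarrow> f (y - z) * box_kernel k z"
        using f(1) by (intro AE_I2 tendsto_mult tendsto_const isCont_tendsto_compose[of _ f] tendsto_diff Y)
          (auto simp: continuous_on_eq_continuous_at)
      show "integrable lborel (\<lambda>z. B * norm (box_kernel k z))" using box_kernel_integrable by auto
      show "AE z in lborel. norm (f (Y n - z) * box_kernel k z) \<le> B * norm (box_kernel k z)" for n
        using f(2) by (intro AE_I2) (auto simp: norm_mult intro: mult_right_mono)
    qed measurable
  qed
qed

text \<open>Two applications of Fubini's theorem. On the test side, the multiplier between the two
  transforms becomes the integral of \<open>\<phi>\<close> against
  \<open>box_kernel k (y - x)\<close>; the second exchange moves the kernel from
  \<open>\<phi>\<close> onto \<open>f\<close>.\<close>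

lemma box_op_regular:
  assumes f: "continuous_on UNIV f" "\<And>x. norm (f x) \<le> B" and \<phi>: "integrable lborel \<phi>"
  shows "box_op \<sigma> k (regular_dist f) \<phi> = regular_dist (box_fun k f) \<phi>"
proof -
  have [measurable]: "f \<in> borel_measurable borel" using f by (intro borel_measurable_continuous_onI)
  have [measurable]: "\<phi> \<in> borel_measurable borel" using \<phi> by auto
  have inner: "fourier (\<lambda>\<xi>. of_real (\<sigma> (\<xi> - of_int k)) * inv_fourier \<phi> \<xi>) x = (LINT y|lborel. \<phi> y * box_kernel k (y - x))" for x
  proof -
    define F where "F \<xi> y = complex_of_real (\<sigma> (\<xi> - of_int k)) * (exp (\<i> * of_real (y - x) * of_real \<xi>) * \<phi> y) / of_real (2 * pi)" for \<xi> y
    have Fm: "case_prod F \<in> borel_measurable (lborel \<Otimes>\<^sub>M lborel)"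
      unfolding F_def by measurable
    have normF: "norm (F \<xi> y) = norm (complex_of_real (\<sigma> (\<xi> - of_int k))) * (norm (\<phi> y) / (2 * pi))" for \<xi> y
      unfolding F_def norm_divide norm_mult by simp
    have "integrable (lborel \<Otimes>\<^sub>M lborel) (case_prod F)"
    proof (rule lborel_pair.Fubini_integrable[OF Fm])
      show "integrable lborel (\<lambda>\<xi>. LINT y|lborel. norm (case (\<xi>, y) of (a, b) \<Rightarrow> F a b))"
        using integrable_norm[OF shifted_cutoff_integrable[of "of_int k"]] unfolding prod.case normF by simp
      show "AE \<xi> in lborel. integrable lborel (\<lambda>y. case (\<xi>, y) of (a, b) \<Rightarrow> F a b)"
      proof (rule AE_I2)
        fix \<xi>
        have "integrable lborel (\<lambda>y. norm (complex_of_real (\<sigma> (\<xi> - of_int k))) * (norm (\<phi> y) / (2 * pi)))"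
          using \<phi> by auto
        then show "integrable lborel (\<lambda>y. case (\<xi>, y) of (a, b) \<Rightarrow> F a b)"
          unfolding prod.case
        proof (rule Bochner_Integration.integrable_bound)
          show "F \<xi> \<in> borel_measurable lborel" unfolding F_def by measurable
        qed (simp add: normF)
      qed
    qed
    then have "(LINT y|lborel. LINT \<xi>|lborel. F \<xi> y) = (LINT \<xi>|lborel. LINT y|lborel. F \<xi> y)"
      by (rule lborel_pair.Fubini_integral)
    moreover have "(LINT y|lborel. F \<xi> y) =
        exp (- (\<i> * of_real \<xi> * of_real x)) * (of_real (\<sigma> (\<xi> - of_int k)) * inv_fourier \<phi> \<xi>)" for \<xi>
    proof -
      have "F \<xi> y = (exp (- (\<i> * of_real \<xi> * of_real x)) * of_real (\<sigma> (\<xi> - of_int k)) / of_real (2 * pi)) *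
          (exp (\<i> * of_real \<xi> * of_real y) * \<phi> y)" for y
      proof -
        have "exp (\<i> * of_real (y - x) * of_real \<xi>) = exp (- (\<i> * of_real \<xi> * of_real x)) * exp (\<i> * of_real \<xi> * of_real y)"
          unfolding exp_add[symmetric] by (simp add: algebra_simps)
        then show ?thesis unfolding F_def by (simp only: mult_ac times_divide_eq_left times_divide_eq_right)
      qed
      then show ?thesis
        unfolding inv_fourier_def by simp
    qed
    moreover have "(LINT \<xi>|lborel. F \<xi> y) = \<phi> y * box_kernel k (y - x)" for y
    proof -
      have "F \<xi> y = (\<phi> y / of_real (2 * pi)) * (exp (\<i> * of_real (y - x) * of_real \<xi>) * of_real (\<sigma> (\<xi> - of_int k)))" for \<xi>
        unfolding F_def by (simp only: mult_ac times_divide_eq_left times_divide_eq_right)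
      then show ?thesis
        unfolding box_kernel_def inv_fourier_def by simp
    qed
    ultimately show ?thesis by (simp add: fourier_def)
  qed
  define G where "G y x = f x * \<phi> y * box_kernel k (y - x)" for x y
  have Gm: "case_prod G \<in> borel_measurable (lborel \<Otimes>\<^sub>M lborel)"
    unfolding G_def by measurable
  have intK: "integrable lborel (\<lambda>x. box_kernel k (y - x))" for y
    using lborel_integrable_real_affine[OF box_kernel_integrable[of k], of "-1" y] by simp
  have massK: "(LINT x|lborel. norm (box_kernel k (y - x))) = kernel_mass k" for y
    using lborel_integral_real_affine[of "-1" "\<lambda>z. norm (box_kernel k z)" y] by (simp add: kernel_mass_def)
  have normG: "norm (G y x) \<le> (B * norm (\<phi> y)) * norm (box_kernel k (y - x))" for x y
    unfolding G_def norm_mult using f(2) by (intro mult_right_mono) auto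
  have intG: "integrable lborel (G y)" for y
  proof (rule Bochner_Integration.integrable_bound)
    show "integrable lborel (\<lambda>x. (B * norm (\<phi> y)) * norm (box_kernel k (y - x)))"
      using intK by auto
    show "AE x in lborel. norm (G y x) \<le> norm ((B * norm (\<phi> y)) * norm (box_kernel k (y - x)))"
      using normG abs_ge_self order_trans unfolding real_norm_def by (intro AE_I2) blast
  next
    show "G y \<in> borel_measurable lborel" unfolding G_def by measurable
  qed
  have "integrable (lborel \<Otimes>\<^sub>M lborel) (case_prod G)"
  proof (rule lborel_pair.Fubini_integrable[OF Gm])
    show "AE y in lborel. integrable lborel (\<lambda>x. case (y, x) of (a, b) \<Rightarrow> G a b)"
      using intG by simp
    show "integrable lborel (\<lambda>y. LINT x|lborel. norm (case (y, x) of (a, b) \<Rightarrow> G a b))"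
      unfolding prod.case
    proof (rule Bochner_Integration.integrable_bound)
      show "integrable lborel (\<lambda>y. (B * norm (\<phi> y)) * kernel_mass k)" using \<phi> by auto
      show "AE y in lborel. norm (LINT x|lborel. norm (G y x)) \<le> norm ((B * norm (\<phi> y)) * kernel_mass k)"
      proof (rule AE_I2)
        fix y
        have "(LINT x|lborel. norm (G y x)) \<le> (LINT x|lborel. (B * norm (\<phi> y)) * norm (box_kernel k (y - x)))"
          using intG intK by (intro integral_mono normG) auto
        also have "\<dots> = (B * norm (\<phi> y)) * kernel_mass k" by (simp add: massK)
        finally show "norm (LINT x|lborel. norm (G y x)) \<le> norm ((B * norm (\<phi> y)) * kernel_mass k)"
          by (simp add: order_trans[OF _ abs_ge_self])
      qed
    qed (use Gm in measurable)
  qed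
  then have swap: "(LINT x|lborel. LINT y|lborel. G y x) = (LINT y|lborel. LINT x|lborel. G y x)"
    by (rule lborel_pair.Fubini_integral)
  have "G y x = f x * (\<phi> y * box_kernel k (y - x))" for x y
    by (simp add: G_def)
  then have "(LINT x|lborel. f x * (LINT y|lborel. \<phi> y * box_kernel k (y - x))) = (LINT x|lborel. LINT y|lborel. G y x)"
    by simp
  moreover have "G y x = (f x * box_kernel k (y - x)) * \<phi> y" for x y
    by (simp add: G_def)
  then have "(LINT y|lborel. box_fun k f y * \<phi> y) = (LINT y|lborel. LINT x|lborel. G y x)"
    by (simp add: box_fun_def)
  ultimately show ?thesis
    unfolding box_op_def dist_inv_fourier_def dist_mult_def dist_fourier_def regular_dist_def inner
    using swap by simp
qed


definition box_norm :: "int \<Rightarrow> (real \<Rightarrow> complex) \<Rightarrow> ennreal" where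
  "box_norm k f = (SUP x. ennreal (norm (box_fun k f x)))"

lemma Linf_norm_box_op:
  assumes f: "continuous_on UNIV f" "\<And>x. norm (f x) \<le> B"
  shows "Linf_norm (box_op \<sigma> k (regular_dist f)) = box_norm k f"
  unfolding box_norm_def
proof (rule Linf_norm_continuous)
  show "continuous_on UNIV (box_fun k f)" by (rule box_fun_continuous[OF f])
  show "norm (box_fun k f x) \<le> B * kernel_mass k" for x
    using f by (intro box_fun_bound borel_measurable_continuous_onI)
  show "box_op \<sigma> k (regular_dist f) \<phi> = regular_dist (box_fun k f) \<phi>" if "\<phi> \<in> schwartz" for \<phi>
    by (rule box_op_regular[OF f schwartz_integrable[OF that]])
qed

lemma modulation_norm_regular:
  assumes f: "continuous_on UNIV f" "\<And>x. norm (f x) \<le> B"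
  shows "X_norm \<sigma> s f = (\<Sum>\<^sub>\<infinity>k::int. ennreal (japanese_bracket k powr s) * box_norm k f)"
  unfolding X_norm_def modulation_norm_def Linf_norm_box_op[OF f] ..

text \<open>Only the three integers within one unit of \<open>\<lfloor>x\<rfloor>\<close> can
  contribute, so the bound does not depend on \<open>N\<close>. A general \<open>g\<close> is
  allowed because the derivatives of the cutoff need the bound as well.\<close>

lemma sum_shifted_cutoff_bound:
  fixes N :: nat and g :: "real \<Rightarrow> real"
  assumes M: "\<And>x. \<bar>g x\<bar> \<le> M" and g: "\<And>x. \<bar>x\<bar> \<ge> 1 \<Longrightarrow> g x = 0"
  shows "\<bar>\<Sum>k\<in>{- int N..int N}. g (x - of_int k)\<bar> \<le> 3 * M"
proof -
  define A where "A = {- int N..int N} \<inter> {\<lfloor>x\<rfloor> - 1..\<lfloor>x\<rfloor> + 1}"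
  have M0: "M \<ge> 0" using M[of 0] by simp
  have "(\<Sum>k\<in>{- int N..int N}. g (x - of_int k)) = (\<Sum>k\<in>A. g (x - of_int k))"
  proof (rule sum.mono_neutral_right)
    show "\<forall>k\<in>{- int N..int N} - A. g (x - of_int k) = 0"
    proof
      fix k assume "k \<in> {- int N..int N} - A"
      then have "k < \<lfloor>x\<rfloor> - 1 \<or> k > \<lfloor>x\<rfloor> + 1" by (auto simp: A_def)
      then have "\<bar>x - of_int k\<bar> \<ge> 1" by linarith
      then show "g (x - of_int k) = 0" by (rule g)
    qed
  qed (auto simp: A_def)
  also have "\<bar>\<dots>\<bar> \<le> (\<Sum>k\<in>A. M)"
    by (rule order_trans[OF sum_abs]) (intro sum_mono M)
  also have "\<dots> \<le> 3 * M"
  proof -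
    have "card A \<le> card {\<lfloor>x\<rfloor> - 1..\<lfloor>x\<rfloor> + 1}" by (intro card_mono) (auto simp: A_def)
    then show ?thesis using M0 by (auto intro!: mult_right_mono)
  qed
  finally show ?thesis .
qed

text \<open>At a fixed point only finitely many summands are nonzero, so the partial sums become
  exactly \<open>1\<close> and pointwise limits follow from eventual equality.\<close>

lemma sum_shifted_cutoff_eventually_1:
  "\<forall>\<^sub>F N in sequentially. (\<Sum>k\<in>{- int N..int N}. \<sigma> (x - of_int k)) = 1"
  unfolding eventually_sequentially
proof (intro exI allI impI)
  fix N assume N: "nat \<lceil>\<bar>x\<bar>\<rceil> + 1 \<le> N"
  have "((\<lambda>k::int. \<sigma> (x - of_int k)) has_sum 1) UNIV"
    using uniform_cutoff by (simp add: uniform_cutoff_def)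
  moreover have "((\<lambda>k::int. \<sigma> (x - of_int k)) has_sum 1) UNIV \<longleftrightarrow>
      ((\<lambda>k::int. \<sigma> (x - of_int k)) has_sum 1) {- int N..int N}"
  proof (rule has_sum_cong_neutral)
    fix k assume "k \<in> UNIV - {- int N..int N}"
    then have "k < - int N \<or> k > int N" by auto
    then have "\<bar>x - of_int k\<bar> \<ge> 1" using N by linarith
    then show "\<sigma> (x - of_int k) = 0" by (rule cutoff_support)
  qed auto
  ultimately show "(\<Sum>k\<in>{- int N..int N}. \<sigma> (x - of_int k)) = 1"
    by (simp add: has_sum_finite_iff)
qed

end

text \<open>The bound is linear in the bound on \<open>p\<close> and independent of its support, so it applies uniformly to all
  partial sums of the partition of unity.\<close>

lemma fourier_gauss_cutoff_decay:
  assumes s: "s > 0"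
  obtains C where "C \<ge> 0"
    "\<And>p p' p'' M R x.
      \<lbrakk>\<And>\<xi>. (p has_vector_derivative p' \<xi>) (at \<xi>); \<And>\<xi>. (p' has_vector_derivative p'' \<xi>) (at \<xi>);
       continuous_on UNIV p''; \<And>\<xi>. norm (p \<xi>) \<le> M; \<And>\<xi>. norm (p' \<xi>) \<le> M; \<And>\<xi>. norm (p'' \<xi>) \<le> M;
       \<And>\<xi>. R \<le> \<bar>\<xi>\<bar> \<Longrightarrow> p \<xi> = 0; \<And>\<xi>. R \<le> \<bar>\<xi>\<bar> \<Longrightarrow> p' \<xi> = 0; \<And>\<xi>. R \<le> \<bar>\<xi>\<bar> \<Longrightarrow> p'' \<xi> = 0; R \<ge> 0\<rbrakk> \<Longrightarrow>
      norm (fourier (\<lambda>\<xi>. p \<xi> * inv_fourier (gauss a s) \<xi>) x) \<le> M * C / (1 + x\<^sup>2) \<and>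
      integrable lborel (\<lambda>\<xi>. exp (- (\<i> * of_real \<xi> * of_real x)) * (p \<xi> * inv_fourier (gauss a s) \<xi>))"
proof -
  define g where "g = inv_fourier (gauss a s)"
  \<comment> \<open>The logarithmic derivative of \<open>g\<close>: so \<open>g' = l * g\<close>,
    and \<open>l' = - s\<^sup>2\<close> produces \<open>g''\<close>.\<close>
  define l where "l \<xi> = \<i> * of_real a - of_real (s\<^sup>2 * \<xi>)" for \<xi> :: real
  define g' where "g' \<xi> = l \<xi> * g \<xi>" for \<xi>
  define g'' where "g'' \<xi> = ((l \<xi>)\<^sup>2 - of_real (s\<^sup>2)) * g \<xi>" for \<xi>
  have g_eq: "g \<xi> = exp (\<i> * of_real a * of_real \<xi>) * of_real (exp (- (s\<^sup>2 * \<xi>\<^sup>2 / 2)) / (2 * pi))" for \<xi>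
    unfolding g_def inv_fourier_gauss[OF s] ..
  have g: "(g has_vector_derivative g' \<xi>) (at \<xi>)" for \<xi>
  proof -
    define A where "A \<xi> = exp (\<i> * of_real a * of_real \<xi>)" for \<xi> :: real
    define E where "E \<xi> = exp (- (s\<^sup>2 * \<xi>\<^sup>2 / 2)) / (2 * pi)" for \<xi> :: real
    have "(A has_vector_derivative \<i> * of_real a * A \<xi>) (at \<xi>)"
      unfolding A_def by (auto intro!: has_vector_derivative_real_field derivative_eq_intros)
    moreover have "((\<lambda>\<xi>. complex_of_real (E \<xi>)) has_vector_derivative of_real (- (s\<^sup>2 * \<xi>) * E \<xi>)) (at \<xi>)"
      unfolding E_def by (intro has_vector_derivative_of_real) (auto intro!: derivative_eq_intros)
    ultimately have "((\<lambda>\<xi>. A \<xi> * of_real (E \<xi>)) has_vector_derivative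
        (A \<xi> * of_real (- (s\<^sup>2 * \<xi>) * E \<xi>) + \<i> * of_real a * A \<xi> * of_real (E \<xi>))) (at \<xi>)"
      by (rule has_vector_derivative_mult)
    moreover have "g = (\<lambda>\<xi>. A \<xi> * of_real (E \<xi>))"
      unfolding g_def inv_fourier_gauss[OF s] A_def E_def ..
    ultimately show ?thesis
      by (simp add: g'_def l_def algebra_simps)
  qed
  have l: "(l has_vector_derivative - of_real (s\<^sup>2)) (at \<xi>)" for \<xi>
  proof -
    have "((\<lambda>\<xi>. complex_of_real (s\<^sup>2 * \<xi>)) has_vector_derivative of_real (s\<^sup>2)) (at \<xi>)"
      by (intro has_vector_derivative_of_real) (auto intro!: derivative_eq_intros)
    from has_vector_derivative_diff[OF has_vector_derivative_const this]
    show ?thesis by (simp add: l_def[abs_def])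
  qed
  have g': "(g' has_vector_derivative g'' \<xi>) (at \<xi>)" for \<xi>
    using has_vector_derivative_mult[OF l g]
    unfolding g'_def[abs_def] g''_def by (simp add: power2_eq_square algebra_simps)
  have g_cont: "continuous_on UNIV g" "continuous_on UNIV g'" "continuous_on UNIV g''"
  proof -
    show gc: "continuous_on UNIV g" "continuous_on UNIV g'"
      using g g' by (auto intro!: continuous_at_imp_continuous_on has_vector_derivative_continuous)
    have "continuous_on UNIV l" using l by (auto intro!: continuous_at_imp_continuous_on has_vector_derivative_continuous)
    then show "continuous_on UNIV g''" unfolding g''_def by (intro continuous_intros gc)
  qed
  have [measurable]: "g \<in> borel_measurable borel"
    using g_cont by (intro borel_measurable_continuous_onI)
  \<comment> \<open>A common polynomial majorant of \<open>1\<close>, of the modulus of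
    \<open>l\<close> and of that of \<open>l\<^sup>2 - s\<^sup>2\<close>; multiplied by
    \<open>g\<close> it still decays faster than any power.\<close>
  define K where "K \<xi> = 1 + s\<^sup>2 + a\<^sup>2 + s ^ 4 * \<xi>\<^sup>2" for \<xi> :: real
  have norm_l: "(norm (l \<xi>))\<^sup>2 = a\<^sup>2 + s ^ 4 * \<xi>\<^sup>2" for \<xi>
    unfolding cmod_power2 l_def by (simp add: power_mult_distrib flip: power_mult)
  have K: "norm (g \<xi>) \<le> K \<xi> * norm (g \<xi>)" "norm (g' \<xi>) \<le> K \<xi> * norm (g \<xi>)" "norm (g'' \<xi>) \<le> K \<xi> * norm (g \<xi>)" for \<xi>
  proof -
    have "1 \<le> K \<xi>" by (simp add: K_def)
    then show "norm (g \<xi>) \<le> K \<xi> * norm (g \<xi>)" by (simp add: mult_le_cancel_right1)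
    have "norm (l \<xi>) \<le> 1 + (norm (l \<xi>))\<^sup>2"
      using sum_squares_bound[of "norm (l \<xi>)" 1] norm_ge_zero[of "l \<xi>"] by (simp del: norm_ge_zero)
    then have "norm (l \<xi>) \<le> K \<xi>" unfolding norm_l K_def using zero_le_power2[of s] by linarith
    then show "norm (g' \<xi>) \<le> K \<xi> * norm (g \<xi>)" by (simp add: g'_def norm_mult mult_right_mono)
    have "norm ((l \<xi>)\<^sup>2 - of_real (s\<^sup>2)) \<le> (norm (l \<xi>))\<^sup>2 + s\<^sup>2"
      by (rule order_trans[OF norm_triangle_ineq4]) (simp add: norm_power del: of_real_power)
    also have "\<dots> \<le> K \<xi>" unfolding norm_l K_def by simp
    finally show "norm (g'' \<xi>) \<le> K \<xi> * norm (g \<xi>)" by (simp add: g''_def norm_mult mult_right_mono)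
  qed
  obtain D where D: "\<And>\<xi>. \<bar>poly ([:1, 0, 1:] * [:1 + s\<^sup>2 + a\<^sup>2, 0, s ^ 4:]) \<xi> * normal_density 0 (1 / s) \<xi>\<bar> \<le> D"
    using poly_times_normal_density_bounded[of "1 / s"] s by (metis zero_less_divide_1_iff)
  define D' where "D' = \<bar>sqrt (2 * pi * (1 / s)\<^sup>2) / (2 * pi)\<bar> * D"
  have Kg: "K \<xi> * norm (g \<xi>) \<le> D' / (1 + \<xi>\<^sup>2)" for \<xi>
  proof -
    have "norm (g \<xi>) = sqrt (2 * pi * (1 / s)\<^sup>2) / (2 * pi) * normal_density 0 (1 / s) \<xi>"
      unfolding g_eq norm_mult normal_density_def using s by (simp add: norm_divide power_divide mult.commute)
    moreover have "poly ([:1, 0, 1:] * [:1 + s\<^sup>2 + a\<^sup>2, 0, s ^ 4:]) \<xi> = (1 + \<xi>\<^sup>2) * K \<xi>"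
      by (simp add: K_def power2_eq_square algebra_simps)
    ultimately have "(1 + \<xi>\<^sup>2) * (K \<xi> * norm (g \<xi>)) = sqrt (2 * pi * (1 / s)\<^sup>2) / (2 * pi) *
        (poly ([:1, 0, 1:] * [:1 + s\<^sup>2 + a\<^sup>2, 0, s ^ 4:]) \<xi> * normal_density 0 (1 / s) \<xi>)"
      by (simp only: mult_ac)
    also have "\<dots> \<le> D'"
      unfolding D'_def by (rule order_trans[OF abs_ge_self]) (simp only: abs_mult[of "_ / _"], intro mult_left_mono D, simp)
    finally show ?thesis
      by (simp add: pos_le_divide_eq add_pos_nonneg mult.commute)
  qed
  have D'0: "D' \<ge> 0"
  proof -
    have "D \<ge> 0" using D[of 0] by linarith
    then show ?thesis by (simp add: D'_def)
  qed
  \<comment> \<open>The factor \<open>5\<close> counts the products to be estimated: one in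
    \<open>h\<close> and four in \<open>h''\<close>.\<close>
  define C where "C = 5 * D' * (LINT x::real|lborel. 1 / (1 + x\<^sup>2))"
  show thesis
  proof (rule that[of C])
    show "C \<ge> 0" unfolding C_def using D'0 by (intro mult_nonneg_nonneg Bochner_Integration.integral_nonneg) auto
    fix p p' p'' :: "real \<Rightarrow> complex" and M R x :: real
    assume p: "\<And>\<xi>. (p has_vector_derivative p' \<xi>) (at \<xi>)" "\<And>\<xi>. (p' has_vector_derivative p'' \<xi>) (at \<xi>)"
      and p''c: "continuous_on UNIV p''"
      and M: "\<And>\<xi>. norm (p \<xi>) \<le> M" "\<And>\<xi>. norm (p' \<xi>) \<le> M" "\<And>\<xi>. norm (p'' \<xi>) \<le> M"
      and R: "\<And>\<xi>. R \<le> \<bar>\<xi>\<bar> \<Longrightarrow> p \<xi> = 0" "\<And>\<xi>. R \<le> \<bar>\<xi>\<bar> \<Longrightarrow> p' \<xi> = 0" "\<And>\<xi>. R \<le> \<bar>\<xi>\<bar> \<Longrightarrow> p'' \<xi> = 0" "R \<ge> 0"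
    have M0: "M \<ge> 0" using order_trans[OF norm_ge_zero M(1)] .
    have pc: "continuous_on UNIV p" "continuous_on UNIV p'"
      using p by (auto intro!: continuous_at_imp_continuous_on has_vector_derivative_continuous)
    define h where "h \<xi> = p \<xi> * g \<xi>" for \<xi>
    define h' where "h' \<xi> = p \<xi> * g' \<xi> + p' \<xi> * g \<xi>" for \<xi>
    define h'' where "h'' \<xi> = (p \<xi> * g'' \<xi> + p' \<xi> * g' \<xi>) + (p' \<xi> * g' \<xi> + p'' \<xi> * g \<xi>)" for \<xi>
    have h: "(h has_vector_derivative h' \<xi>) (at \<xi>)" "(h' has_vector_derivative h'' \<xi>) (at \<xi>)" for \<xi>
      unfolding h_def h'_def h''_def by (intro derivative_intros has_vector_derivative_mult p g g')+
    have h''c: "continuous_on UNIV h''"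
      unfolding h''_def by (intro continuous_intros pc p''c g_cont)
    have bound: "norm (h \<xi>) + norm (h'' \<xi>) \<le> 5 * M * D' * (1 / (1 + \<xi>\<^sup>2))" for \<xi>
    proof -
      have prod: "norm (u * v) \<le> M * (D' / (1 + \<xi>\<^sup>2))" if "norm u \<le> M" "norm v \<le> K \<xi> * norm (g \<xi>)" for u v :: complex
        unfolding norm_mult using that Kg[of \<xi>] M0 by (intro mult_mono) auto
      have "norm (h \<xi>) + norm (h'' \<xi>) \<le> norm (p \<xi> * g \<xi>) + ((norm (p \<xi> * g'' \<xi>) + norm (p' \<xi> * g' \<xi>)) +
          (norm (p' \<xi> * g' \<xi>) + norm (p'' \<xi> * g \<xi>)))"
        unfolding h_def h''_def
        by (intro add_mono order_refl order_trans[OF norm_triangle_ineq add_mono[OF norm_triangle_ineq norm_triangle_ineq]])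
      also have "\<dots> \<le> M * (D' / (1 + \<xi>\<^sup>2)) + ((M * (D' / (1 + \<xi>\<^sup>2)) + M * (D' / (1 + \<xi>\<^sup>2))) +
          (M * (D' / (1 + \<xi>\<^sup>2)) + M * (D' / (1 + \<xi>\<^sup>2))))"
        by (intro add_mono prod M K)
      finally show ?thesis by (simp add: mult_ac)
    qed
    have int: "integrable lborel (\<lambda>\<xi>::real. 5 * M * D' * (1 / (1 + \<xi>\<^sup>2)))"
      by (intro integrable_mult_right integrable_inverse_one_plus_square)
    have supp: "h \<xi> = 0" "h' \<xi> = 0" "h'' \<xi> = 0" if "R \<le> \<bar>\<xi>\<bar>" for \<xi>
      using R(1-3)[OF that] by (auto simp: h_def h'_def h''_def)
    note decay = fourier_decay[OF h h''c supp R(4) bound int, of x]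
    have "(LINT \<xi>::real|lborel. 5 * M * D' * (1 / (1 + \<xi>\<^sup>2))) = M * C"
      by (simp only: integral_mult_right_zero C_def mult_ac)
    then show "norm (fourier (\<lambda>\<xi>. p \<xi> * inv_fourier (gauss a s) \<xi>) x) \<le> M * C / (1 + x\<^sup>2) \<and>
      integrable lborel (\<lambda>\<xi>. exp (- (\<i> * of_real \<xi> * of_real x)) * (p \<xi> * inv_fourier (gauss a s) \<xi>))"
      using decay unfolding h_def g_def by simp
  qed
qed

section \<open>Bounded continuous functions and the norm of \<open>X\<close>\<close>

definition bcont :: "(real \<Rightarrow> complex) \<Rightarrow> bool" where
  "bcont f \<longleftrightarrow> continuous_on UNIV f \<and> bounded (range f)"

lemma bcontE:
  assumes "bcont f"
  obtains B where "B > 0" "continuous_on UNIV f" "\<And>x. norm (f x) \<le> B" "f \<in> borel_measurable borel"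
proof -
  obtain B where "B > 0" "\<forall>x. norm (f x) \<le> B"
    using assms by (auto simp: bcont_def bounded_pos)
  then show thesis using that assms by (auto simp: bcont_def intro: borel_measurable_continuous_onI)
qed

lemma bcontI: "continuous_on UNIV f \<Longrightarrow> (\<And>x. norm (f x) \<le> B) \<Longrightarrow> bcont f"
  by (auto simp: bcont_def intro!: boundedI)

lemma bcont_diff: "bcont f \<Longrightarrow> bcont g \<Longrightarrow> bcont (\<lambda>x. f x - g x)"
  unfolding bcont_def using bounded_minus_comp[of f UNIV g] by (auto intro!: continuous_intros)

lemma bcont_add: "bcont f \<Longrightarrow> bcont g \<Longrightarrow> bcont (\<lambda>x. f x + g x)"
  unfolding bcont_def using bounded_plus_comp[of f UNIV g] by (auto intro!: continuous_intros)

lemma bcont_translate: "bcont f \<Longrightarrow> bcont (translate y f)"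
  unfolding bcont_def translate_def
  by (auto intro!: continuous_on_compose2[of UNIV f] continuous_intros elim!: bounded_subset)

lemma X_space_bcont: "f \<in> X_space \<sigma> s \<Longrightarrow> bcont f"
  by (auto simp: X_space_def bcont_def intro: uniformly_continuous_imp_continuous)

text \<open>Makes temperedness automatic, so that membership in \<open>X_space\<close> comes down to
  boundedness, uniform continuity and a finite norm.\<close>

lemma tempered_regular_dist:
  assumes "bcont f"
  shows "tempered (regular_dist f)"
proof -
  obtain B where B: "B > 0" "\<And>x. norm (f x) \<le> B" and [measurable]: "f \<in> borel_measurable borel"
    by (rule bcontE[OF assms]) (use that in blast)
  have int: "integrable lborel (\<lambda>x. f x * \<phi> x)" if "\<phi> \<in> schwartz" for \<phi>
  proof (rule Bochner_Integration.integrable_bound)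
    have [measurable]: "\<phi> \<in> borel_measurable borel"
      using that by (intro borel_measurable_continuous_onI schwartz_continuous)
    show "(\<lambda>x. f x * \<phi> x) \<in> borel_measurable lborel" by measurable
    show "integrable lborel (\<lambda>x. B * norm (\<phi> x))" using schwartz_integrable[OF that] by auto
    show "AE x in lborel. norm (f x * \<phi> x) \<le> norm (B * norm (\<phi> x))"
      using B by (intro AE_I2) (auto simp: norm_mult intro: mult_right_mono)
  qed
  define c0 where "c0 = (LINT x::real|lborel. 1 / (1 + x\<^sup>2))"
  have c0: "c0 \<ge> 0" unfolding c0_def by (intro Bochner_Integration.integral_nonneg) auto
  have bound: "norm (regular_dist f \<phi>) \<le> (B * c0) * (\<Sum>m\<le>2. \<Sum>n\<le>2. schwartz_seminorm m n \<phi>)"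
    if \<phi>: "\<phi> \<in> schwartz" for \<phi>
  proof -
    define S where "S = schwartz_seminorm 0 0 \<phi> + schwartz_seminorm 2 0 \<phi>"
    have nn: "schwartz_seminorm m n \<phi> \<ge> 0" for m n
    proof -
      have "bounded (range (\<lambda>x. x ^ m *\<^sub>R (vderiv ^^ n) \<phi> x))"
        using \<phi> by (simp add: schwartz_def)
      then have "bdd_above (range (\<lambda>x. norm (x ^ m *\<^sub>R (vderiv ^^ n) \<phi> x)))"
        by (auto simp: bounded_iff bdd_above_def)
      then show ?thesis
        unfolding schwartz_seminorm_def by (rule cSUP_upper2[of _ _ 0]) auto
    qed
    have "norm (regular_dist f \<phi>) \<le> (LINT x|lborel. B * S * (1 / (1 + x\<^sup>2)))"
      unfolding regular_dist_def
    proof (rule Bochner_Integration.integral_norm_bound_integral[OF int[OF \<phi>]])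
      show "integrable lborel (\<lambda>x::real. B * S * (1 / (1 + x\<^sup>2)))"
        by (intro integrable_mult_right integrable_inverse_one_plus_square)
      fix x
      have "norm (f x * \<phi> x) \<le> B * (S / (1 + x\<^sup>2))"
        unfolding norm_mult S_def using B \<phi> by (intro mult_mono schwartz_decay) auto
      then show "norm (f x * \<phi> x) \<le> B * S * (1 / (1 + x\<^sup>2))" by simp
    qed
    also have "\<dots> = (B * c0) * S" by (simp only: integral_mult_right_zero c0_def mult_ac)
    also have "\<dots> \<le> (B * c0) * (\<Sum>m\<le>2. \<Sum>n\<le>2. schwartz_seminorm m n \<phi>)"
    proof (rule mult_left_mono)
      have "S \<le> (\<Sum>n\<le>2. schwartz_seminorm 0 n \<phi>) + (\<Sum>n\<le>2. schwartz_seminorm 2 n \<phi>)"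
        unfolding S_def using nn by (intro add_mono member_le_sum) auto
      also have "\<dots> \<le> (\<Sum>m\<le>2. \<Sum>n\<le>2. schwartz_seminorm m n \<phi>)"
        using nn by (simp add: numeral_2_eq_2 sum_nonneg)
      finally show "S \<le> (\<Sum>m\<le>2. \<Sum>n\<le>2. schwartz_seminorm m n \<phi>)" .
    qed (use B c0 in auto)
    finally show ?thesis .
  qed
  have "regular_dist f (\<lambda>x. \<phi> x + \<psi> x) = regular_dist f \<phi> + regular_dist f \<psi>"
    if "\<phi> \<in> schwartz" "\<psi> \<in> schwartz" for \<phi> \<psi>
    using int[OF that(1)] int[OF that(2)] by (simp add: regular_dist_def distrib_left)
  moreover have "regular_dist f (\<lambda>x. c * \<phi> x) = c * regular_dist f \<phi>" for c \<phi>
    by (simp add: regular_dist_def mult.left_commute)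
  ultimately show ?thesis
    unfolding tempered_def using bound by blast
qed

lemma X_space_iff:
  "f \<in> X_space \<sigma> s \<longleftrightarrow> bounded (range f) \<and> uniformly_continuous_on UNIV f \<and> X_norm \<sigma> s f < \<infinity>"
proof -
  have "tempered (regular_dist f)" if "bounded (range f)" "uniformly_continuous_on UNIV f"
    using that by (intro tempered_regular_dist) (auto simp: bcont_def intro: uniformly_continuous_imp_continuous)
  then show ?thesis by (auto simp: X_space_def modulation_space_def X_norm_def)
qed

lemma Linf_norm_uminus: "Linf_norm (\<lambda>\<phi>. - u \<phi>) = Linf_norm u"
proof -
  have le: "Linf_norm (\<lambda>\<phi>. - u \<phi>) \<le> Linf_norm u" for u
    unfolding Linf_norm_def
  proof (rule Inf_superset_mono, safe)
    fix C g assume g: "g \<in> borel_measurable lborel" "AE x in lborel. norm (g x) \<le> C"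
      "\<forall>\<phi>\<in>schwartz. u \<phi> = regular_dist g \<phi>"
    show "\<exists>C'. ennreal C = ennreal C' \<and> (\<exists>g. g \<in> borel_measurable lborel \<and> (AE x in lborel. norm (g x) \<le> C') \<and>
        (\<forall>\<phi>\<in>schwartz. - u \<phi> = regular_dist g \<phi>))"
      by (intro exI[of _ C] exI[of _ "\<lambda>x. - g x"] conjI refl) (use g in \<open>auto simp: regular_dist_def\<close>)
  qed
  from le[of u] le[of "\<lambda>\<phi>. - u \<phi>"] show ?thesis by simp
qed

text \<open>The symmetry axiom of a metric space is demanded for all functions, also outside
  \<open>X_space\<close>; therefore the sign is pulled out at the level of distributions, where
  regularity of \<open>f\<close> and \<open>g\<close> does not enter.\<close>

lemma X_norm_commute: "X_norm \<sigma> s (\<lambda>x. f x - g x) = X_norm \<sigma> s (\<lambda>x. g x - f x)"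
proof -
  have "(LINT x|lborel. (f x - g x) * \<phi> x) = - (LINT x|lborel. (g x - f x) * \<phi> x)" for \<phi>
    unfolding Bochner_Integration.integral_minus[symmetric]
    by (intro Bochner_Integration.integral_cong) (auto simp: algebra_simps)
  then have "box_op \<sigma> k (regular_dist (\<lambda>x. f x - g x)) = (\<lambda>\<phi>. - box_op \<sigma> k (regular_dist (\<lambda>x. g x - f x)) \<phi>)" for k
    by (simp add: box_op_def dist_inv_fourier_def dist_mult_def dist_fourier_def regular_dist_def fun_eq_iff)
  then show ?thesis
    by (simp add: X_norm_def modulation_norm_def Linf_norm_uminus)
qed

lemma japanese_bracket_powr_ge_1: "s \<ge> 0 \<Longrightarrow> japanese_bracket k powr s \<ge> 1"
  by (rule ge_one_powr_ge_zero) (auto simp: japanese_bracket_def)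

lemma finite_sum_le_infsum_ennreal:
  fixes f :: "'a \<Rightarrow> ennreal"
  assumes "finite F"
  shows "sum f F \<le> infsum f UNIV"
  using assms unfolding nonneg_infsum_complete[OF zero_le] by (intro SUP_upper) auto

text \<open>Finiteness of the total provides a finite \<open>F\<close> whose sum comes within
  \<open>\<epsilon>\<close> of it; splitting the total over \<open>F\<close> and its complement
  leaves less than \<open>\<epsilon>\<close> for the latter.\<close>

lemma infsum_ennreal_small_tail:
  fixes f :: "'a \<Rightarrow> ennreal"
  assumes "infsum f UNIV < \<infinity>" "\<epsilon> > 0"
  obtains F where "finite F" "infsum f (- F) < \<epsilon>"
proof -
  have tot: "infsum f UNIV = (SUP F\<in>{F. finite F \<and> F \<subseteq> UNIV}. sum f F)"
    by (rule nonneg_infsum_complete) simp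
  have "\<exists>F. finite F \<and> infsum f UNIV < sum f F + \<epsilon>"
  proof (cases "infsum f UNIV = 0")
    case True
    then show ?thesis using assms(2) by (intro exI[of _ "{}"]) auto
  next
    case False
    then have "infsum f UNIV - \<epsilon> < infsum f UNIV"
      using assms by (intro ennreal_between) (auto simp: zero_less_iff_neq_zero)
    then obtain F where "finite F" "infsum f UNIV - \<epsilon> < sum f F"
      unfolding tot less_SUP_iff by auto
    then show ?thesis
      using ennreal_le_minus_iff[of "sum f F" "infsum f UNIV" \<epsilon>] by (meson not_le)
  qed
  then obtain F where F: "finite F" "infsum f UNIV < sum f F + \<epsilon>" by blast
  have "infsum f UNIV = infsum f F + infsum f (- F)"
    using infsum_Un_disjoint[of f F "- F"] nonneg_summable_on_complete[of _ f] by (simp add: Compl_partition)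
  with F assms(1) have "sum f F + infsum f (- F) < sum f F + \<epsilon>" "sum f F + infsum f (- F) < \<infinity>" by auto
  then have "infsum f (- F) < \<epsilon>"
    by (metis add_left_mono not_le)
  then show thesis using that F by blast
qed

context cutoff
begin

text \<open>Formally \<open>f\<close> is the sum of its boxes and the weights are at least
  \<open>1\<close>, so the box norms dominate. The reconstruction is verified weakly: tested against
  a Gaussian, the partial sums converge by dominated convergence, and the Gaussian is then narrowed
  to the point \<open>a\<close>.\<close>

lemma sup_le_X_norm:
  assumes f: "bcont f" and r: "r \<ge> 0"
  shows "ennreal (norm (f a)) \<le> X_norm \<sigma> r f"
proof -
  obtain B where B: "B > 0" "continuous_on UNIV f" "\<And>x. norm (f x) \<le> B" and [measurable]: "f \<in> borel_measurable borel"
    by (rule bcontE[OF f]) (use that in blast)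
  obtain M where M: "M > 0" "\<And>x. \<bar>\<sigma> x\<bar> \<le> M" "\<And>x. \<bar>\<sigma>' x\<bar> \<le> M" "\<And>x. \<bar>\<sigma>'' x\<bar> \<le> M"
    using cutoff_bounded by blast
  have gauss_bound: "ennreal (norm (LINT x|lborel. f x * gauss a s x)) \<le> X_norm \<sigma> r f" if s: "s > 0" for s
  proof -
    define g where "g = inv_fourier (gauss a s)"
    define p where "p = (\<lambda>k::int. \<lambda>\<xi>. complex_of_real (\<sigma> (\<xi> - of_int k)))"
    define P where "P N \<xi> = (\<Sum>k\<in>{- int N..int N}. p k \<xi>)" for N \<xi>
    have g_int: "integrable lborel g" unfolding g_def by (rule fourier_inv_fourier_gauss(2)[OF s])
    then have [measurable]: "g \<in> borel_measurable borel" by auto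
    have [measurable]: "p k \<in> borel_measurable borel" for k unfolding p_def by measurable
    obtain C where C0: "C \<ge> 0" and C:
      "\<And>p p' p'' M R x.
      \<lbrakk>\<And>\<xi>. (p has_vector_derivative p' \<xi>) (at \<xi>); \<And>\<xi>. (p' has_vector_derivative p'' \<xi>) (at \<xi>);
       continuous_on UNIV p''; \<And>\<xi>. norm (p \<xi>) \<le> M; \<And>\<xi>. norm (p' \<xi>) \<le> M; \<And>\<xi>. norm (p'' \<xi>) \<le> M;
       \<And>\<xi>. R \<le> \<bar>\<xi>\<bar> \<Longrightarrow> p \<xi> = 0; \<And>\<xi>. R \<le> \<bar>\<xi>\<bar> \<Longrightarrow> p' \<xi> = 0; \<And>\<xi>. R \<le> \<bar>\<xi>\<bar> \<Longrightarrow> p'' \<xi> = 0; R \<ge> 0\<rbrakk> \<Longrightarrow>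
      norm (fourier (\<lambda>\<xi>. p \<xi> * g \<xi>) x) \<le> M * C / (1 + x\<^sup>2) \<and>
      integrable lborel (\<lambda>\<xi>. exp (- (\<i> * of_real \<xi> * of_real x)) * (p \<xi> * g \<xi>))"
      unfolding g_def by (rule fourier_gauss_cutoff_decay[OF s, of a]) (use that in blast)
    have single: "norm (fourier (\<lambda>\<xi>. p k \<xi> * g \<xi>) x) \<le> M * C / (1 + x\<^sup>2) \<and>
      integrable lborel (\<lambda>\<xi>. exp (- (\<i> * of_real \<xi> * of_real x)) * (p k \<xi> * g \<xi>))" for k x
      unfolding p_def
    proof (rule C[OF shifted_cutoff_derivs, where R = "\<bar>real_of_int k\<bar> + 1"])
      fix \<xi> :: real
      show "norm (complex_of_real (\<sigma> (\<xi> - of_int k))) \<le> M" "norm (complex_of_real (\<sigma>' (\<xi> - of_int k))) \<le> M"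
        "norm (complex_of_real (\<sigma>'' (\<xi> - of_int k))) \<le> M"
        using M by auto
    next
      fix \<xi> :: real assume "\<bar>real_of_int k\<bar> + 1 \<le> \<bar>\<xi>\<bar>"
      then have "1 \<le> \<bar>\<xi> - of_int k\<bar>" by linarith
      then show "complex_of_real (\<sigma> (\<xi> - of_int k)) = 0" "complex_of_real (\<sigma>' (\<xi> - of_int k)) = 0"
        "complex_of_real (\<sigma>'' (\<xi> - of_int k)) = 0"
        using cutoff_support by auto
    qed (auto intro!: continuous_intros shifted_cutoff_continuous)
    \<comment> \<open>Supplies the dominating function for the integral over \<open>x\<close>. The
      constant must not grow with \<open>N\<close>, so the bound \<open>3 * M\<close> for the summed
      cutoffs and their derivatives is used in place of a sum of the estimates for single
      \<open>k\<close>.\<close>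
    have partial: "norm (fourier (\<lambda>\<xi>. P N \<xi> * g \<xi>) x) \<le> 3 * M * C / (1 + x\<^sup>2)" for N x
    proof -
      have nb: "norm (\<Sum>k\<in>{- int N..int N}. complex_of_real (h (\<xi> - of_int k))) \<le> 3 * M"
        if "\<And>x. \<bar>h x\<bar> \<le> M" "\<And>x. \<bar>x\<bar> \<ge> 1 \<Longrightarrow> h x = 0" for h :: "real \<Rightarrow> real" and \<xi> :: real
        using sum_shifted_cutoff_bound[OF that, where x = \<xi> and N = N] unfolding of_real_sum[symmetric] norm_of_real .
      have sup: "(\<Sum>k\<in>{- int N..int N}. complex_of_real (h (\<xi> - of_int k))) = 0"
        if "\<And>x. \<bar>x\<bar> \<ge> 1 \<Longrightarrow> h x = 0" "real N + 1 \<le> \<bar>\<xi>\<bar>" for h :: "real \<Rightarrow> real" and \<xi> :: real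
      proof (rule sum.neutral, rule ballI)
        fix k assume "k \<in> {- int N..int N}"
        then have "\<bar>real_of_int k\<bar> \<le> real N" by auto
        then have "1 \<le> \<bar>\<xi> - of_int k\<bar>" using that(2) by linarith
        then show "complex_of_real (h (\<xi> - of_int k)) = 0" using that(1) by simp
      qed
      have "norm (fourier (\<lambda>\<xi>. (\<Sum>k\<in>{- int N..int N}. complex_of_real (\<sigma> (\<xi> - of_int k))) * g \<xi>) x) \<le> (3 * M) * C / (1 + x\<^sup>2) \<and>
        integrable lborel (\<lambda>\<xi>. exp (- (\<i> * of_real \<xi> * of_real x)) * ((\<Sum>k\<in>{- int N..int N}. complex_of_real (\<sigma> (\<xi> - of_int k))) * g \<xi>))"
      proof (rule C[where R = "real N + 1"
            and p' = "\<lambda>\<xi>. \<Sum>k\<in>{- int N..int N}. complex_of_real (\<sigma>' (\<xi> - of_int k))"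
            and p'' = "\<lambda>\<xi>. \<Sum>k\<in>{- int N..int N}. complex_of_real (\<sigma>'' (\<xi> - of_int k))"])
        show "continuous_on UNIV (\<lambda>\<xi>. \<Sum>k\<in>{- int N..int N}. complex_of_real (\<sigma>'' (\<xi> - of_int k)))"
          by (intro continuous_intros shifted_cutoff_continuous)
      qed (auto intro!: has_vector_derivative_sum shifted_cutoff_derivs nb sup M cutoff_support)
      then show ?thesis by (simp add: P_def p_def)
    qed
    have P_fourier: "fourier (\<lambda>\<xi>. P N \<xi> * g \<xi>) x = (\<Sum>k\<in>{- int N..int N}. fourier (\<lambda>\<xi>. p k \<xi> * g \<xi>) x)" for N x
      unfolding fourier_def P_def sum_distrib_right sum_distrib_left
      using single by (intro Bochner_Integration.integral_sum) auto
    have [measurable]: "fourier (\<lambda>\<xi>. P N \<xi> * g \<xi>) \<in> borel_measurable borel" for N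
      unfolding fourier_def P_def by measurable
    have meas1 [measurable]: "fourier (\<lambda>\<xi>. p k \<xi> * g \<xi>) \<in> borel_measurable borel" for k
      unfolding fourier_def by measurable
    have int1: "integrable lborel (\<lambda>x. f x * fourier (\<lambda>\<xi>. p k \<xi> * g \<xi>) x)" for k
    proof (rule integrable_quadratic_decay[where C = "B * (M * C)"])
      show "norm (f x * fourier (\<lambda>\<xi>. p k \<xi> * g \<xi>) x) \<le> B * (M * C) / (1 + x\<^sup>2)" for x
      proof -
        have "norm (f x * fourier (\<lambda>\<xi>. p k \<xi> * g \<xi>) x) \<le> B * (M * C / (1 + x\<^sup>2))"
          unfolding norm_mult using B single by (intro mult_mono) auto
        then show ?thesis by simp
      qed
    qed measurable
    have box: "(LINT x|lborel. f x * fourier (\<lambda>\<xi>. p k \<xi> * g \<xi>) x) = box_op \<sigma> k (regular_dist f) (gauss a s)" for k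
      by (simp add: box_op_def dist_inv_fourier_def dist_mult_def dist_fourier_def regular_dist_def p_def g_def)
    \<comment> \<open>In frequency the multiplier becomes \<open>1\<close> pointwise; the inversion
      formula for the Gaussian then names the limit.\<close>
    have lim_fourier: "(\<lambda>N. fourier (\<lambda>\<xi>. P N \<xi> * g \<xi>) x) \<longlonglongrightarrow> gauss a s x" for x
    proof -
      have "(\<lambda>N. fourier (\<lambda>\<xi>. P N \<xi> * g \<xi>) x) \<longlonglongrightarrow> fourier g x"
        unfolding fourier_def
      proof (rule integral_dominated_convergence[where w = "\<lambda>\<xi>. 3 * M * norm (g \<xi>)"])
        show "AE \<xi> in lborel. (\<lambda>N. exp (- (\<i> * of_real \<xi> * of_real x)) * (P N \<xi> * g \<xi>))
            \<longlonglongrightarrow> exp (- (\<i> * of_real \<xi> * of_real x)) * g \<xi>"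
        proof (rule AE_I2, rule tendsto_eventually)
          fix \<xi>
          show "\<forall>\<^sub>F N in sequentially. exp (- (\<i> * of_real \<xi> * of_real x)) * (P N \<xi> * g \<xi>) = exp (- (\<i> * of_real \<xi> * of_real x)) * g \<xi>"
            using sum_shifted_cutoff_eventually_1[of \<xi>]
            by eventually_elim (simp add: P_def p_def flip: of_real_sum)
        qed
        show "integrable lborel (\<lambda>\<xi>. 3 * M * norm (g \<xi>))" using g_int by auto
        show "AE \<xi> in lborel. norm (exp (- (\<i> * of_real \<xi> * of_real x)) * (P N \<xi> * g \<xi>)) \<le> 3 * M * norm (g \<xi>)" for N
        proof (rule AE_I2)
          fix \<xi>
          have "norm (P N \<xi>) \<le> 3 * M"
            using sum_shifted_cutoff_bound[where g = \<sigma> and M = M and x = \<xi> and N = N] M cutoff_support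
            unfolding P_def p_def of_real_sum[symmetric] norm_of_real by blast
          then show "norm (exp (- (\<i> * of_real \<xi> * of_real x)) * (P N \<xi> * g \<xi>)) \<le> 3 * M * norm (g \<xi>)"
            by (simp add: norm_mult mult_right_mono)
        qed
      qed (auto simp: P_def)
      then show ?thesis by (simp add: g_def fourier_inv_fourier_gauss(1)[OF s])
    qed
    have "(\<lambda>N. LINT x|lborel. f x * fourier (\<lambda>\<xi>. P N \<xi> * g \<xi>) x) \<longlonglongrightarrow> (LINT x|lborel. f x * gauss a s x)"
    proof (rule integral_dominated_convergence[where w = "\<lambda>x. (B * (3 * M * C)) * (1 / (1 + x\<^sup>2))"])
      show "integrable lborel (\<lambda>x::real. (B * (3 * M * C)) * (1 / (1 + x\<^sup>2)))"
        by (intro integrable_mult_right integrable_inverse_one_plus_square)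
      show "AE x in lborel. norm (f x * fourier (\<lambda>\<xi>. P N \<xi> * g \<xi>) x) \<le> (B * (3 * M * C)) * (1 / (1 + x\<^sup>2))" for N
      proof (rule AE_I2)
        fix x
        have "norm (f x * fourier (\<lambda>\<xi>. P N \<xi> * g \<xi>) x) \<le> B * (3 * M * C / (1 + x\<^sup>2))"
          unfolding norm_mult using B partial by (intro mult_mono) auto
        then show "norm (f x * fourier (\<lambda>\<xi>. P N \<xi> * g \<xi>) x) \<le> (B * (3 * M * C)) * (1 / (1 + x\<^sup>2))" by simp
      qed
      show "AE x in lborel. (\<lambda>N. f x * fourier (\<lambda>\<xi>. P N \<xi> * g \<xi>) x) \<longlonglongrightarrow> f x * gauss a s x"
        by (intro AE_I2 tendsto_mult tendsto_const lim_fourier)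
    qed (auto simp: gauss_def)
    then have "(\<lambda>N. ennreal (norm (LINT x|lborel. f x * fourier (\<lambda>\<xi>. P N \<xi> * g \<xi>) x))) \<longlonglongrightarrow>
        ennreal (norm (LINT x|lborel. f x * gauss a s x))"
      by (intro tendsto_ennrealI tendsto_norm)
    moreover have "ennreal (norm (LINT x|lborel. f x * fourier (\<lambda>\<xi>. P N \<xi> * g \<xi>) x)) \<le> X_norm \<sigma> r f" for N
    proof -
      have "(LINT x|lborel. f x * fourier (\<lambda>\<xi>. P N \<xi> * g \<xi>) x) =
          (\<Sum>k\<in>{- int N..int N}. box_op \<sigma> k (regular_dist f) (gauss a s))"
        unfolding P_fourier sum_distrib_left box[symmetric] by (intro Bochner_Integration.integral_sum int1)
      then have "ennreal (norm (LINT x|lborel. f x * fourier (\<lambda>\<xi>. P N \<xi> * g \<xi>) x)) \<le>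
          ennreal (\<Sum>k\<in>{- int N..int N}. norm (box_op \<sigma> k (regular_dist f) (gauss a s)))"
        by (intro ennreal_leI) (simp add: norm_sum)
      also have "\<dots> = (\<Sum>k\<in>{- int N..int N}. ennreal (norm (box_op \<sigma> k (regular_dist f) (gauss a s))))"
        by (simp add: sum_ennreal)
      also have "\<dots> \<le> (\<Sum>k\<in>{- int N..int N}. ennreal (japanese_bracket k powr r) * Linf_norm (box_op \<sigma> k (regular_dist f)))"
      proof (rule sum_mono)
        fix k
        have "1 * ennreal (norm (box_op \<sigma> k (regular_dist f) (gauss a s))) \<le>
            ennreal (japanese_bracket k powr r) * Linf_norm (box_op \<sigma> k (regular_dist f))"
          using japanese_bracket_powr_ge_1[OF r, of k] s
          by (intro mult_mono Linf_norm_gauss_bound) (auto simp: ennreal_le_iff2 simp flip: ennreal_1)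
        then show "ennreal (norm (box_op \<sigma> k (regular_dist f) (gauss a s))) \<le>
            ennreal (japanese_bracket k powr r) * Linf_norm (box_op \<sigma> k (regular_dist f))" by simp
      qed
      also have "\<dots> \<le> X_norm \<sigma> r f"
        unfolding X_norm_def modulation_norm_def by (rule finite_sum_le_infsum_ennreal) simp
      finally show ?thesis .
    qed
    ultimately show ?thesis by (blast intro: LIMSEQ_le_const2)
  qed
  show ?thesis
  proof (rule LIMSEQ_le_const2)
    show "(\<lambda>n. ennreal (norm (LINT x|lborel. f x * gauss a (1 / real (Suc n)) x))) \<longlonglongrightarrow> ennreal (norm (f a))"
      by (intro tendsto_ennrealI tendsto_norm gauss_approximate_identity[OF B(2,3)])
  qed (use gauss_bound in auto)
qed

end

context cutoff
begin

lemma X_norm_eq: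
  assumes "bcont f"
  shows "X_norm \<sigma> r f = (\<Sum>\<^sub>\<infinity>k::int. ennreal (japanese_bracket k powr r) * box_norm k f)"
proof -
  obtain B where "continuous_on UNIV f" "\<And>x. norm (f x) \<le> B"
    by (rule bcontE[OF assms]) (use that in blast)
  then show ?thesis by (rule modulation_norm_regular)
qed

lemma box_fun_add:
  assumes "bcont f" "bcont g"
  shows "box_fun k (\<lambda>x. f x + g x) y = box_fun k f y + box_fun k g y"
proof -
  have int: "integrable lborel (\<lambda>z. h (y - z) * box_kernel k z)" if "bcont h" for h
    by (rule bcontE[OF that]) (rule box_fun_integrable)
  show ?thesis
    using int[OF assms(1)] int[OF assms(2)] by (simp add: box_fun_eq distrib_right)
qed

lemma box_norm_add_le:
  assumes "bcont f" "bcont g"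
  shows "box_norm k (\<lambda>x. f x + g x) \<le> box_norm k f + box_norm k g"
  unfolding box_norm_def
proof (rule SUP_least)
  fix x
  have "ennreal (norm (box_fun k (\<lambda>x. f x + g x) x)) \<le> ennreal (norm (box_fun k f x)) + ennreal (norm (box_fun k g x))"
    unfolding box_fun_add[OF assms] by (simp add: norm_triangle_ineq ennreal_leI flip: ennreal_plus)
  also have "\<dots> \<le> (SUP x. ennreal (norm (box_fun k f x))) + (SUP x. ennreal (norm (box_fun k g x)))"
    by (intro add_mono SUP_upper) auto
  finally show "ennreal (norm (box_fun k (\<lambda>x. f x + g x) x)) \<le>
    (SUP x. ennreal (norm (box_fun k f x))) + (SUP x. ennreal (norm (box_fun k g x)))" .
qed

lemma box_norm_uminus: "box_norm k (\<lambda>x. - f x) = box_norm k f"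
  by (simp add: box_norm_def box_fun_def)

lemma box_norm_diff_le:
  assumes "bcont f" "bcont g"
  shows "box_norm k (\<lambda>x. f x - g x) \<le> box_norm k f + box_norm k g"
proof -
  have "bcont (\<lambda>x. - g x)" using assms(2) by (auto simp: bcont_def bounded_uminus intro!: continuous_intros)
  from box_norm_add_le[OF assms(1) this] show ?thesis by (simp add: box_norm_uminus)
qed

lemma box_norm_le_sup:
  assumes "bcont f" "\<And>x. norm (f x) \<le> \<delta>"
  shows "box_norm k f \<le> ennreal (\<delta> * kernel_mass k)"
  unfolding box_norm_def using assms
  by (intro SUP_least ennreal_leI box_fun_bound) (auto simp: bcont_def intro: borel_measurable_continuous_onI)

lemma box_norm_translate: "box_norm k (translate y f) = box_norm k f"
proof -
  have "box_fun k (translate y f) x = box_fun k f (x + y)" for x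
    by (simp add: box_fun_eq translate_def algebra_simps)
  moreover have "range (\<lambda>x. ennreal (norm (box_fun k f (x + y)))) = range (\<lambda>x. ennreal (norm (box_fun k f x)))"
  proof -
    have "(\<lambda>x. ennreal (norm (box_fun k f (x + y)))) = (\<lambda>x. ennreal (norm (box_fun k f x))) \<circ> (\<lambda>x. x + y)"
      by (simp add: fun_eq_iff)
    then show ?thesis by (simp only: image_comp[symmetric] surj_plus_right)
  qed
  ultimately show ?thesis by (simp add: box_norm_def)
qed

text \<open>Lower semicontinuity under uniform convergence: since the kernel is integrable, a
  uniform error costs at most that error times \<open>kernel_mass k\<close>. This carries box bounds
  from translates to the hull.\<close>

lemma box_norm_uniform_limit_le:
  assumes g: "bcont g"
    and approx: "\<And>\<epsilon>. \<epsilon> > 0 \<Longrightarrow> \<exists>f. bcont f \<and> box_norm k f \<le> b \<and> (\<forall>x. norm (f x - g x) \<le> \<epsilon>)"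
  shows "box_norm k g \<le> b"
proof (rule ennreal_le_epsilon)
  fix e :: real assume e: "e > 0"
  \<comment> \<open>Adding \<open>1\<close> allows division even if the mass should be zero.\<close>
  have pos: "kernel_mass k + 1 > 0" using kernel_mass_nonneg[of k] by simp
  obtain f where f: "bcont f" "box_norm k f \<le> b" "\<And>x. norm (f x - g x) \<le> e / (kernel_mass k + 1)"
    using approx[of "e / (kernel_mass k + 1)"] e pos by auto
  have "box_norm k g = box_norm k (\<lambda>x. f x - (f x - g x))" by simp
  also have "\<dots> \<le> box_norm k f + box_norm k (\<lambda>x. f x - g x)"
    by (intro box_norm_diff_le bcont_diff f g)
  also have "\<dots> \<le> b + ennreal (e / (kernel_mass k + 1) * kernel_mass k)"
    by (intro add_mono box_norm_le_sup bcont_diff f g)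
  also have "\<dots> \<le> b + ennreal e"
  proof (intro add_mono ennreal_leI order_refl)
    have "e * kernel_mass k \<le> e * (kernel_mass k + 1)" using e by simp
    then show "e / (kernel_mass k + 1) * kernel_mass k \<le> e"
      using pos by (simp add: divide_le_eq)
  qed
  finally show "box_norm k g \<le> b + ennreal e" .
qed

lemma X_norm_translate: "bcont f \<Longrightarrow> X_norm \<sigma> r (translate y f) = X_norm \<sigma> r f"
  by (simp add: X_norm_eq bcont_translate box_norm_translate)

lemma X_norm_add_le:
  assumes "bcont f" "bcont g"
  shows "X_norm \<sigma> r (\<lambda>x. f x + g x) \<le> X_norm \<sigma> r f + X_norm \<sigma> r g"
  unfolding X_norm_eq[OF assms(1)] X_norm_eq[OF assms(2)] X_norm_eq[OF bcont_add[OF assms]]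
proof -
  have "(\<Sum>\<^sub>\<infinity>k::int. ennreal (japanese_bracket k powr r) * box_norm k (\<lambda>x. f x + g x)) \<le>
      (\<Sum>\<^sub>\<infinity>k::int. ennreal (japanese_bracket k powr r) * box_norm k f + ennreal (japanese_bracket k powr r) * box_norm k g)"
    using box_norm_add_le[OF assms]
    by (intro infsum_mono nonneg_summable_on_complete) (auto simp: mult_left_mono simp flip: distrib_left)
  also have "\<dots> = (\<Sum>\<^sub>\<infinity>k::int. ennreal (japanese_bracket k powr r) * box_norm k f) +
      (\<Sum>\<^sub>\<infinity>k::int. ennreal (japanese_bracket k powr r) * box_norm k g)"
    by (intro infsum_add nonneg_summable_on_complete) auto
  finally show "(\<Sum>\<^sub>\<infinity>k::int. ennreal (japanese_bracket k powr r) * box_norm k (\<lambda>x. f x + g x)) \<le>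
      (\<Sum>\<^sub>\<infinity>k::int. ennreal (japanese_bracket k powr r) * box_norm k f) +
      (\<Sum>\<^sub>\<infinity>k::int. ennreal (japanese_bracket k powr r) * box_norm k g)" .
qed

lemma X_norm_diff_le:
  assumes "bcont f" "bcont g"
  shows "X_norm \<sigma> r (\<lambda>x. f x - g x) \<le> X_norm \<sigma> r f + X_norm \<sigma> r g"
proof -
  have b: "bcont (\<lambda>x. - g x)" using assms(2) by (auto simp: bcont_def bounded_uminus intro!: continuous_intros)
  have "X_norm \<sigma> r (\<lambda>x. - g x) = X_norm \<sigma> r g"
    by (simp add: X_norm_eq b assms box_norm_uminus)
  with X_norm_add_le[OF assms(1) b, of r] show ?thesis by simp
qed

lemma X_norm_diff_finite:
  assumes "f \<in> X_space \<sigma> r" "g \<in> X_space \<sigma> r"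
  shows "X_norm \<sigma> r (\<lambda>x. f x - g x) < \<infinity>"
  using X_norm_diff_le[OF X_space_bcont[OF assms(1)] X_space_bcont[OF assms(2)], of r] assms
  by (auto simp: X_space_iff intro: le_less_trans)

lemma translate_X_space:
  assumes "f \<in> X_space \<sigma> r"
  shows "translate y f \<in> X_space \<sigma> r"
proof -
  have "uniformly_continuous_on UNIV (translate y f)"
  proof -
    have "uniformly_continuous_on UNIV f" using assms by (simp add: X_space_def)
    then show ?thesis
      unfolding uniformly_continuous_on_def translate_def
      by (metis dist_add_cancel2 UNIV_I)
  qed
  then show ?thesis
    using assms bcont_translate[OF X_space_bcont[OF assms]] X_norm_translate[OF X_space_bcont[OF assms]]
    by (simp add: X_space_iff bcont_def)
qed

lemma sup_diff_le_X_dist: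
  assumes "f \<in> X_space \<sigma> r" "g \<in> X_space \<sigma> r" "r \<ge> 0"
  shows "norm (f x - g x) \<le> X_dist \<sigma> r f g"
proof -
  have "ennreal (norm (f x - g x)) \<le> X_norm \<sigma> r (\<lambda>x. f x - g x)"
    by (intro sup_le_X_norm bcont_diff X_space_bcont[OF assms(1)] X_space_bcont[OF assms(2)] assms(3))
  then have "enn2real (ennreal (norm (f x - g x))) \<le> X_dist \<sigma> r f g"
    unfolding X_dist_def using X_norm_diff_finite[OF assms(1,2)] by (intro enn2real_mono) auto
  then show ?thesis by simp
qed

text \<open>Definiteness comes from domination of the supremum norm. The triangle inequality relies
  on finite norms, since \<open>enn2real\<close> sends \<open>\<infinity>\<close> to
  \<open>0\<close>.\<close>

lemma X_metric_space:
  assumes r: "r \<ge> 0"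
  shows "Metric_space (X_space \<sigma> r) (X_dist \<sigma> r)"
proof
  show "0 \<le> X_dist \<sigma> r f g" for f g by (simp add: X_dist_def)
  show "X_dist \<sigma> r f g = X_dist \<sigma> r g f" for f g unfolding X_dist_def by (rule arg_cong[OF X_norm_commute])
next
  fix f g assume fg: "f \<in> X_space \<sigma> r" "g \<in> X_space \<sigma> r"
  show "X_dist \<sigma> r f g = 0 \<longleftrightarrow> f = g"
  proof
    assume "X_dist \<sigma> r f g = 0"
    then have "norm (f x - g x) \<le> 0" for x using sup_diff_le_X_dist[OF fg r, of x] by simp
    then show "f = g" by (simp add: fun_eq_iff)
  next
    assume "f = g"
    have "bcont (\<lambda>_. 0)" by (intro bcontI[of _ 0]) auto
    then have "X_norm \<sigma> r (\<lambda>_. 0) = 0" by (simp add: X_norm_eq box_norm_def box_fun_def)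
    then show "X_dist \<sigma> r f g = 0" using \<open>f = g\<close> by (simp add: X_dist_def)
  qed
next
  fix f g h assume fgh: "f \<in> X_space \<sigma> r" "g \<in> X_space \<sigma> r" "h \<in> X_space \<sigma> r"
  have "X_norm \<sigma> r (\<lambda>x. f x - h x) = X_norm \<sigma> r (\<lambda>x. (f x - g x) + (g x - h x))" by simp
  also have "\<dots> \<le> X_norm \<sigma> r (\<lambda>x. f x - g x) + X_norm \<sigma> r (\<lambda>x. g x - h x)"
    by (intro X_norm_add_le bcont_diff fgh[THEN X_space_bcont])
  finally show "X_dist \<sigma> r f h \<le> X_dist \<sigma> r f g + X_dist \<sigma> r g h"
    unfolding X_dist_def using X_norm_diff_finite fgh
    by (subst enn2real_plus[symmetric]) (auto intro!: enn2real_mono simp: ennreal_add_less_top)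
qed

text \<open>\<open>F\<close> carries all but \<open>\<epsilon> / 4\<close> of the norm of
  \<open>q\<close>. On \<open>F\<close> uniform closeness acts through finitely many kernel masses;
  off \<open>F\<close> the difference is majorized by twice the boxes of \<open>q\<close>. The
  choice of \<open>\<delta>\<close> depends on \<open>q\<close> and not on \<open>f\<close> and
  \<open>g\<close>.\<close>

lemma X_norm_small_if_uniformly_small:
  assumes q: "bcont q" "X_norm \<sigma> r q < \<infinity>" and \<epsilon>: "\<epsilon> > 0"
  obtains \<delta> where "\<delta> > 0"
    "\<And>f g. \<lbrakk>bcont f; bcont g; \<And>k. box_norm k f \<le> box_norm k q; \<And>k. box_norm k g \<le> box_norm k q;
      \<And>x. norm (f x - g x) \<le> \<delta>\<rbrakk> \<Longrightarrow> X_norm \<sigma> r (\<lambda>x. f x - g x) \<le> ennreal \<epsilon>"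
proof -
  define w where "w k = ennreal (japanese_bracket k powr r)" for k
  have "infsum (\<lambda>k. w k * box_norm k q) UNIV < \<infinity>"
    using q X_norm_eq[OF q(1)] by (simp add: w_def)
  then obtain F where F: "finite F" "infsum (\<lambda>k. w k * box_norm k q) (- F) < ennreal (\<epsilon> / 4)"
    using infsum_ennreal_small_tail[of "\<lambda>k. w k * box_norm k q" "ennreal (\<epsilon> / 4)"] \<epsilon> by auto
  define W where "W = (\<Sum>k\<in>F. japanese_bracket k powr r * kernel_mass k) + 1"
  have W: "W > 0" unfolding W_def by (intro add_nonneg_pos sum_nonneg mult_nonneg_nonneg kernel_mass_nonneg) auto
  define \<delta> where "\<delta> = \<epsilon> / (2 * W)"
  have \<delta>: "\<delta> > 0" using W \<epsilon> by (simp add: \<delta>_def)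
  show thesis
  proof (rule that[OF \<delta>])
    fix f g assume fg: "bcont f" "bcont g" and le: "\<And>k. box_norm k f \<le> box_norm k q" "\<And>k. box_norm k g \<le> box_norm k q"
      and d: "\<And>x. norm (f x - g x) \<le> \<delta>"
    have b: "bcont (\<lambda>x. f x - g x)" by (rule bcont_diff[OF fg])
    have "X_norm \<sigma> r (\<lambda>x. f x - g x) = infsum (\<lambda>k. w k * box_norm k (\<lambda>x. f x - g x)) (F \<union> - F)"
      by (simp add: X_norm_eq[OF b] w_def)
    also have "\<dots> = infsum (\<lambda>k. w k * box_norm k (\<lambda>x. f x - g x)) F + infsum (\<lambda>k. w k * box_norm k (\<lambda>x. f x - g x)) (- F)"
      by (intro infsum_Un_disjoint nonneg_summable_on_complete) auto
    also have "infsum (\<lambda>k. w k * box_norm k (\<lambda>x. f x - g x)) F \<le> ennreal (\<epsilon> / 2)"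
    proof -
      have "infsum (\<lambda>k. w k * box_norm k (\<lambda>x. f x - g x)) F = (\<Sum>k\<in>F. w k * box_norm k (\<lambda>x. f x - g x))"
        using F by simp
      also have "\<dots> \<le> (\<Sum>k\<in>F. ennreal (japanese_bracket k powr r * (\<delta> * kernel_mass k)))"
      proof (rule sum_mono)
        fix k
        have "w k * box_norm k (\<lambda>x. f x - g x) \<le> w k * ennreal (\<delta> * kernel_mass k)"
          by (intro mult_left_mono box_norm_le_sup b d) auto
        then show "w k * box_norm k (\<lambda>x. f x - g x) \<le> ennreal (japanese_bracket k powr r * (\<delta> * kernel_mass k))"
          using \<delta> kernel_mass_nonneg by (simp add: w_def ennreal_mult)
      qed
      also have "\<dots> = ennreal (\<Sum>k\<in>F. japanese_bracket k powr r * (\<delta> * kernel_mass k))"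
        using \<delta> kernel_mass_nonneg by (intro sum_ennreal) auto
      also have "(\<Sum>k\<in>F. japanese_bracket k powr r * (\<delta> * kernel_mass k)) = \<delta> * (W - 1)"
        unfolding W_def by (simp add: sum_distrib_left mult_ac)
      also have "ennreal (\<delta> * (W - 1)) \<le> ennreal (\<delta> * W)"
        using \<delta> by (intro ennreal_leI) auto
      also have "\<delta> * W = \<epsilon> / 2" using W by (simp add: \<delta>_def)
      finally show ?thesis .
    qed
    also have "infsum (\<lambda>k. w k * box_norm k (\<lambda>x. f x - g x)) (- F) \<le> ennreal (\<epsilon> / 2)"
    proof -
      have "infsum (\<lambda>k. w k * box_norm k (\<lambda>x. f x - g x)) (- F) \<le>
          infsum (\<lambda>k. w k * box_norm k q + w k * box_norm k q) (- F)"
      proof (intro infsum_mono nonneg_summable_on_complete)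
        fix k
        have "box_norm k (\<lambda>x. f x - g x) \<le> box_norm k q + box_norm k q"
          using box_norm_diff_le[OF fg] le by (meson add_mono order_trans)
        then show "w k * box_norm k (\<lambda>x. f x - g x) \<le> w k * box_norm k q + w k * box_norm k q"
          by (simp add: mult_left_mono flip: distrib_left)
      qed auto
      also have "\<dots> = infsum (\<lambda>k. w k * box_norm k q) (- F) + infsum (\<lambda>k. w k * box_norm k q) (- F)"
        by (intro infsum_add nonneg_summable_on_complete) auto
      also have "\<dots> \<le> ennreal (\<epsilon> / 4) + ennreal (\<epsilon> / 4)"
        using F by (intro add_mono) auto
      also have "\<dots> = ennreal (\<epsilon> / 2)" using \<epsilon> by (simp flip: ennreal_plus)
      finally show ?thesis .
    qed
    also have "ennreal (\<epsilon> / 2) + ennreal (\<epsilon> / 2) = ennreal \<epsilon>" using \<epsilon> by (simp flip: ennreal_plus)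
    finally show "X_norm \<sigma> r (\<lambda>x. f x - g x) \<le> ennreal \<epsilon>"
      by (simp add: add_mono)
  qed
qed

end

section \<open>The flow on hulls\<close>

lemma classical_solution_shift:
  assumes v: "classical_solution \<kappa> v"
  shows "classical_solution \<kappa> (\<lambda>t x. v (t + s) (x + y))"
    and "dx (\<lambda>t x. v (t + s) (x + y)) t x = dx v (t + s) (x + y)"
proof -
  have dx1: "dx (\<lambda>t x. v (t + s) (x + y)) = (\<lambda>t x. dx v (t + s) (x + y))" for v
    by (intro ext) (simp add: dx_def vderiv_shift[of "v (_ + s)"])
  have dt1: "dt (\<lambda>t x. v (t + s) (x + y)) = (\<lambda>t x. dt v (t + s) (x + y))"
    by (intro ext) (simp add: dt_def vderiv_shift[of "\<lambda>r. v r (_ + y)"])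
  show "dx (\<lambda>t x. v (t + s) (x + y)) t x = dx v (t + s) (x + y)" by (simp add: dx1)
  have c: "continuous_on UNIV (\<lambda>p::real \<times> real. h (fst p + s) (snd p + y))"
    if "continuous_on UNIV (\<lambda>(t, x). h t x)" for h :: "real \<Rightarrow> real \<Rightarrow> complex"
    using continuous_on_compose2[OF that, of UNIV "\<lambda>p. (fst p + s, snd p + y)"]
    by (simp add: continuous_intros)
  show "classical_solution \<kappa> (\<lambda>t x. v (t + s) (x + y))"
    using v unfolding classical_solution_def dx1 dt1 case_prod_beta
    by (intro conjI allI) (auto simp: differentiable_shift_iff[of "\<lambda>r. v r (_ + y)"]
        differentiable_shift_iff[of "v (_ + s)"] differentiable_shift_iff[of "dx v (_ + s)"]
        case_prod_beta intro!: c)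
qed

context cutoff
begin

text \<open>The continuous image of the compact time interval is bounded in the metric of
  \<open>X\<close>, which dominates the supremum norm.\<close>

lemma C0_X_bounded:
  assumes v: "C0_X \<sigma> r v" and r: "r \<ge> 0"
  obtains B where "\<And>t x. \<bar>t\<bar> \<le> T \<Longrightarrow> norm (v t x) \<le> B"
proof -
  interpret Metric_space "X_space \<sigma> r" "X_dist \<sigma> r" by (rule X_metric_space[OF r])
  have "compactin euclideanreal {-T..T}" by simp
  then have "compactin mtopology (v ` {-T..T})"
    using v unfolding C0_X_def X_topology_def by (intro image_compactin) auto
  then have "mbounded (v ` {-T..T})" by (rule compactin_imp_mbounded)
  then obtain c D where D: "v ` {-T..T} \<subseteq> mcball c D" by (auto simp: mbounded_def)
  show thesis
  proof (cases "c \<in> X_space \<sigma> r")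
    case True
    obtain C where C: "\<And>x. norm (c x) \<le> C"
      by (rule bcontE[OF X_space_bcont[OF True]]) (use that in blast)
    have "norm (v t x) \<le> C + D" if "\<bar>t\<bar> \<le> T" for t x
    proof -
      have "v t \<in> mcball c D" using that by (intro subsetD[OF D] imageI) (auto simp: abs_le_iff)
      then have "X_dist \<sigma> r c (v t) \<le> D" "v t \<in> X_space \<sigma> r" by (auto simp: in_mcball)
      then have "norm (c x - v t x) \<le> D"
        using sup_diff_le_X_dist[OF True _ r, of "v t" x] by simp
      then show ?thesis
        using C[of x] norm_triangle_ineq2[of "v t x" "c x"] by (simp add: norm_minus_commute)
    qed
    then show thesis by (rule that)
  next
    \<comment> \<open>A closed ball about a point outside the space is empty; then there is no
      admissible \<open>t\<close> at all, that is \<open>T < 0\<close>.\<close>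
    case False
    then have "mcball c D = {}" by (auto simp: mcball_def)
    with D have "\<not> \<bar>t\<bar> \<le> T" for t by (auto simp: abs_le_iff)
    then show thesis by (intro that) blast
  qed
qed

text \<open>Difference quotients that converge in \<open>X_norm\<close> converge pointwise, so the
  derivative in \<open>X\<close> is the classical one. It thereby makes bounds on
  \<open>q\<^sub>t\<close> uniform in \<open>x\<close> available.\<close>

lemma C1_X_time_derivative:
  assumes q: "\<And>t. q t \<in> X_space \<sigma> r" and p: "p t \<in> X_space \<sigma> r" and r: "r \<ge> 0"
    and lim: "((\<lambda>h. X_norm \<sigma> r (\<lambda>x. (q (t + h) x - q t x) / of_real h - p t x)) \<longlongrightarrow> 0) (at 0)"
    and d: "((\<lambda>s. q s x) has_vector_derivative d) (at t)"
  shows "d = p t x"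
proof -
  define Q where "Q h = (q (t + h) x - q t x) / complex_of_real h" for h
  have "((\<lambda>h. ennreal (norm (Q h - p t x))) \<longlongrightarrow> 0) (at 0)"
  proof (rule tendsto_sandwich[OF _ _ tendsto_const lim])
    have "ennreal (norm (Q h - p t x)) \<le> X_norm \<sigma> r (\<lambda>x. (q (t + h) x - q t x) / of_real h - p t x)" for h
    proof -
      have "bcont (\<lambda>x. (q (t + h) x - q t x) / of_real h - p t x)"
      proof (rule bcont_diff[OF _ X_space_bcont[OF p]])
        obtain B where B: "continuous_on UNIV (\<lambda>x. q (t + h) x - q t x)" "\<And>x. norm (q (t + h) x - q t x) \<le> B"
          by (rule bcontE[OF bcont_diff[OF X_space_bcont[OF q] X_space_bcont[OF q]]]) (use that in blast)
        show "bcont (\<lambda>x. (q (t + h) x - q t x) / of_real h)"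
        proof (rule bcontI)
          show "continuous_on UNIV (\<lambda>x. (q (t + h) x - q t x) / of_real h)"
            unfolding divide_inverse by (intro continuous_on_mult B continuous_on_const)
          show "norm ((q (t + h) x - q t x) / of_real h) \<le> B / \<bar>h\<bar>" for x
            unfolding norm_divide norm_of_real using B by (intro divide_right_mono) auto
        qed
      qed
      from sup_le_X_norm[OF this r, of x] show ?thesis by (simp add: Q_def)
    qed
    then show "\<forall>\<^sub>F h in at 0. ennreal (norm (Q h - p t x)) \<le> X_norm \<sigma> r (\<lambda>x. (q (t + h) x - q t x) / of_real h - p t x)"
      by simp
  qed simp
  then have "((\<lambda>h. norm (Q h - p t x)) \<longlongrightarrow> 0) (at 0)"
    by (subst (asm) ennreal_0[symmetric], subst (asm) tendsto_ennreal_iff) auto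
  then have "(Q \<longlongrightarrow> p t x) (at 0)"
    by (simp add: tendsto_norm_zero_iff LIM_zero_iff)
  moreover have "(Q \<longlongrightarrow> d) (at 0)"
  proof -
    have "((\<lambda>h. norm (q (t + h) x - q t x - h *\<^sub>R d) / norm h) \<longlongrightarrow> 0) (at 0)"
      using d by (simp add: has_vector_derivative_def has_derivative_at)
    moreover have "\<forall>\<^sub>F h in at 0. norm (q (t + h) x - q t x - h *\<^sub>R d) / norm h = norm (Q h - d)"
    proof (rule eventually_at_filter[THEN iffD2, OF always_eventually], intro allI impI)
      fix h :: real assume h: "h \<noteq> 0"
      have "Q h - d = (q (t + h) x - q t x - h *\<^sub>R d) / of_real h"
        using h by (simp add: Q_def field_simps scaleR_conv_of_real)
      then show "norm (q (t + h) x - q t x - h *\<^sub>R d) / norm h = norm (Q h - d)"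
        by (simp add: norm_divide)
    qed
    ultimately have "((\<lambda>h. norm (Q h - d)) \<longlongrightarrow> 0) (at 0)"
      by (rule Lim_transform_eventually)
    then show ?thesis by (simp add: tendsto_norm_zero_iff LIM_zero_iff)
  qed
  ultimately show ?thesis
    using tendsto_unique[OF trivial_limit_at] by blast
qed

lemma box_norm_le_if_approximated_by_translates:
  assumes f: "f \<in> X_space \<sigma> r" and g: "g \<in> X_space \<sigma> r"
    and close: "\<And>\<epsilon>. \<epsilon> > 0 \<Longrightarrow> \<exists>y. \<forall>x. norm (f (x + y) - g x) \<le> \<epsilon>"
  shows "box_norm k g \<le> box_norm k f"
proof (rule box_norm_uniform_limit_le[OF X_space_bcont[OF g]])
  fix \<epsilon> :: real assume "\<epsilon> > 0"
  then obtain y where "\<forall>x. norm (f (x + y) - g x) \<le> \<epsilon>" using close by blast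
  then show "\<exists>h. bcont h \<and> box_norm k h \<le> box_norm k f \<and> (\<forall>x. norm (h x - g x) \<le> \<epsilon>)"
    by (intro exI[of _ "translate y f"])
      (simp add: box_norm_translate bcont_translate X_space_bcont[OF f], simp add: translate_def)
qed

lemma hull_memD:
  assumes f: "f \<in> X_space \<sigma> 5" and g: "g \<in> translation_hull \<sigma> f"
  shows "g \<in> X_space \<sigma> 5"
    and "\<epsilon> > 0 \<Longrightarrow> \<exists>y. \<forall>x. norm (f (x + y) - g x) \<le> \<epsilon>"
    and "box_norm k g \<le> box_norm k f"
proof -
  interpret Metric_space "X_space \<sigma> 5" "X_dist \<sigma> 5" by (rule X_metric_space) simp
  have g': "g \<in> X_space \<sigma> 5" "\<And>e. e > 0 \<Longrightarrow> \<exists>y. X_dist \<sigma> 5 g (translate y f) < e"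
    using g unfolding translation_hull_def X_topology_def metric_closure_of by (auto simp: in_mball)
  then show "g \<in> X_space \<sigma> 5" by simp
  show close: "\<exists>y. \<forall>x. norm (f (x + y) - g x) \<le> \<epsilon>" if \<epsilon>: "\<epsilon> > 0" for \<epsilon>
  proof -
    obtain y where y: "X_dist \<sigma> 5 g (translate y f) < \<epsilon>" using g'(2)[OF \<epsilon>] by blast
    have "norm (f (x + y) - g x) \<le> \<epsilon>" for x
      using sup_diff_le_X_dist[OF g'(1) translate_X_space[OF f], of x y] y
      by (simp add: translate_def norm_minus_commute)
    then show ?thesis by blast
  qed
  show "box_norm k g \<le> box_norm k f"
    by (rule box_norm_le_if_approximated_by_translates[OF f g'(1) close])
qed

text \<open>Together with \<open>hull_memD\<close> this characterizes the hull inside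
  \<open>X_space\<close> by uniform approximation: such a \<open>g\<close> inherits the box bounds
  of \<open>f\<close>, and these upgrade the approximation to the norm of \<open>X\<close>.\<close>

lemma hull_memI:
  assumes f: "f \<in> X_space \<sigma> 5" and g: "g \<in> X_space \<sigma> 5"
    and close: "\<And>\<epsilon>. \<epsilon> > 0 \<Longrightarrow> \<exists>y. \<forall>x. norm (f (x + y) - g x) \<le> \<epsilon>"
  shows "g \<in> translation_hull \<sigma> f"
proof -
  interpret Metric_space "X_space \<sigma> 5" "X_dist \<sigma> 5" by (rule X_metric_space) simp
  note bg = box_norm_le_if_approximated_by_translates[OF f g close]
  have "\<exists>y. X_dist \<sigma> 5 g (translate y f) < e" if e: "e > 0" for e
  proof -
    obtain \<delta> where \<delta>: "\<delta> > 0" and small: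
      "\<And>h g. \<lbrakk>bcont h; bcont g; \<And>k. box_norm k h \<le> box_norm k f; \<And>k. box_norm k g \<le> box_norm k f;
        \<And>x. norm (h x - g x) \<le> \<delta>\<rbrakk> \<Longrightarrow> X_norm \<sigma> 5 (\<lambda>x. h x - g x) \<le> ennreal (e / 2)"
      by (rule X_norm_small_if_uniformly_small[OF X_space_bcont[OF f], of 5 "e / 2"])
        (use f e that in \<open>auto simp: X_space_iff\<close>)
    obtain y where y: "\<And>x. norm (f (x + y) - g x) \<le> \<delta>" using close[OF \<delta>] by blast
    have "X_norm \<sigma> 5 (\<lambda>x. g x - translate y f x) \<le> ennreal (e / 2)"
    proof (intro small bg X_space_bcont[OF g] bcont_translate X_space_bcont[OF f])
      show "box_norm k (translate y f) \<le> box_norm k f" for k by (simp add: box_norm_translate)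
      show "norm (g x - translate y f x) \<le> \<delta>" for x using y[of x] by (simp add: translate_def norm_minus_commute)
    qed
    then have "X_dist \<sigma> 5 g (translate y f) \<le> enn2real (ennreal (e / 2))"
      unfolding X_dist_def by (intro enn2real_mono) auto
    then have "X_dist \<sigma> 5 g (translate y f) < e" using e by simp
    then show ?thesis by blast
  qed
  then show ?thesis
    using g translate_X_space[OF f] unfolding translation_hull_def X_topology_def metric_closure_of
    by (auto simp: in_mball)
qed

end

section \<open>The flow: symmetries, stability, almost periodic data and hulls\<close>

locale nls = cutoff +
  fixes \<kappa> :: real and \<Phi> :: "real \<Rightarrow> (real \<Rightarrow> complex) \<Rightarrow> (real \<Rightarrow> complex)"
  assumes \<kappa>: "\<kappa> \<in> {1, -1}" and flow: "nls_flow \<sigma> \<kappa> \<Phi>"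
begin

lemma flow_facts:
  assumes "f \<in> X_space \<sigma> 5"
  shows "classical_solution \<kappa> (\<lambda>t. \<Phi> t f)" "\<Phi> t f \<in> X_space \<sigma> 5" "\<Phi> 0 f = f"
    "C0_X \<sigma> 5 (\<lambda>t. \<Phi> t f)" "C1_X \<sigma> 3 (\<lambda>t. \<Phi> t f)"
    "\<And>v. \<lbrakk>classical_solution \<kappa> v; bounded_on_strips v; bounded_on_strips (dx v); v 0 = f\<rbrakk> \<Longrightarrow> v = (\<lambda>t. \<Phi> t f)"
  using flow assms by (auto simp: nls_flow_def C0_X_def)

lemma orbit_bounded:
  assumes f: "f \<in> X_space \<sigma> 5"
  obtains M where "M > 0" "\<And>t x. \<bar>t\<bar> \<le> T \<Longrightarrow> norm (\<Phi> t f x) \<le> M" "\<And>t x. \<bar>t\<bar> \<le> T \<Longrightarrow> norm (dx (\<lambda>t. \<Phi> t f) t x) \<le> M"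
proof -
  define q where "q = (\<lambda>t. \<Phi> t f)"
  have "classical_solution \<kappa> q" unfolding q_def by (rule flow_facts(1)[OF f])
  note D = classical_solutionD[OF this]
  obtain B where B: "\<And>t x. \<bar>t\<bar> \<le> T \<Longrightarrow> norm (q t x) \<le> B"
    unfolding q_def by (rule C0_X_bounded[OF flow_facts(4)[OF f], of T]) (use that in auto)
  obtain p where p: "C0_X \<sigma> 3 p" "\<And>t. q t \<in> X_space \<sigma> 3"
    "\<And>t. ((\<lambda>h. X_norm \<sigma> 3 (\<lambda>x. (q (t + h) x - q t x) / of_real h - p t x)) \<longlongrightarrow> 0) (at 0)"
    using flow_facts(5)[OF f] unfolding C1_X_def q_def by blast
  obtain A where A: "\<And>t x. \<bar>t\<bar> \<le> T \<Longrightarrow> norm (p t x) \<le> A"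
    by (rule C0_X_bounded[OF p(1), of T]) (use that in auto)
  have pX: "p t \<in> X_space \<sigma> 3" for t using p(1) by (simp add: C0_X_def)
  have dt: "dt q t x = p t x" for t x
    by (rule C1_X_time_derivative[where r = 3 and q = q]) (auto intro: p(2,3) pX D(1))
  have \<kappa>1: "\<bar>\<kappa>\<bar> = 1" using \<kappa> by auto
  have xx: "norm (dx (dx q) t x) \<le> 2 * (A + B ^ 3)" if t: "\<bar>t\<bar> \<le> T" for t x
  proof -
    have "dx (dx q) t x = - 2 * \<i> * (dt q t x + \<i> * of_real \<kappa> * cubic (q t x))"
      unfolding D(4) by (simp add: algebra_simps)
    also have "norm \<dots> = 2 * norm (dt q t x + \<i> * of_real \<kappa> * cubic (q t x))"
      by (simp add: norm_mult)
    also have "\<dots> \<le> 2 * (A + B ^ 3)"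
    proof (intro mult_left_mono order_trans[OF norm_triangle_ineq] add_mono)
      show "norm (dt q t x) \<le> A" using A[OF t] by (simp add: dt)
      have "norm (\<i> * of_real \<kappa> * cubic (q t x)) = norm (q t x) ^ 3"
        using \<kappa>1 by (simp add: cubic_def norm_mult norm_power power3_eq_cube power2_eq_square)
      also have "\<dots> \<le> B ^ 3" using B[OF t] by (intro power_mono) auto
      finally show "norm (\<i> * of_real \<kappa> * cubic (q t x)) \<le> B ^ 3" .
    qed simp
    finally show ?thesis .
  qed
  have x: "norm (dx q t x) \<le> 2 * B + 2 * (A + B ^ 3)" if t: "\<bar>t\<bar> \<le> T" for t x
    by (rule landau_derivative_bound[OF D(2) D(3) B[OF t] xx[OF t]])
  show thesis
  proof (rule that[of "max 1 (max B (2 * B + 2 * (A + B ^ 3)))"])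
    fix t x assume t: "\<bar>t\<bar> \<le> T"
    show "norm (\<Phi> t f x) \<le> max 1 (max B (2 * B + 2 * (A + B ^ 3)))"
      using B[OF t, of x] unfolding q_def le_max_iff_disj by blast
    show "norm (dx (\<lambda>t. \<Phi> t f) t x) \<le> max 1 (max B (2 * B + 2 * (A + B ^ 3)))"
      using x[OF t, of x] unfolding q_def le_max_iff_disj by blast
  qed simp
qed

lemma flow_unique:
  assumes f: "f \<in> X_space \<sigma> 5" and v: "classical_solution \<kappa> v" "v 0 = f"
    and b: "\<And>T. \<exists>M. \<forall>t x. \<bar>t\<bar> \<le> T \<longrightarrow> norm (v t x) \<le> M \<and> norm (dx v t x) \<le> M"
  shows "v t = \<Phi> t f"
proof -
  have "bounded_on_strips v" "bounded_on_strips (dx v)"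
    unfolding bounded_on_strips_def
  proof (safe)
    fix T
    obtain M where M: "\<And>t x. \<bar>t\<bar> \<le> T \<Longrightarrow> norm (v t x) \<le> M \<and> norm (dx v t x) \<le> M" using b by blast
    show "bounded ((\<lambda>(t, x). v t x) ` ({-T..T} \<times> UNIV))" "bounded ((\<lambda>(t, x). dx v t x) ` ({-T..T} \<times> UNIV))"
      using M by (auto intro!: boundedI[of _ M] simp: abs_le_iff)
  qed
  then show ?thesis using flow_facts(6)[OF f v(1) _ _ v(2)] by metis
qed

text \<open>The shifted orbit solves the same autonomous, translation-invariant equation, and its
  bounds for \<open>\<bar>t\<bar> \<le> T\<close> come from the original orbit up to time
  \<open>T + \<bar>s\<bar>\<close>. Taking \<open>s = 0\<close> gives equivariance, and
  \<open>y = 0\<close> with opposite times gives the inverse.\<close>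

lemma flow_shift:
  assumes f: "f \<in> X_space \<sigma> 5"
  shows "translate y (\<Phi> (t + s) f) = \<Phi> t (translate y (\<Phi> s f))"
proof -
  define v where "v = (\<lambda>t x. \<Phi> (t + s) f (x + y))"
  note sh = classical_solution_shift[OF flow_facts(1)[OF f], of s y, folded v_def]
  have "v t = \<Phi> t (translate y (\<Phi> s f))"
  proof (rule flow_unique)
    show "translate y (\<Phi> s f) \<in> X_space \<sigma> 5" by (intro translate_X_space flow_facts f)
    show "classical_solution \<kappa> v" by (rule sh)
    show "v 0 = translate y (\<Phi> s f)" by (simp add: v_def translate_def)
    fix T
    obtain M where M: "\<And>t x. \<bar>t\<bar> \<le> T + \<bar>s\<bar> \<Longrightarrow> norm (\<Phi> t f x) \<le> M"
      "\<And>t x. \<bar>t\<bar> \<le> T + \<bar>s\<bar> \<Longrightarrow> norm (dx (\<lambda>t. \<Phi> t f) t x) \<le> M"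
      by (rule orbit_bounded[OF f, of "T + \<bar>s\<bar>"]) (use that in blast)
    show "\<exists>M. \<forall>t x. \<bar>t\<bar> \<le> T \<longrightarrow> norm (v t x) \<le> M \<and> norm (dx v t x) \<le> M"
    proof (intro exI allI impI conjI)
      fix t x assume "\<bar>t\<bar> \<le> T"
      then have "\<bar>t + s\<bar> \<le> T + \<bar>s\<bar>" by linarith
      then show "norm (v t x) \<le> M" "norm (dx v t x) \<le> M"
        unfolding sh(2) by (auto simp: v_def intro: M)
    qed
  qed
  then show ?thesis by (simp add: v_def translate_def)
qed

lemma flow_translate: "f \<in> X_space \<sigma> 5 \<Longrightarrow> \<Phi> t (translate y f) = translate y (\<Phi> t f)"
  using flow_shift[of f y t 0] by (simp add: flow_facts)

lemma flow_inverse: "f \<in> X_space \<sigma> 5 \<Longrightarrow> \<Phi> (- t) (\<Phi> t f) = f"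
  using flow_shift[of f 0 "- t" t] by (simp add: flow_facts translate_def)

text \<open>\<open>\<delta>\<close> precedes the shifts \<open>y\<close> and \<open>z\<close>,
  because translating an orbit does not change its bounds. With \<open>g = f\<close> the lemma
  compares translates of one orbit, as almost periodicity requires; with \<open>g\<close> in the
  hull of \<open>f\<close> it compares \<open>g\<close> with the translates approximating
  it.\<close>

lemma flow_stability:
  assumes f: "f \<in> X_space \<sigma> 5" and g: "g \<in> X_space \<sigma> 5" and \<eta>: "\<eta> > 0"
  obtains \<delta> where "\<delta> > 0"
    "\<And>y z x. (\<And>x. norm (f (x + y) - g (x + z)) \<le> \<delta>) \<Longrightarrow> norm (\<Phi> t f (x + y) - \<Phi> t g (x + z)) \<le> \<eta>"
proof -
  obtain M1 where M1: "M1 > 0" "\<And>s x. \<bar>s\<bar> \<le> \<bar>t\<bar> \<Longrightarrow> norm (\<Phi> s f x) \<le> M1"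
    "\<And>s x. \<bar>s\<bar> \<le> \<bar>t\<bar> \<Longrightarrow> norm (dx (\<lambda>t. \<Phi> t f) s x) \<le> M1"
    by (rule orbit_bounded[OF f, of "\<bar>t\<bar>"]) (use that in blast)
  obtain M2 where M2: "M2 > 0" "\<And>s x. \<bar>s\<bar> \<le> \<bar>t\<bar> \<Longrightarrow> norm (\<Phi> s g x) \<le> M2"
    "\<And>s x. \<bar>s\<bar> \<le> \<bar>t\<bar> \<Longrightarrow> norm (dx (\<lambda>t. \<Phi> t g) s x) \<le> M2"
    by (rule orbit_bounded[OF g, of "\<bar>t\<bar>"]) (use that in blast)
  have M: "max M1 M2 > 0" using M1 by simp
  obtain \<delta> where \<delta>: "\<delta> > 0" and stab:
    "\<And>\<kappa> u v s x. \<lbrakk>classical_solution \<kappa> u; classical_solution \<kappa> v; \<bar>\<kappa>\<bar> \<le> 1; \<bar>s\<bar> \<le> \<bar>t\<bar>;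
      \<And>s x. \<bar>s\<bar> \<le> \<bar>t\<bar> \<Longrightarrow> norm (u s x) \<le> max M1 M2; \<And>s x. \<bar>s\<bar> \<le> \<bar>t\<bar> \<Longrightarrow> norm (v s x) \<le> max M1 M2;
      \<And>s x. \<bar>s\<bar> \<le> \<bar>t\<bar> \<Longrightarrow> norm (dx u s x) \<le> max M1 M2; \<And>s x. \<bar>s\<bar> \<le> \<bar>t\<bar> \<Longrightarrow> norm (dx v s x) \<le> max M1 M2;
      \<And>x. norm (u 0 x - v 0 x) \<le> \<delta>\<rbrakk> \<Longrightarrow> norm (u s x - v s x) \<le> \<eta>"
    by (rule classical_solution_stability[OF M \<eta>, of "\<bar>t\<bar>"]) (use that in blast)
  show thesis
  proof (rule that[OF \<delta>])
    fix y z x assume close: "\<And>x. norm (f (x + y) - g (x + z)) \<le> \<delta>"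
    note sf = classical_solution_shift[OF flow_facts(1)[OF f], of 0 y, simplified]
    note sg = classical_solution_shift[OF flow_facts(1)[OF g], of 0 z, simplified]
    have "norm ((\<lambda>t x. \<Phi> t f (x + y)) t x - (\<lambda>t x. \<Phi> t g (x + z)) t x) \<le> \<eta>"
    proof (rule stab[OF sf(1) sg(1)])
      show "\<bar>\<kappa>\<bar> \<le> 1" using \<kappa> by auto
      show "norm (dx (\<lambda>t x. \<Phi> t f (x + y)) s x) \<le> max M1 M2" if "\<bar>s\<bar> \<le> \<bar>t\<bar>" for s x
        unfolding sf(2) using M1(3)[OF that] by (simp add: le_max_iff_disj)
      show "norm (dx (\<lambda>t x. \<Phi> t g (x + z)) s x) \<le> max M1 M2" if "\<bar>s\<bar> \<le> \<bar>t\<bar>" for s x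
        unfolding sg(2) using M2(3)[OF that] by (simp add: le_max_iff_disj)
    qed (use M1(2) M2(2) close in \<open>auto simp: flow_facts f g le_max_iff_disj\<close>)
    then show "norm (\<Phi> t f (x + y) - \<Phi> t g (x + z)) \<le> \<eta>" by simp
  qed
qed

text \<open>Stability with \<open>y = \<tau>\<close> and \<open>z = 0\<close> turns an almost period
  of \<open>f\<close> into one of \<open>\<Phi> t f\<close>, so the same finite subsets of the
  spectrum of \<open>f\<close> control both.\<close>

lemma flow_AP:
  assumes f: "f \<in> X_space \<sigma> 5" "f \<in> AP"
  shows "\<Phi> t f \<in> AP" "frequency_module (\<Phi> t f) \<subseteq> frequency_module f"
proof -
  obtain Bf where Bf: "continuous_on UNIV f" "\<And>x. norm (f x) \<le> Bf"
    by (rule bcontE[OF X_space_bcont[OF f(1)]]) (use that in blast)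
  obtain B where B: "continuous_on UNIV (\<Phi> t f)" "\<And>x. norm (\<Phi> t f x) \<le> B"
    by (rule bcontE[OF X_space_bcont[OF flow_facts(2)[OF f(1), of t]]]) (use that in blast)
  have ap: "\<exists>\<Lambda> \<delta>. finite \<Lambda> \<and> \<Lambda> \<subseteq> {\<omega>. bohr_coeff f \<omega> \<noteq> 0} \<and> \<delta> > 0 \<and> ap_modulus (\<Phi> t f) \<Lambda> \<delta> \<eta>"
    if \<eta>: "\<eta> > 0" for \<eta> :: real
  proof -
    obtain \<delta> where \<delta>: "\<delta> > 0" and stab:
      "\<And>y z x. (\<And>x. norm (f (x + y) - f (x + z)) \<le> \<delta>) \<Longrightarrow> norm (\<Phi> t f (x + y) - \<Phi> t f (x + z)) \<le> \<eta>"
      by (rule flow_stability[OF f(1) f(1) \<eta>, of t]) (use that in blast)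
    obtain \<Lambda> \<delta>' where \<Lambda>: "finite \<Lambda>" "\<Lambda> \<subseteq> {\<omega>. bohr_coeff f \<omega> \<noteq> 0}" "\<delta>' > 0" "ap_modulus f \<Lambda> \<delta>' \<delta>"
      by (rule AP_ap_modulus[OF f(2) Bf \<delta>]) (use that in blast)
    have "ap_modulus (\<Phi> t f) \<Lambda> \<delta>' \<eta>"
      unfolding ap_modulus_def
    proof (intro allI impI)
      fix \<tau> x assume "\<forall>\<omega>\<in>\<Lambda>. norm (chr \<omega> \<tau> - 1) \<le> \<delta>'"
      then have "norm (f (x + \<tau>) - f (x + 0)) \<le> \<delta>" for x
        using \<Lambda>(4) by (simp add: ap_modulus_def)
      then have "norm (\<Phi> t f (x + \<tau>) - \<Phi> t f (x + 0)) \<le> \<eta>" by (rule stab)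
      then show "norm (\<Phi> t f (x + \<tau>) - \<Phi> t f x) \<le> \<eta>" by simp
    qed
    then show ?thesis using \<Lambda> by blast
  qed
  show "\<Phi> t f \<in> AP" "frequency_module (\<Phi> t f) \<subseteq> frequency_module f"
    using AP_of_ap_modulus[OF B ap] by (auto simp: frequency_module_def)
qed

lemma flow_hull:
  assumes f: "f \<in> X_space \<sigma> 5" and g: "g \<in> translation_hull \<sigma> f"
  shows "\<Phi> t g \<in> translation_hull \<sigma> (\<Phi> t f)"
proof -
  note gX = hull_memD(1)[OF f g]
  show ?thesis
  proof (rule hull_memI)
    fix \<eta> :: real assume \<eta>: "\<eta> > 0"
    obtain \<delta> where \<delta>: "\<delta> > 0" and stab:
      "\<And>y z x. (\<And>x. norm (f (x + y) - g (x + z)) \<le> \<delta>) \<Longrightarrow> norm (\<Phi> t f (x + y) - \<Phi> t g (x + z)) \<le> \<eta>"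
      by (rule flow_stability[OF f gX \<eta>, of t]) (use that in blast)
    obtain y where y: "\<And>x. norm (f (x + y) - g (x + 0)) \<le> \<delta>" using hull_memD(2)[OF f g \<delta>] by auto
    have "norm (\<Phi> t f (x + y) - \<Phi> t g (x + 0)) \<le> \<eta>" for x by (rule stab) (rule y)
    then show "\<exists>y. \<forall>x. norm (\<Phi> t f (x + y) - \<Phi> t g x) \<le> \<eta>" by auto
  qed (intro flow_facts f gX)+
qed

text \<open>The common \<open>\<delta>\<close> comes from comparing translates of \<open>f\<close>
  only. Each hull element is replaced by a translate that is near it both at time \<open>0\<close>
  and at time \<open>t\<close>, with a closeness that may depend on the element; the three errors
  then add up. In this way the orbits starting in the hull never have to be bounded
  simultaneously.\<close>

lemma flow_hull_uniform:
  assumes f: "f \<in> X_space \<sigma> 5" and \<eta>: "\<eta> > 0"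
  obtains \<delta> where "\<delta> > 0"
    "\<And>g h x. \<lbrakk>g \<in> translation_hull \<sigma> f; h \<in> translation_hull \<sigma> f; \<And>x. norm (g x - h x) \<le> \<delta>\<rbrakk> \<Longrightarrow>
      norm (\<Phi> t g x - \<Phi> t h x) \<le> \<eta>"
proof -
  obtain \<delta> where \<delta>: "\<delta> > 0" and stab:
    "\<And>y z x. (\<And>x. norm (f (x + y) - f (x + z)) \<le> \<delta>) \<Longrightarrow> norm (\<Phi> t f (x + y) - \<Phi> t f (x + z)) \<le> \<eta> / 3"
    by (rule flow_stability[OF f f, of "\<eta> / 3" t]) (use that \<eta> in auto)
  have approx: "\<exists>y. (\<forall>x. norm (f (x + y) - g x) \<le> \<delta> / 3) \<and> (\<forall>x. norm (\<Phi> t f (x + y) - \<Phi> t g x) \<le> \<eta> / 3)"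
    if g: "g \<in> translation_hull \<sigma> f" for g
  proof -
    obtain d where d: "d > 0" and stab_g:
      "\<And>y z x. (\<And>x. norm (f (x + y) - g (x + z)) \<le> d) \<Longrightarrow> norm (\<Phi> t f (x + y) - \<Phi> t g (x + z)) \<le> \<eta> / 3"
      by (rule flow_stability[OF f hull_memD(1)[OF f g], of "\<eta> / 3" t]) (use that \<eta> in auto)
    obtain y where y: "\<And>x. norm (f (x + y) - g x) \<le> min d (\<delta> / 3)"
      using hull_memD(2)[OF f g, of "min d (\<delta> / 3)"] d \<delta> by auto
    then have y': "norm (f (x + y) - g (x + 0)) \<le> d" for x by simp
    have "norm (\<Phi> t f (x + y) - \<Phi> t g (x + 0)) \<le> \<eta> / 3" for x by (rule stab_g) (rule y')
    with y show ?thesis by (intro exI[of _ y]) auto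
  qed
  show thesis
  proof (rule that[of "\<delta> / 3"])
    fix g h x assume gh: "g \<in> translation_hull \<sigma> f" "h \<in> translation_hull \<sigma> f"
      and d: "\<And>x. norm (g x - h x) \<le> \<delta> / 3"
    obtain y where y: "\<And>x. norm (f (x + y) - g x) \<le> \<delta> / 3" "\<And>x. norm (\<Phi> t f (x + y) - \<Phi> t g x) \<le> \<eta> / 3"
      using approx[OF gh(1)] by blast
    obtain z where z: "\<And>x. norm (f (x + z) - h x) \<le> \<delta> / 3" "\<And>x. norm (\<Phi> t f (x + z) - \<Phi> t h x) \<le> \<eta> / 3"
      using approx[OF gh(2)] by blast
    have three: "norm (a - b) \<le> e" if "norm (a - c) \<le> e / 3" "norm (c - d) \<le> e / 3" "norm (b - d) \<le> e / 3"
      for a b c d :: complex and e :: real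
    proof -
      have "a - b = (a - c) + (c - d) - (b - d)" by simp
      also have "norm \<dots> \<le> norm (a - c) + norm (c - d) + norm (b - d)"
        by (meson norm_triangle_ineq norm_triangle_ineq4 add_mono order_refl order_trans)
      finally show ?thesis using that by linarith
    qed
    have yz: "norm (f (x + y) - f (x + z)) \<le> \<delta>" for x
      by (rule three[OF y(1) d z(1)])
    have mid: "norm (\<Phi> t f (x + y) - \<Phi> t f (x + z)) \<le> \<eta> / 3" by (rule stab) (rule yz)
    show "norm (\<Phi> t g x - \<Phi> t h x) \<le> \<eta>"
      by (rule three[of _ "\<Phi> t f (x + y)" _ "\<Phi> t f (x + z)"])
        (use mid y(2)[of x] z(2)[of x] in \<open>simp_all add: norm_minus_commute\<close>)
  qed (use \<delta> in simp)
qed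

text \<open>Closeness in \<open>X\<close> implies uniform closeness, which the flow respects
  uniformly on the hull. The images lie in the hull of \<open>\<Phi> t f\<close>, where the box
  bounds of \<open>\<Phi> t f\<close> turn uniform closeness back into closeness in
  \<open>X\<close>.\<close>

lemma flow_hull_continuous:
  assumes f: "f \<in> X_space \<sigma> 5"
  shows "continuous_map (subtopology (X_topology \<sigma> 5) (translation_hull \<sigma> f))
    (subtopology (X_topology \<sigma> 5) (translation_hull \<sigma> (\<Phi> t f))) (\<Phi> t)"
proof -
  interpret Metric_space "X_space \<sigma> 5" "X_dist \<sigma> 5" by (rule X_metric_space) simp
  define g where "g = \<Phi> t f"
  have g: "g \<in> X_space \<sigma> 5" unfolding g_def by (rule flow_facts(2)[OF f])
  \<comment> \<open>Presents the subspace topologies as metric topologies, so that the epsilon-delta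
    criterion applies.\<close>
  interpret Hf: Submetric "X_space \<sigma> 5" "X_dist \<sigma> 5" "translation_hull \<sigma> f"
    by unfold_locales (use hull_memD(1)[OF f] in blast)
  interpret Hg: Submetric "X_space \<sigma> 5" "X_dist \<sigma> 5" "translation_hull \<sigma> g"
    by unfold_locales (use hull_memD(1)[OF g] in blast)
  have "continuous_map Hf.sub.mtopology Hg.sub.mtopology (\<Phi> t)"
    unfolding Hf.sub.metric_continuous_map[OF Hg.sub.Metric_space_axioms]
  proof (intro conjI ballI allI impI)
    show "\<Phi> t ` translation_hull \<sigma> f \<subseteq> translation_hull \<sigma> g"
      using flow_hull[OF f] by (auto simp: g_def)
    fix a and \<epsilon> :: real assume a: "a \<in> translation_hull \<sigma> f" and \<epsilon>: "\<epsilon> > 0"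
    obtain \<delta> where \<delta>: "\<delta> > 0" and small:
      "\<And>h h'. \<lbrakk>bcont h; bcont h'; \<And>k. box_norm k h \<le> box_norm k g; \<And>k. box_norm k h' \<le> box_norm k g;
        \<And>x. norm (h x - h' x) \<le> \<delta>\<rbrakk> \<Longrightarrow> X_norm \<sigma> 5 (\<lambda>x. h x - h' x) \<le> ennreal (\<epsilon> / 2)"
      by (rule X_norm_small_if_uniformly_small[OF X_space_bcont[OF g], of 5 "\<epsilon> / 2"])
        (use g \<epsilon> that in \<open>auto simp: X_space_iff\<close>)
    obtain \<delta>' where \<delta>': "\<delta>' > 0" and unif:
      "\<And>g h x. \<lbrakk>g \<in> translation_hull \<sigma> f; h \<in> translation_hull \<sigma> f; \<And>x. norm (g x - h x) \<le> \<delta>'\<rbrakk> \<Longrightarrow>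
        norm (\<Phi> t g x - \<Phi> t h x) \<le> \<delta>"
      by (rule flow_hull_uniform[OF f \<delta>, of t]) (use that in blast)
    show "\<exists>\<delta>>0. \<forall>x. x \<in> translation_hull \<sigma> f \<and> X_dist \<sigma> 5 a x < \<delta> \<longrightarrow> X_dist \<sigma> 5 (\<Phi> t a) (\<Phi> t x) < \<epsilon>"
    proof (intro exI[of _ \<delta>'] conjI allI impI \<delta>', elim conjE)
      fix b assume b: "b \<in> translation_hull \<sigma> f" "X_dist \<sigma> 5 a b < \<delta>'"
      have ab: "norm (a x - b x) \<le> \<delta>'" for x
        using sup_diff_le_X_dist[OF hull_memD(1)[OF f a] hull_memD(1)[OF f b(1)], of x] b(2) by simp
      have close: "norm (\<Phi> t a x - \<Phi> t b x) \<le> \<delta>" for x by (rule unif[OF a b(1)]) (rule ab)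
      have a': "\<Phi> t a \<in> translation_hull \<sigma> g" and b': "\<Phi> t b \<in> translation_hull \<sigma> g"
        using flow_hull[OF f] a b(1) by (auto simp: g_def)
      have "X_norm \<sigma> 5 (\<lambda>x. \<Phi> t a x - \<Phi> t b x) \<le> ennreal (\<epsilon> / 2)"
        by (intro small close hull_memD(3)[OF g a'] hull_memD(3)[OF g b']
            X_space_bcont[OF hull_memD(1)[OF g a']] X_space_bcont[OF hull_memD(1)[OF g b']])
      then have "X_dist \<sigma> 5 (\<Phi> t a) (\<Phi> t b) \<le> enn2real (ennreal (\<epsilon> / 2))"
        unfolding X_dist_def by (intro enn2real_mono) auto
      then show "X_dist \<sigma> 5 (\<Phi> t a) (\<Phi> t b) < \<epsilon>" using \<epsilon> by simp
    qed
  qed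
  from this[unfolded Hf.mtopology_submetric Hg.mtopology_submetric] show ?thesis
    by (simp only: X_topology_def g_def)
qed

text \<open>The inverse is \<open>\<Phi> (- t)\<close>, continuous by the same result for the datum
  \<open>\<Phi> t f\<close>, which \<open>\<Phi> (- t)\<close> sends back to
  \<open>f\<close>.\<close>

lemma flow_hull_homeomorphic:
  assumes f: "f \<in> X_space \<sigma> 5"
  shows "homeomorphic_map (subtopology (X_topology \<sigma> 5) (translation_hull \<sigma> f))
    (subtopology (X_topology \<sigma> 5) (translation_hull \<sigma> (\<Phi> t f))) (\<Phi> t)"
proof -
  have "continuous_map (subtopology (X_topology \<sigma> 5) (translation_hull \<sigma> (\<Phi> t f)))
      (subtopology (X_topology \<sigma> 5) (translation_hull \<sigma> f)) (\<Phi> (- t))"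
    using flow_hull_continuous[OF flow_facts(2)[OF f, of t], of "- t"] by (simp add: flow_inverse f)
  moreover have "\<Phi> (- t) (\<Phi> t g) = g" "\<Phi> t (\<Phi> (- t) g) = g" if "g \<in> X_space \<sigma> 5" for g
    using flow_inverse[OF that, of t] flow_inverse[OF that, of "- t"] by simp_all
  ultimately have "homeomorphic_maps (subtopology (X_topology \<sigma> 5) (translation_hull \<sigma> f))
    (subtopology (X_topology \<sigma> 5) (translation_hull \<sigma> (\<Phi> t f))) (\<Phi> t) (\<Phi> (- t))"
    unfolding homeomorphic_maps_def
    using flow_hull_continuous[OF f] hull_memD(1)[OF f] hull_memD(1)[OF flow_facts(2)[OF f]]
    by auto
  then show ?thesis by (auto simp: homeomorphic_map_maps)
qed

end

theorem theorem8:
  fixes \<sigma> :: "real \<Rightarrow> real" and \<kappa> :: real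
    and \<Phi> :: "real \<Rightarrow> (real \<Rightarrow> complex) \<Rightarrow> (real \<Rightarrow> complex)"
    and q0 :: "real \<Rightarrow> complex"
  assumes "uniform_cutoff \<sigma>"
    and "\<kappa> \<in> {1, -1}"
    and "nls_flow \<sigma> \<kappa> \<Phi>"
    and "q0 \<in> X_space \<sigma> 5 \<inter> AP"
  shows "(\<forall>t. \<Phi> t q0 \<in> X_space \<sigma> 5 \<inter> AP) \<and>
    (\<forall>t. frequency_module (\<Phi> t q0) = frequency_module q0) \<and>
    (\<forall>t. homeomorphic_map
           (subtopology (X_topology \<sigma> 5) (translation_hull \<sigma> q0))
           (subtopology (X_topology \<sigma> 5) (translation_hull \<sigma> (\<Phi> t q0))) (\<Phi> t)) \<and>
    (\<forall>t y. \<forall>f \<in> X_space \<sigma> 5. \<Phi> t (translate y f) = translate y (\<Phi> t f))"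
proof -
  interpret nls \<sigma> \<kappa> \<Phi> using assms by unfold_locales
  have q0: "q0 \<in> X_space \<sigma> 5" "q0 \<in> AP" using assms(4) by auto
  \<comment> \<open>The forward inclusion for the datum \<open>\<Phi> t q0\<close>, already known to
    be almost periodic, under \<open>\<Phi> (- t)\<close>.\<close>
  have "frequency_module q0 \<subseteq> frequency_module (\<Phi> t q0)" for t
    using flow_AP(2)[OF flow_facts(2)[OF q0(1), of t] flow_AP(1)[OF q0], of "- t"]
    by (simp add: flow_inverse q0)
  then show ?thesis
    using flow_AP[OF q0] flow_facts(2)[OF q0(1)] flow_hull_homeomorphic[OF q0(1)] flow_translate
    by blast
qed

end
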